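(* Let $\alpha>0$ be a real number. Let $f\colon\mathbb{N}\to[0,\infty)$ be a multiplicative function such that $f(n)\le d_k(n)$ for all $n$, for some fixed integer $k\in\mathbb{N}$, and such that $f(p)=\alpha$ for all primes $p$. Let $F\colon\mathbb{R}\to\mathbb{C}$ be continuous with compact support. If $S$ is a set of primes having natural density $\delta(S)$, then \[ \lim_{x \to \infty} \Big(\sum_{1\le n\le x}f(n)\Big)^{-1}\sum_{\substack{1\le n\le x\\ P^+(n)\in S}}f(n)\, F\Big( \frac{\Omega(n) - \alpha\log \log x }{\sqrt{\alpha\log \log x}} \Big) =\delta(S)\cdot\Big(\frac{1}{\sqrt{2\pi}} \int_{-\infty}^{\infty} F(t) e^{-t^2/2} \, dt\Big). \]
   Context: $d_k(n)=\#\{(a_1,\dots,a_k)\in\mathbb{N}^k: a_1\cdots a_k=n\}$ is the $k$-th divisor function. $\Omega(n)$ is the number of prime factors of $n$ counted with multiplicity. $P^+(n)$ is the largest prime factor of $n$ for $n\ge 2$, and $P^+(1)=1$. A set $S$ of primes has natural density $\delta(S)$ if $\lim_{x\to\infty}\#\{p\in S: p\le x\}/\#\{p: p\le x\}$ exists and equals $\delta(S)$. *)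

theory Defs
  imports "HOL-Analysis.Analysis" "HOL-Computational_Algebra.Primes"
begin

text \<open>
  Arithmetic functions on the positive integers are functions \<open>nat \<Rightarrow> _\<close> whose value
  at \<open>0\<close> is irrelevant.
\<close>

definition multiplicative :: "(nat \<Rightarrow> real) \<Rightarrow> bool" where
  "multiplicative f \<longleftrightarrow>
     f 1 = 1 \<and> (\<forall>m>0. \<forall>n>0. coprime m n \<longrightarrow> f (m * n) = f m * f n)"

definition divisor_fun :: "nat \<Rightarrow> nat \<Rightarrow> nat" where
  "divisor_fun k n = card {as. length as = k \<and> (\<forall>a\<in>set as. 0 < a) \<and> prod_list as = n}"

lemma finite_divisor_fun_tuples:
  "finite {as. length as = k \<and> (\<forall>a\<in>set as. 0 < (a::nat)) \<and> prod_list as = n}"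
proof (rule finite_subset)
  have "a \<le> prod_list as" if "a \<in> set as" "\<forall>a\<in>set as. 0 < a" for a :: nat and as
  proof (rule dvd_imp_le)
    show "a dvd prod_list as"
      using that(1) by (rule prod_list_dvd)
    show "0 < prod_list as"
      using that(2) by (induction as) auto
  qed
  then show "{as. length as = k \<and> (\<forall>a\<in>set as. 0 < (a::nat)) \<and> prod_list as = n}
      \<subseteq> {as. set as \<subseteq> {..n} \<and> length as = k}"
    by auto
qed (simp add: finite_lists_length_eq)

definition prime_Omega :: "nat \<Rightarrow> nat" where
  "prime_Omega n = size (prime_factorization n)"

definition largest_prime_factor :: "nat \<Rightarrow> nat" where
  "largest_prime_factor n = (if n \<le> 1 then 1 else Max (prime_factors n))"

text \<open>The denominator vanishes only for \<open>x < 2\<close>, so the limit is unaffected by it.\<close>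

definition has_natural_density :: "nat set \<Rightarrow> real \<Rightarrow> bool" where
  "has_natural_density S d \<longleftrightarrow>
     ((\<lambda>x::real. real (card {p \<in> S. real p \<le> x}) / real (card {p::nat. prime p \<and> real p \<le> x}))
        \<longlongrightarrow> d) at_top"

end

theory Submission
  imports Defs "HOL-Number_Theory.Number_Theory" "HOL-Probability.Probability"
    "HOL-Computational_Algebra.Squarefree" "HOL-Real_Asymp.Real_Asymp"
begin

text \<open>
  Write \<open>S(h, x) = (\<Sum>n\<le>x. f n * h n)\<close> with \<open>h\<close> a bounded function of the normalised \<open>\<Omega>\<close>, centred by its Gaussian
  mean. The convolutions of \<open>f\<close> with \<open>\<Lambda>\<close> give identities expressing \<open>ln x * S(h, x)\<close>, and a second-order version
  of it, through averages of \<open>S(h, y)\<close> over smaller \<open>y\<close>. The prime number theorem is avoided: Selberg's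
  symmetry formula controls the sum of the two averaging operators involved, so that
  \<open>limsup |S(h, x)| / S(x)\<close> is bounded by a fixed multiple \<open>\<kappa> < 1\<close> of itself and hence vanishes, provided that
  the logarithmic averages of \<open>h\<close> vanish. For those one passes to the Dirichlet weights \<open>f n / n powr \<sigma>\<close>,
  whose Euler product yields the characteristic function of \<open>\<Omega>\<close> and thus a central limit theorem.

  For the largest prime factor write \<open>n = m * p\<close> with \<open>p = P\<^sup>+(n)\<close>; outside a negligible set \<open>p\<close> is large and
  does not divide \<open>m\<close>. For fixed \<open>m\<close> the prime \<open>p\<close> runs through an interval, in which the density of the
  given primes is \<open>\<delta>\<close> on average, while \<open>\<Omega>(n) = \<Omega>(m) + 1\<close> does not depend on \<open>p\<close>.
\<close>

text \<open>The first-order identity alone cannot contract: for \<open>h = 1\<close> it shows that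
  its averaging operator reproduces \<open>S\<close> to leading order. In the second-order identity
  the two operators carry the weights \<alpha> and \<alpha> squared, while Selberg's formula
  evaluates their sum with equal weights; subtracting the smaller multiple of that sum leaves a
  single positive operator with a reduced coefficient. Two obstacles shape the rest. The function
  \<open>h\<close> depends on \<open>x\<close> through the centring, so a bound at \<open>y\<close>
  is carried over to \<open>x\<close> only for \<open>y\<close> between
  \<open>x powr \<theta>\<close> and \<open>x\<close>, where ln ln hardly moves; smaller
  \<open>y\<close> contribute a proportion of order \<open>\<theta> powr \<alpha>\<close>. And the
  logarithmic averages are finite sums, while the Euler product describes Dirichlet series to the
  right of 1; Karamata's polynomial approximation, with the exponents \<sigma> = 1 + i / ln x,
  closes this gap. The sizes of \<open>S\<close> and of the logarithmic sum \<open>A\<close> enter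
  through upper and lower bounds of matching order, x * (ln x) powr (\<alpha> - 1) and (ln x) powr
  \<alpha>.\<close>

section \<open>Sums over the positive integers up to a real bound\<close>

definition nats_le :: "real \<Rightarrow> nat set" where
  "nats_le x = {n. 1 \<le> n \<and> real n \<le> x}"

lemma nats_le_eq: "nats_le x = {1..nat \<lfloor>x\<rfloor>}"
proof (intro equalityI subsetI)
  fix n assume "n \<in> nats_le x"
  thus "n \<in> {1..nat \<lfloor>x\<rfloor>}" by (simp add: nats_le_def le_nat_floor)
next
  fix n assume n: "n \<in> {1..nat \<lfloor>x\<rfloor>}"
  hence "\<lfloor>x\<rfloor> \<ge> int n" by (simp add: nat_le_iff le_nat_iff) linarith
  hence "real n \<le> x" by linarith
  thus "n \<in> nats_le x" using n by (simp add: nats_le_def)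
qed

lemma finite_nats_le [simp, intro]: "finite (nats_le x)"
  by (simp add: nats_le_eq)

lemma mem_nats_le: "n \<in> nats_le x \<longleftrightarrow> 1 \<le> n \<and> real n \<le> x"
  by (simp add: nats_le_def)

lemma nats_le_mono: "x \<le> y \<Longrightarrow> nats_le x \<subseteq> nats_le y"
  by (auto simp: mem_nats_le)

lemma nats_le_less_one: "x < 1 \<Longrightarrow> nats_le x = {}"
  by (auto simp: mem_nats_le)

lemma nats_le_of_nat [simp]: "nats_le (real n) = {1..n}"
  by (auto simp: mem_nats_le)

lemma one_mem_nats_le: "x \<ge> 1 \<Longrightarrow> 1 \<in> nats_le x"
  by (auto simp: mem_nats_le)

lemma card_nats_le: "x \<ge> 0 \<Longrightarrow> real (card (nats_le x)) = of_int \<lfloor>x\<rfloor>"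
  by (simp add: nats_le_eq)

lemma nats_le_divI: "d \<in> nats_le x \<Longrightarrow> x / real d \<ge> 1"
  by (auto simp: mem_nats_le field_simps)

text \<open>The region under the hyperbola in symmetric form. With real cut-offs
  \<open>x / real d\<close> is again an admissible bound, so convolution sums can be nested and
  interchanged.\<close>

lemma Sigma_nats_le_eq: "(SIGMA d:nats_le x. nats_le (x / real d)) = {(d, m). 1 \<le> d \<and> 1 \<le> m \<and> real d * real m \<le> x}"
proof -
  have "real d \<le> x" if "1 \<le> d" "1 \<le> m" "real d * real m \<le> x" for d m :: nat
    using that mult_left_mono[of 1 "real m" "real d"] by linarith
  thus ?thesis by (auto simp: mem_nats_le field_simps)
qed

lemma sum_nats_le_swap:
  fixes g :: "nat \<Rightarrow> nat \<Rightarrow> 'a :: comm_monoid_add"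
  shows "(\<Sum>d\<in>nats_le x. \<Sum>m\<in>nats_le (x / real d). g d m) = (\<Sum>m\<in>nats_le x. \<Sum>d\<in>nats_le (x / real m). g d m)"
  unfolding sum.Sigma[OF finite_nats_le ballI[OF finite_nats_le]] Sigma_nats_le_eq
  by (rule sum.reindex_bij_witness[of _ "\<lambda>(a,b). (b,a)" "\<lambda>(a,b). (b,a)"]) (auto simp: mult.commute)

lemma sum_nats_le_divisors:
  fixes g :: "nat \<Rightarrow> nat \<Rightarrow> 'a :: comm_monoid_add"
  shows "(\<Sum>n\<in>nats_le x. \<Sum>d | d dvd n. g d n) = (\<Sum>d\<in>nats_le x. \<Sum>m\<in>nats_le (x / real d). g d (d * m))"
proof -
  have "(\<Sum>n\<in>nats_le x. \<Sum>d | d dvd n. g d n) = (\<Sum>(n,d)\<in>(SIGMA n:nats_le x. {d. d dvd n}). g d n)"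
    by (rule sum.Sigma) (auto simp: mem_nats_le)
  also have "\<dots> = (\<Sum>(d,m)\<in>(SIGMA d:nats_le x. nats_le (x / real d)). g d (d * m))"
    unfolding Sigma_nats_le_eq
    by (rule sum.reindex_bij_witness[of _ "\<lambda>(d,m). (d * m, d)" "\<lambda>(n,d). (d, n div d)"])
       (auto simp: mem_nats_le elim!: dvdE simp flip: of_nat_mult)
  also have "\<dots> = (\<Sum>d\<in>nats_le x. \<Sum>m\<in>nats_le (x / real d). g d (d * m))"
    by (rule sum.Sigma[symmetric]) auto
  finally show ?thesis .
qed

lemma sum_nats_le_triple:
  fixes g :: "nat \<Rightarrow> nat \<Rightarrow> nat \<Rightarrow> 'a :: comm_monoid_add"
  shows "(\<Sum>m\<in>nats_le x. \<Sum>d\<in>nats_le (x / real m). \<Sum>e\<in>nats_le (x / real m / real d). g m d e)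
       = (\<Sum>d\<in>nats_le x. \<Sum>e\<in>nats_le (x / real d). \<Sum>m\<in>nats_le (x / real d / real e). g m d e)"
proof -
  have "(\<Sum>m\<in>nats_le x. \<Sum>d\<in>nats_le (x / real m). \<Sum>e\<in>nats_le (x / real m / real d). g m d e)
      = (\<Sum>d\<in>nats_le x. \<Sum>m\<in>nats_le (x / real d). \<Sum>e\<in>nats_le (x / real m / real d). g m d e)"
    by (rule sum_nats_le_swap)
  also have "\<dots> = (\<Sum>d\<in>nats_le x. \<Sum>m\<in>nats_le (x / real d). \<Sum>e\<in>nats_le (x / real d / real m). g m d e)"
    by (simp add: field_simps)
  also have "\<dots> = (\<Sum>d\<in>nats_le x. \<Sum>e\<in>nats_le (x / real d). \<Sum>m\<in>nats_le (x / real d / real e). g m d e)"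
    by (intro sum.cong refl sum_nats_le_swap)
  finally show ?thesis .
qed

section \<open>Chebyshev and Mertens estimates\<close>

definition psi :: "real \<Rightarrow> real" where
  "psi x = (\<Sum>n\<in>nats_le x. mangoldt n)"

lemma psi_nonneg: "psi x \<ge> 0"
  unfolding psi_def by (intro sum_nonneg mangoldt_nonneg)

text \<open>Stirling's formula to first order, by induction: the increment ln (n + 1) - ln n lies
  between 1 / (n + 1) and 1 / n, and each of these two bounds settles one inequality.\<close>

lemma sum_ln_nat_bounds:
  fixes n :: nat assumes "n \<ge> 1"
  shows "n * ln n - n + 1 \<le> (\<Sum>k\<in>{1..n}. ln (real k))"
    and "(\<Sum>k\<in>{1..n}. ln (real k)) \<le> n * ln n - n + 1 + ln n"
proof -
  have "n * ln n - n + 1 \<le> (\<Sum>k\<in>{1..n}. ln (real k)) \<and> (\<Sum>k\<in>{1..n}. ln (real k)) \<le> n * ln n - n + 1 + ln n"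
    using assms
  proof (induction n rule: nat_induct_at_least)
    case base then show ?case by simp
  next
    case (Suc n)
    define a where "a = ln (real (Suc n)) - ln (real n)"
    have n: "real n \<ge> 1" using Suc by simp
    have a: "a = ln (1 + 1 / n)"
      unfolding a_def using n ln_div[of "1 + real n" "real n"] by (simp add: field_simps)
    have "a \<le> 1 / n" unfolding a using n by (intro ln_add_one_self_le_self) auto
    hence 1: "n * a \<le> 1" using n by (simp add: field_simps)
    have "-a = ln (real n) - ln (real (Suc n))" by (simp add: a_def)
    also have "\<dots> = ln (1 + (- 1 / Suc n))"
      using n ln_div[of "real n" "1 + real n"] by (simp add: field_simps)
    also have "\<dots> \<le> - 1 / Suc n" by (rule ln_add_one_self_le_self2) (use n in \<open>auto simp: field_simps\<close>)
    finally have 2: "(n + 1) * a \<ge> 1" using n by (simp add: field_simps)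
    have "ln (real (Suc n)) = a + ln n" by (simp add: a_def)
    with Suc.IH 1 2 show ?case by (simp add: algebra_simps)
  qed
  thus "n * ln n - n + 1 \<le> (\<Sum>k\<in>{1..n}. ln (real k))"
    and "(\<Sum>k\<in>{1..n}. ln (real k)) \<le> n * ln n - n + 1 + ln n" by auto
qed

lemma sum_ln_nats_le:
  assumes "x \<ge> 1"
  shows "\<bar>(\<Sum>n\<in>nats_le x. ln (real n)) - (x * ln x - x)\<bar> \<le> 1 + ln x"
proof -
  define n where "n = nat \<lfloor>x\<rfloor>"
  have n: "n \<ge> 1" "real n \<le> x" "x \<le> n + 1"
    using assms by (auto simp: n_def le_nat_iff le_floor_iff) linarith+
  have T: "(\<Sum>n\<in>nats_le x. ln (real n)) = (\<Sum>k\<in>{1..n}. ln (real k))"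
    by (simp add: nats_le_eq n_def)
  define a where "a = ln x - ln n"
  have a: "a = ln (x / n)" using n assms by (simp add: a_def ln_div)
  have "a \<le> x / n - 1" unfolding a using n assms by (intro ln_le_minus_one) auto
  hence 1: "n * a \<le> x - n" using n by (simp add: field_simps)
  have "-a = ln (n / x)" using n assms by (simp add: a_def ln_div)
  also have "\<dots> \<le> n / x - 1" using n assms by (intro ln_le_minus_one) auto
  finally have 2: "x * a \<ge> x - n" using n assms by (simp add: field_simps)
  have l: "ln x \<ge> 0" "ln n \<ge> 0" "ln n \<le> ln x" using n assms by auto
  have 3: "(x - n) * ln x \<le> 1 * ln x" using n l by (intro mult_right_mono) auto
  have 4: "(x - n) * ln n \<ge> 0" using n l by simp
  have e: "ln x = a + ln n" by (simp add: a_def)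
  have "x * ln x - x - (n * ln n - n) \<le> ln x"
    using 1 3 unfolding e by (simp add: algebra_simps)
  moreover have "x * ln x - x - (n * ln n - n) \<ge> 0"
    using 2 4 unfolding e by (simp add: algebra_simps)
  ultimately show ?thesis unfolding T using sum_ln_nat_bounds[OF n(1)] l by linarith
qed

lemma sum_ln_nats_le_eq_psi: "(\<Sum>n\<in>nats_le x. ln (real n)) = (\<Sum>d\<in>nats_le x. psi (x / real d))"
proof -
  have "(\<Sum>n\<in>nats_le x. ln (real n)) = (\<Sum>n\<in>nats_le x. \<Sum>d | d dvd n. mangoldt d)"
    by (intro sum.cong refl, subst mangoldt_sum) (auto simp: mem_nats_le)
  also have "\<dots> = (\<Sum>d\<in>nats_le x. psi (x / real d))"
    unfolding sum_nats_le_divisors psi_def by (rule sum_nats_le_swap)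
  finally show ?thesis .
qed

lemma sum_ln_nats_le_eq_floor: "(\<Sum>n\<in>nats_le x. ln (real n)) = (\<Sum>d\<in>nats_le x. mangoldt d * of_int \<lfloor>x / real d\<rfloor>)"
proof -
  have "(\<Sum>n\<in>nats_le x. ln (real n)) = (\<Sum>n\<in>nats_le x. \<Sum>d | d dvd n. mangoldt d)"
    by (intro sum.cong refl, subst mangoldt_sum) (auto simp: mem_nats_le)
  also have "\<dots> = (\<Sum>d\<in>nats_le x. mangoldt d * of_int \<lfloor>x / real d\<rfloor>)"
    unfolding sum_nats_le_divisors using nats_le_divI
    by (intro sum.cong refl) (force simp: card_nats_le[symmetric])
  finally show ?thesis .
qed

text \<open>Chebyshev's argument: floor u - 2 * floor (u / 2) is never negative and is at least 1
  for 1 \<le> u < 2. Hence the prime powers between x / 2 and x are dominated by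
  \<open>T x - 2 * T (x / 2)\<close>, which Stirling evaluates as x * ln 2 up to a logarithmic
  error.\<close>

lemma psi_diff_le:
  assumes "x \<ge> 1"
  shows "psi x - psi (x / 2) \<le> 4 * x"
proof (cases "x < 2")
  case True
  hence "nats_le x = {1}" using assms by (auto simp: mem_nats_le)
  hence "psi x = 0" by (simp add: psi_def)
  thus ?thesis using psi_nonneg[of "x/2"] assms by simp
next
  case False
  define T where "T y = (\<Sum>n\<in>nats_le y. ln (real n))" for y
  have sub: "nats_le (x / 2) \<subseteq> nats_le x" using assms by (intro nats_le_mono) auto
  have T2: "T (x / 2) = (\<Sum>d\<in>nats_le x. mangoldt d * of_int \<lfloor>x / 2 / real d\<rfloor>)"
    unfolding T_def sum_ln_nats_le_eq_floor using False
    by (intro sum.mono_neutral_left sub) (auto simp: mem_nats_le field_simps floor_eq_iff)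
  have "psi x - psi (x / 2) = (\<Sum>d\<in>nats_le x - nats_le (x / 2). mangoldt d)"
    unfolding psi_def using sub by (simp add: sum_diff)
  also have "\<dots> \<le> (\<Sum>d\<in>nats_le x - nats_le (x / 2). mangoldt d * (of_int \<lfloor>x / real d\<rfloor> - 2 * of_int \<lfloor>x / 2 / real d\<rfloor>))"
  proof (rule sum_mono)
    fix d assume d: "d \<in> nats_le x - nats_le (x / 2)"
    hence "\<lfloor>x / real d\<rfloor> \<ge> 1" "\<lfloor>x / 2 / real d\<rfloor> = 0"
      using assms by (auto simp: mem_nats_le field_simps floor_eq_iff le_floor_iff)
    thus "(mangoldt d :: real) \<le> mangoldt d * (of_int \<lfloor>x / real d\<rfloor> - 2 * of_int \<lfloor>x / 2 / real d\<rfloor>)"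
      using mangoldt_nonneg[of d] mult_left_mono[of 1 "of_int \<lfloor>x / real d\<rfloor>" "mangoldt d :: real"] by simp
  qed
  also have "\<dots> \<le> (\<Sum>d\<in>nats_le x. mangoldt d * (of_int \<lfloor>x / real d\<rfloor> - 2 * of_int \<lfloor>x / 2 / real d\<rfloor>))"
  proof (rule sum_mono2)
    fix d assume "d \<in> nats_le x - (nats_le x - nats_le (x / 2))"
    have "2 * of_int \<lfloor>x / 2 / real d\<rfloor> \<le> x / real d" by (simp add: field_simps) linarith
    hence "2 * \<lfloor>x / 2 / real d\<rfloor> \<le> \<lfloor>x / real d\<rfloor>" by (simp add: le_floor_iff)
    hence "0 \<le> (of_int \<lfloor>x / real d\<rfloor> - 2 * of_int \<lfloor>x / 2 / real d\<rfloor> :: real)" by linarith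
    thus "0 \<le> mangoldt d * (of_int \<lfloor>x / real d\<rfloor> - 2 * of_int \<lfloor>x / 2 / real d\<rfloor> :: real)"
      using mangoldt_nonneg[of d] by (intro mult_nonneg_nonneg) auto
  qed auto
  also have "\<dots> = T x - 2 * T (x / 2)"
    unfolding T2 unfolding T_def sum_ln_nats_le_eq_floor
    by (simp add: algebra_simps sum_subtractf sum_distrib_left)
  also have "\<dots> \<le> (x * ln x - x + 1 + ln x) - 2 * (x / 2 * ln (x / 2) - x / 2 - 1 - ln (x / 2))"
    using sum_ln_nats_le[of x] sum_ln_nats_le[of "x / 2"] False unfolding T_def by simp
  also have "\<dots> = x * ln 2 + 3 + 3 * ln x - 2 * ln 2"
    using False by (simp add: ln_div algebra_simps)
  also have "\<dots> \<le> 4 * x"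
    using ln_2_less_1 ln_le_minus_one[of x] False mult_left_mono[of "ln 2" 1 x] ln_gt_zero[of "2::real"] by linarith
  finally show ?thesis .
qed

text \<open>Dyadic descent from \<open>psi_diff_le\<close>; 8 is the solution of c = 4 + c /
  2.\<close>

lemma psi_le: "x \<ge> 0 \<Longrightarrow> psi x \<le> 8 * x"
proof -
  have *: "0 \<le> x \<Longrightarrow> x < 2 ^ n \<Longrightarrow> psi x \<le> 8 * x" for n
  proof (induction n arbitrary: x)
    case 0
    thus ?case by (simp add: psi_def nats_le_less_one)
  next
    case (Suc n)
    show ?case
    proof (cases "x < 1")
      case False
      with Suc.IH[of "x / 2"] Suc.prems psi_diff_le[of x] show ?thesis by simp
    qed (use Suc in \<open>simp add: psi_def nats_le_less_one\<close>)
  qed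
  assume "x \<ge> 0"
  moreover obtain n where "x < 2 ^ n" using real_arch_pow[of 2 x] by auto
  ultimately show ?thesis using * by auto
qed

text \<open>Replacing floor (x / d) by x / d in the formula for the sum of the logarithms costs at
  most \<open>psi x\<close>, hence 8 * x; the Stirling error is absorbed by 1 + ln x \<le> x.
  Division by x leaves a bounded error.\<close>

lemma Mertens_mangoldt:
  assumes "x \<ge> 1"
  shows "\<bar>(\<Sum>d\<in>nats_le x. mangoldt d / real d) - ln x\<bar> \<le> 9"
proof -
  define M where "M = (\<Sum>d\<in>nats_le x. mangoldt d / real d)"
  define T where "T = (\<Sum>n\<in>nats_le x. ln (real n))"
  have "T \<le> (\<Sum>d\<in>nats_le x. mangoldt d * (x / real d))"
    unfolding T_def sum_ln_nats_le_eq_floor by (intro sum_mono mult_left_mono mangoldt_nonneg) auto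
  hence 1: "T \<le> x * M" by (simp add: M_def sum_distrib_left mult.commute)
  have "(\<Sum>d\<in>nats_le x. mangoldt d * (x / real d - 1)) \<le> T"
    unfolding T_def sum_ln_nats_le_eq_floor by (intro sum_mono mult_left_mono mangoldt_nonneg) linarith
  hence 2: "x * M - psi x \<le> T"
    by (simp add: M_def psi_def sum_distrib_left algebra_simps sum_subtractf)
  have T: "\<bar>T - (x * ln x - x)\<bar> \<le> 1 + ln x" unfolding T_def by (rule sum_ln_nats_le[OF assms])
  have "x * M \<le> x * (ln x + 9)" "x * M \<ge> x * (ln x - 9)"
    using 1 2 T psi_le[of x] ln_le_minus_one[of x] assms by (auto simp: algebra_simps)
  hence "M \<le> ln x + 9" "M \<ge> ln x - 9" using assms by auto
  thus ?thesis unfolding M_def by linarith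
qed

section \<open>Selberg's symmetry formula\<close>

definition moebius :: "nat \<Rightarrow> real" where
  "moebius n = (if squarefree n then (- 1) ^ card (prime_factors n) else 0)"

lemma abs_moebius_le: "\<bar>moebius n\<bar> \<le> 1"
  by (simp add: moebius_def power_abs)

text \<open>For a fixed prime p dividing n, the map from d to p * d pairs the squarefree divisors
  prime to p with those divisible by p, and the two members of a pair have opposite signs.\<close>

lemma sum_moebius_dvd:
  assumes "n > 0"
  shows "(\<Sum>d | d dvd n. moebius d) = (if n = 1 then 1 else 0)"
proof (cases "n = 1")
  case True
  thus ?thesis by (simp add: moebius_def)
next
  case False
  then obtain p where p: "prime p" "p dvd n" using prime_factor_nat by blast
  define A where "A = {d. d dvd n \<and> squarefree d \<and> \<not> p dvd d}"
  define B where "B = {d. d dvd n \<and> squarefree d \<and> p dvd d}"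
  have fin: "finite A" "finite B" using assms by (auto simp: A_def B_def)
  have cop: "coprime p d" if "\<not> p dvd d" for d using p that by (simp add: prime_imp_coprime)
  have "(\<Sum>d\<in>B. moebius d) = (\<Sum>d\<in>A. - moebius d)"
  proof (rule sum.reindex_bij_witness[of _ "\<lambda>d. p * d" "\<lambda>d. d div p"])
    fix d assume d: "d \<in> B"
    then obtain e where e: "d = p * e" by (auto simp: B_def)
    have "\<not> p dvd e"
    proof
      assume "p dvd e"
      hence "p ^ 2 dvd d" unfolding e power2_eq_square by (rule mult_dvd_mono[OF dvd_refl])
      thus False using d p squarefreeD[of d p] by (auto simp: B_def)
    qed
    have sq: "squarefree e" using d squarefree_mono[of e d] by (auto simp: B_def e)
    have "e dvd n" using d dvd_mult_right[of p e n] by (auto simp: B_def e)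
    with \<open>\<not> p dvd e\<close> sq show "d div p \<in> A" "p * (d div p) = d"
      using p by (simp_all add: A_def e)
    have "e > 0" using \<open>e dvd n\<close> assms by (rule dvd_pos_nat[rotated])
    hence "prime_factors d = insert p (prime_factors e)"
      using p unfolding e by (subst prime_factors_product) (auto simp: prime_factorization_prime)
    moreover have "p \<notin> prime_factors e" using \<open>\<not> p dvd e\<close> by (auto simp: prime_factors_dvd)
    ultimately show "- moebius (d div p) = moebius d"
      using d p sq by (simp add: moebius_def e B_def)
  next
    fix d assume d: "d \<in> A"
    have "p * d dvd n" using p d cop[of d] by (intro divides_mult) (auto simp: A_def)
    moreover have "squarefree (p * d)"
      using d p cop[of d] by (intro squarefree_mult_coprime) (auto simp: A_def squarefree_prime)
    ultimately show "p * d \<in> B" by (auto simp: B_def)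
    show "p * d div p = d" using p by auto
  qed
  moreover have "(\<Sum>d | d dvd n. moebius d) = (\<Sum>d\<in>A\<union>B. moebius d)"
    using assms by (intro sum.mono_neutral_right) (auto simp: A_def B_def moebius_def)
  moreover have "\<dots> = (\<Sum>d\<in>A. moebius d) + (\<Sum>d\<in>B. moebius d)"
    using fin by (intro sum.union_disjoint) (auto simp: A_def B_def)
  ultimately show ?thesis using False by (simp add: sum_negf)
qed

text \<open>Moebius inversion of the divisor sum of \<open>mangoldt\<close>: expanding the logarithm
  and exchanging the sums leaves the Moebius sum over the divisors of n div e, which survives only
  for e = n.\<close>

lemma sum_moebius_ln_dvd:
  assumes "n > 0"
  shows "(\<Sum>d | d dvd n. moebius d * ln (real n / real d)) = mangoldt n"
proof -
  have fin: "finite {d. d dvd n}" using assms by simp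
  have "(\<Sum>d | d dvd n. moebius d * ln (real n / real d))
      = (\<Sum>d | d dvd n. \<Sum>e | e dvd n div d. moebius d * mangoldt e)"
  proof (intro sum.cong refl)
    fix d assume "d \<in> {d. d dvd n}"
    then obtain m where m: "n = d * m" by auto
    with assms have "d > 0" "m > 0" by auto
    thus "moebius d * ln (real n / real d) = (\<Sum>e | e dvd n div d. moebius d * mangoldt e)"
      using mangoldt_sum[of m, where ?'a = real] by (simp add: m sum_distrib_left[symmetric])
  qed
  also have "\<dots> = (\<Sum>(d,e)\<in>(SIGMA d:{d. d dvd n}. {e. e dvd n div d}). moebius d * mangoldt e)"
    using assms by (intro sum.Sigma) (auto simp: dvd_div_eq_0_iff)
  also have "\<dots> = (\<Sum>(e,d)\<in>(SIGMA e:{e. e dvd n}. {d. d dvd n div e}). moebius d * mangoldt e)"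
    by (rule sum.reindex_bij_witness[of _ "\<lambda>(a,b). (b,a)" "\<lambda>(a,b). (b,a)"])
       (use assms in \<open>auto elim!: dvdE\<close>)
  also have "\<dots> = (\<Sum>e | e dvd n. \<Sum>d | d dvd n div e. moebius d * mangoldt e)"
    using assms by (intro sum.Sigma[symmetric]) (auto simp: dvd_div_eq_0_iff)
  also have "\<dots> = (\<Sum>e | e dvd n. if e = n then mangoldt n else 0)"
  proof (intro sum.cong refl)
    fix e assume e: "e \<in> {e. e dvd n}"
    hence "n div e > 0" using assms by (auto simp: div_greater_zero_iff dvd_imp_le)
    hence "(\<Sum>d | d dvd n div e. moebius d * mangoldt e) = (if n div e = 1 then 1 else 0) * mangoldt e"
      by (simp add: sum_distrib_right[symmetric] sum_moebius_dvd)
    also have "n div e = 1 \<longleftrightarrow> e = n" using e assms by auto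
    finally show "(\<Sum>d | d dvd n div e. moebius d * mangoldt e) = (if e = n then mangoldt n else 0)" by simp
  qed
  also have "\<dots> = mangoldt n" using fin by (simp add: sum.delta)
  finally show ?thesis .
qed

text \<open>With n = d * m, split ln (x / d) = ln (x / n) + ln (n / d). The first part meets the
  plain Moebius sum and survives only at n = 1; the second produces \<open>mangoldt n\<close>. Since
  F is arbitrary, it can later be chosen so that its sums over x / m cancel.\<close>

lemma Tatuzawa_Iseki:
  fixes F :: "real \<Rightarrow> real"
  assumes "x \<ge> 1"
  shows "(\<Sum>d\<in>nats_le x. moebius d * ln (x / real d) * (\<Sum>m\<in>nats_le (x / real d). F (x / real (d * m))))
       = F x * ln x + (\<Sum>n\<in>nats_le x. mangoldt n * F (x / real n))"
proof -
  have "(\<Sum>d\<in>nats_le x. moebius d * ln (x / real d) * (\<Sum>m\<in>nats_le (x / real d). F (x / real (d * m))))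
      = (\<Sum>n\<in>nats_le x. \<Sum>d | d dvd n. moebius d * ln (x / real d) * F (x / real n))"
    unfolding sum_nats_le_divisors by (simp add: sum_distrib_left)
  also have "\<dots> = (\<Sum>n\<in>nats_le x. (if n = 1 then F x * ln x else 0) + mangoldt n * F (x / real n))"
  proof (intro sum.cong refl)
    fix n assume n: "n \<in> nats_le x"
    have "(\<Sum>d | d dvd n. moebius d * ln (x / real d))
        = (\<Sum>d | d dvd n. moebius d * ln (x / real n) + moebius d * ln (real n / real d))"
    proof (intro sum.cong refl)
      fix d assume "d \<in> {d. d dvd n}"
      hence "d > 0" "n > 0" using n by (auto simp: mem_nats_le intro!: Nat.gr0I)
      hence "ln (x / real d) = ln (x / real n) + ln (real n / real d)"
        using assms by (simp add: ln_div)
      thus "moebius d * ln (x / real d) = moebius d * ln (x / real n) + moebius d * ln (real n / real d)"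
        by (simp add: algebra_simps)
    qed
    also have "\<dots> = (if n = 1 then ln x else 0) + mangoldt n"
      using n by (simp add: sum.distrib sum_moebius_ln_dvd sum_moebius_dvd mem_nats_le flip: sum_distrib_right)
    finally show "(\<Sum>d | d dvd n. moebius d * ln (x / real d) * F (x / real n))
        = (if n = 1 then F x * ln x else 0) + mangoldt n * F (x / real n)"
      by (simp only: sum_distrib_right[symmetric]) (simp add: algebra_simps)
  qed
  also have "\<dots> = F x * ln x + (\<Sum>n\<in>nats_le x. mangoldt n * F (x / real n))"
    using one_mem_nats_le[OF assms] by (simp add: sum.distrib sum.delta)
  finally show ?thesis .
qed

text \<open>One 1 / x comes from the bracketing of the Euler-Mascheroni constant, the other from
  replacing x by floor x + 1 in the logarithm.\<close>

lemma harmonic_nats_le: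
  assumes "x \<ge> 1"
  shows "\<bar>(\<Sum>n\<in>nats_le x. 1 / real n) - ln x - euler_mascheroni\<bar> \<le> 2 / x"
proof -
  define n where "n = nat \<lfloor>x\<rfloor>"
  have n: "n \<ge> 1" "real n \<le> x" "x \<le> n + 1"
    using assms by (auto simp: n_def le_nat_iff le_floor_iff) linarith+
  have H: "(\<Sum>n\<in>nats_le x. 1 / real n) = harm n"
    by (simp add: nats_le_eq n_def harm_def inverse_eq_divide)
  define a where "a = ln (real (Suc n)) - ln x"
  have "a = ln (real (Suc n) / x)" using n assms ln_div[of "real (Suc n)" x] by (simp add: a_def)
  also have "\<dots> \<le> real (Suc n) / x - 1" using n assms by (intro ln_le_minus_one) auto
  also have "\<dots> \<le> 1 / x" using n assms by (simp add: field_simps)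
  finally have a: "a \<le> 1 / x" "a \<ge> 0" using n assms by (auto simp: a_def)
  have "inverse (real (2 * n)) \<le> 1 / x" using n assms by (simp add: field_simps)
  moreover have "inverse (real (2 * (n + 1))) \<ge> 0" by simp
  moreover have "harm n - ln (real (Suc n)) + inverse (real (2 * (n + 1))) \<le> euler_mascheroni"
    "euler_mascheroni \<le> harm n - ln (real (Suc n)) + inverse (real (2 * n))"
    using euler_mascheroni_bounds[of n] n(1) by (simp_all only: atLeastAtMost_iff)
  moreover have "1 / x \<ge> 0" using assms by simp
  ultimately have "\<bar>harm n - ln x - euler_mascheroni\<bar> \<le> 1 / x + 1 / x"
    using a unfolding a_def by linarith
  thus ?thesis unfolding H by simp
qed

lemma euler_mascheroni_le_2: "euler_mascheroni \<le> (2::real)"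
proof -
  have "euler_mascheroni \<le> 3 / 2 - ln (2::real)"
    using euler_mascheroni_upper[of 0] by (simp add: harm_def)
  moreover have "ln (2::real) > 0" by simp
  ultimately show ?thesis by linarith
qed

lemma ln_le_harmonic: "y \<ge> 1 \<Longrightarrow> ln y \<le> (\<Sum>k\<in>nats_le y. 1 / real k)"
proof -
  assume y: "y \<ge> 1"
  have "ln y \<le> ln (real (nat \<lfloor>y\<rfloor>) + 1)"
    using y by (subst ln_le_cancel_iff) (auto, linarith)
  also have "\<dots> \<le> harm (nat \<lfloor>y\<rfloor>)" by (rule ln_le_harm)
  finally show ?thesis by (simp add: nats_le_eq harm_def inverse_eq_divide)
qed

lemma ln_le_root4: "(y::real) \<ge> 1 \<Longrightarrow> ln y \<le> 4 * y powr (1 / 4)"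
  using ln_powr_bound[of y "1/4"] by simp

lemma ln_sq_le_sqrt: "(y::real) \<ge> 1 \<Longrightarrow> (ln y) ^ 2 \<le> 16 * sqrt y"
proof -
  assume y: "y \<ge> 1"
  have "(ln y) ^ 2 \<le> (4 * y powr (1 / 4)) ^ 2"
    using ln_le_root4[OF y] y by (intro power_mono) auto
  also have "\<dots> = 16 * sqrt y"
    using y by (simp add: power_mult_distrib powr_half_sqrt flip: powr_realpow powr_powr add: powr_powr)
  finally show ?thesis .
qed

lemma sum_inverse_sqrt_le:
  assumes "x \<ge> 0"
  shows "(\<Sum>n\<in>nats_le x. 1 / sqrt (real n)) \<le> 2 * sqrt x"
proof -
  have "(\<Sum>k\<in>{1..n}. 1 / sqrt (real k)) \<le> 2 * sqrt n" for n :: nat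
  proof (induction n)
    case (Suc n)
    have s: "sqrt (real (Suc n)) > 0" by simp
    have "0 \<le> (sqrt (real (Suc n)) - sqrt n) ^ 2" by simp
    hence "2 * (sqrt n * sqrt (real (Suc n))) \<le> 2 * real n + 1"
      by (simp add: power2_diff mult.commute)
    hence "2 * sqrt n + 1 / sqrt (real (Suc n)) \<le> 2 * sqrt (real (Suc n))"
      using s by (simp add: field_simps)
    with Suc show ?case by simp
  qed simp
  from this[of "nat \<lfloor>x\<rfloor>"] have "(\<Sum>n\<in>nats_le x. 1 / sqrt (real n)) \<le> 2 * sqrt (real (nat \<lfloor>x\<rfloor>))"
    by (simp add: nats_le_eq)
  also have "\<dots> \<le> 2 * sqrt x" using assms by simp
  finally show ?thesis .
qed

lemma sum_inverse_squares_le: "(\<Sum>n\<in>nats_le x. 1 / real n ^ 2) \<le> 2"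
proof -
  have "(\<Sum>k\<in>{1..Suc n}. 1 / real k ^ 2) \<le> 2 - 1 / Suc n" for n :: nat
  proof (induction n)
    case (Suc n)
    have "1 / real (Suc (Suc n)) ^ 2 \<le> 1 / Suc n - 1 / Suc (Suc n)"
    proof -
      have "1 / real (Suc (Suc n)) ^ 2 \<le> 1 / (real (Suc n) * real (Suc (Suc n)))"
        by (intro divide_left_mono) (auto simp: power2_eq_square)
      also have "\<dots> = 1 / Suc n - 1 / Suc (Suc n)" by (simp add: field_simps)
      finally show ?thesis .
    qed
    with Suc show ?case by simp
  qed simp
  hence *: "(\<Sum>k\<in>{1..Suc n}. 1 / real k ^ 2) \<le> 2" for n
    by (rule order_trans) simp
  show ?thesis using *[of "nat \<lfloor>x\<rfloor> - 1"] by (cases "nat \<lfloor>x\<rfloor>") (simp_all add: nats_le_eq del: sum.cl_ivl_Suc)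
qed

text \<open>The logarithm is replaced by the harmonic sum that dominates it. After the exchange the
  inner sum is \<open>psi (x / k)\<close>, and the factor 1 / k turns Chebyshev's bound into the
  convergent series of inverse squares.\<close>

lemma sum_mangoldt_ln_div_le:
  assumes "x \<ge> 1"
  shows "(\<Sum>n\<in>nats_le x. mangoldt n * ln (x / real n)) \<le> 16 * x"
proof -
  have "(\<Sum>n\<in>nats_le x. mangoldt n * ln (x / real n))
      \<le> (\<Sum>n\<in>nats_le x. \<Sum>k\<in>nats_le (x / real n). mangoldt n * (1 / real k))"
    unfolding sum_distrib_left[symmetric]
    by (intro sum_mono mult_left_mono ln_le_harmonic nats_le_divI mangoldt_nonneg)
  also have "\<dots> = (\<Sum>k\<in>nats_le x. psi (x / real k) * (1 / real k))"
    unfolding psi_def by (subst sum_nats_le_swap) (simp add: sum_divide_distrib)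
  also have "\<dots> \<le> (\<Sum>k\<in>nats_le x. 8 * (x / real k) * (1 / real k))"
    using assms by (intro sum_mono mult_right_mono psi_le) auto
  also have "\<dots> = 8 * x * (\<Sum>k\<in>nats_le x. 1 / real k ^ 2)"
    by (simp add: sum_distrib_left power2_eq_square)
  also have "\<dots> \<le> 8 * x * 2" using assms by (intro mult_left_mono sum_inverse_squares_le) auto
  finally show ?thesis by simp
qed

text \<open>The Tatuzawa-Iseki identity for the remainder \<open>psi y - y\<close>, corrected by a
  constant. Its inner sums become logarithmic, so the Moebius function can be bounded trivially by
  1.\<close>

lemma psi_ln_plus_convolution:
  assumes "x \<ge> 1"
  shows "\<bar>psi x * ln x + (\<Sum>n\<in>nats_le x. mangoldt n * psi (x / real n)) - 2 * x * ln x\<bar> \<le> 104 * x"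
proof -
  \<comment> \<open>The constant is forced: \<open>psi (y / m)\<close> sums to y * ln y - y and y /
    m to y * ln y + \<gamma> * y, up to small errors, so c * y must cancel the remaining -(1 +
    \<gamma>) * y. Only a logarithm is left in \<open>sumF\<close>.\<close>
  define c :: real where "c = 1 + euler_mascheroni"
  have c: "0 \<le> c" "c \<le> 3"
    using euler_mascheroni_le_2 euler_mascheroni_pos by (auto simp: c_def)
  define F where "F y = psi y - y + c" for y
  have sumF: "\<bar>\<Sum>m\<in>nats_le y. F (y / real m)\<bar> \<le> 6 + ln y" if y: "y \<ge> 1" for y
  proof -
    have "(\<Sum>m\<in>nats_le y. F (y / real m))
        = (\<Sum>m\<in>nats_le y. psi (y / real m)) - y * (\<Sum>m\<in>nats_le y. 1 / real m) + c * real (card (nats_le y))"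
      by (simp add: F_def sum.distrib sum_subtractf sum_distrib_left)
    also have "(\<Sum>m\<in>nats_le y. psi (y / real m)) = (\<Sum>n\<in>nats_le y. ln (real n))"
      by (rule sum_ln_nats_le_eq_psi[symmetric])
    finally have eq: "(\<Sum>m\<in>nats_le y. F (y / real m))
        = (\<Sum>n\<in>nats_le y. ln (real n)) - y * (\<Sum>m\<in>nats_le y. 1 / real m) + c * of_int \<lfloor>y\<rfloor>"
      using y by (simp add: card_nats_le)
    define H where "H = (\<Sum>m\<in>nats_le y. 1 / real m) - ln y - euler_mascheroni"
    have "\<bar>y * H\<bar> \<le> y * (2 / y)"
      unfolding abs_mult using harmonic_nats_le[OF y] y by (intro mult_mono) (auto simp: H_def)
    hence 1: "\<bar>y * H\<bar> \<le> 2" using y by simp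
    have 2: "y * (\<Sum>m\<in>nats_le y. 1 / real m) = y * H + y * ln y + y * euler_mascheroni"
      by (simp add: H_def algebra_simps)
    have "c * (y - 1) \<le> c * of_int \<lfloor>y\<rfloor>" "c * of_int \<lfloor>y\<rfloor> \<le> c * y"
      using c by (intro mult_left_mono; linarith)+
    hence 3: "c * y - 3 \<le> c * of_int \<lfloor>y\<rfloor>" "c * of_int \<lfloor>y\<rfloor> \<le> c * y"
      using c by (auto simp: algebra_simps)
    have 4: "c * y = y + y * euler_mascheroni" by (simp add: c_def algebra_simps)
    show ?thesis unfolding eq using 1 2 3 4 sum_ln_nats_le[OF y] by linarith
  qed
  \<comment> \<open>Two logarithms are traded for a square root, with 6 * 2 + 16 = 28: the sum of 1
    / sqrt d up to x has order sqrt x, so that the total is O(x) without a logarithmic loss.\<close>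
  have bound: "\<bar>moebius d * ln (x / real d) * (\<Sum>m\<in>nats_le (x / real d). F (x / real (d * m)))\<bar>
      \<le> 28 * (sqrt x * (1 / sqrt (real d)))" if d: "d \<in> nats_le x" for d
  proof -
    define y where "y = x / real d"
    have y: "y \<ge> 1" using nats_le_divI[OF d] by (simp add: y_def)
    have "\<bar>moebius d * ln y * (\<Sum>m\<in>nats_le y. F (y / real m))\<bar> \<le> 1 * ln y * (6 + ln y)"
      unfolding abs_mult using y abs_moebius_le[of d] sumF[OF y]
      by (intro mult_mono) auto
    also have "\<dots> = 6 * ln y + (ln y) ^ 2" by (simp add: power2_eq_square algebra_simps)
    moreover have "ln y \<le> 2 * sqrt y"
      using ln_powr_bound[of y "1/2"] y by (simp add: powr_half_sqrt)
    moreover note ln_sq_le_sqrt[OF y]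
    ultimately have "\<bar>moebius d * ln y * (\<Sum>m\<in>nats_le y. F (y / real m))\<bar> \<le> 28 * sqrt y" by linarith
    thus ?thesis by (simp add: y_def real_sqrt_divide)
  qed
  have "\<bar>F x * ln x + (\<Sum>n\<in>nats_le x. mangoldt n * F (x / real n))\<bar>
      \<le> (\<Sum>d\<in>nats_le x. \<bar>moebius d * ln (x / real d) * (\<Sum>m\<in>nats_le (x / real d). F (x / real (d * m)))\<bar>)"
    unfolding Tatuzawa_Iseki[OF assms, symmetric] by (rule sum_abs)
  also have "\<dots> \<le> (\<Sum>d\<in>nats_le x. 28 * (sqrt x * (1 / sqrt (real d))))"
    by (intro sum_mono bound)
  also have "\<dots> = 28 * sqrt x * (\<Sum>d\<in>nats_le x. 1 / sqrt (real d))"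
    by (simp add: sum_distrib_left)
  also have "\<dots> \<le> 28 * sqrt x * (2 * sqrt x)"
    using assms by (intro mult_left_mono sum_inverse_sqrt_le) auto
  also have "\<dots> = 56 * x" using assms by simp
  finally have main: "\<bar>F x * ln x + (\<Sum>n\<in>nats_le x. mangoldt n * F (x / real n))\<bar> \<le> 56 * x" .
  define M where "M = (\<Sum>d\<in>nats_le x. mangoldt d / real d)"
  have eq: "F x * ln x + (\<Sum>n\<in>nats_le x. mangoldt n * F (x / real n))
      = psi x * ln x + (\<Sum>n\<in>nats_le x. mangoldt n * psi (x / real n)) - x * ln x - x * M + c * ln x + c * psi x"
    by (simp add: F_def M_def psi_def algebra_simps sum.distrib sum_subtractf sum_distrib_left)
  have "\<bar>x * (M - ln x)\<bar> \<le> x * 9"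
    unfolding abs_mult using Mertens_mangoldt[OF assms] assms by (intro mult_mono) (auto simp: M_def)
  hence 1: "\<bar>x * M - x * ln x\<bar> \<le> 9 * x" by (simp add: algebra_simps)
  have "c * ln x \<le> 3 * x" using c ln_le_minus_one[of x] assms by (intro mult_mono) auto
  moreover have "c * ln x \<ge> 0" using c assms by simp
  moreover have "c * psi x \<le> 3 * (8 * x)" using c psi_le[of x] psi_nonneg[of x] assms by (intro mult_mono) auto
  moreover have "c * psi x \<ge> 0" using c psi_nonneg[of x] by simp
  ultimately show ?thesis using main 1 unfolding eq by linarith
qed

definition selberg_sum :: "real \<Rightarrow> real" where
  "selberg_sum x = (\<Sum>d\<in>nats_le x. mangoldt d * ln (real d)) + (\<Sum>d\<in>nats_le x. mangoldt d * psi (x / real d))"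

text \<open>The weights ln d and ln x differ by ln (x / d), which costs 16 * x in addition to the
  104 * x of the previous form.\<close>

theorem Selberg_formula:
  assumes "x \<ge> 1"
  shows "\<bar>selberg_sum x - 2 * x * ln x\<bar> \<le> 120 * x"
proof -
  have "(\<Sum>d\<in>nats_le x. mangoldt d * ln (real d))
      = (\<Sum>d\<in>nats_le x. mangoldt d * ln x - mangoldt d * ln (x / real d))"
    using assms by (intro sum.cong refl) (auto simp: mem_nats_le ln_div algebra_simps)
  also have "\<dots> = psi x * ln x - (\<Sum>d\<in>nats_le x. mangoldt d * ln (x / real d))"
    by (simp add: sum_subtractf psi_def sum_distrib_right)
  finally have "selberg_sum x = psi x * ln x + (\<Sum>d\<in>nats_le x. mangoldt d * psi (x / real d))
      - (\<Sum>d\<in>nats_le x. mangoldt d * ln (x / real d))" by (simp add: selberg_sum_def)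
  moreover have "(\<Sum>d\<in>nats_le x. mangoldt d * ln (x / real d)) \<ge> 0"
    by (intro sum_nonneg mult_nonneg_nonneg mangoldt_nonneg ln_ge_zero nats_le_divI)
  ultimately show ?thesis
    using sum_mangoldt_ln_div_le[OF assms] psi_ln_plus_convolution[OF assms] by linarith
qed

section \<open>Euler products\<close>

lemma abs_summable_has_sum_times:
  fixes f :: "'a \<Rightarrow> 'c :: {banach, real_normed_field, second_countable_topology}" and g :: "'b \<Rightarrow> 'c"
  assumes f: "(\<lambda>n. norm (f n)) summable_on A" "(f has_sum s) A" and g: "(\<lambda>n. norm (g n)) summable_on B" "(g has_sum t) B"
  shows "(\<lambda>z. norm (case z of (x, y) \<Rightarrow> f x * g y)) summable_on A \<times> B"
    and "((\<lambda>(x, y). f x * g y) has_sum (s * t)) (A \<times> B)"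
proof -
  show *: "(\<lambda>z. norm (case z of (x, y) \<Rightarrow> f x * g y)) summable_on A \<times> B"
    using f(1) g(1) Infinite_Sum.abs_summable_on_Sigma_iff[where f = "\<lambda>(x, y). f x * g y" and A = A and B = "\<lambda>_. B"]
    by (simp add: norm_mult infsum_cmult_right' summable_on_cmult_left summable_on_cmult_right infsum_nonneg)
  show "((\<lambda>(x, y). f x * g y) has_sum (s * t)) (A \<times> B)"
    by (rule has_sum_SigmaI[where g = "\<lambda>x. f x * t"])
       (use has_sum_cmult_left[OF f(2)] has_sum_cmult_right[OF g(2)] abs_summable_summable[OF *] in simp_all)
qed

text \<open>Positivity matters because \<open>prime_factors 0\<close> is empty; the number 1 belongs
  to every such set.\<close>

definition smooth_numbers :: "nat set \<Rightarrow> nat set" where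
  "smooth_numbers P = {n. n > 0 \<and> prime_factors n \<subseteq> P}"

lemma smooth_numbers_empty: "smooth_numbers {} = {1}"
proof -
  have "n > 0 \<and> prime_factors n \<subseteq> {} \<longleftrightarrow> n = 1" for n :: nat
  proof
    assume n: "n > 0 \<and> prime_factors n \<subseteq> {}"
    show "n = 1"
    proof (rule ccontr)
      assume "n \<noteq> 1"
      then obtain p where "prime p" "p dvd n" using prime_factor_nat by blast
      with n show False by (force simp: prime_factors_dvd)
    qed
  qed simp
  thus ?thesis unfolding smooth_numbers_def by blast
qed

lemma power_times_coprime_inj:
  fixes p :: nat
  assumes p: "prime p" and "\<not> p dvd m" "\<not> p dvd m'" "m > 0" "m' > 0" and eq: "p ^ j * m = p ^ j' * m'"
  shows "j = j' \<and> m = m'"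
proof -
  have "multiplicity p (p ^ j * m) = j" if "\<not> p dvd m" for j m
    using p that multiplicity_prime_elem_times_other[of p m "p ^ j"] by (simp add: mult.commute)
  from this[of m j] this[of m' j'] have "multiplicity p (p ^ j * m) = j" "multiplicity p (p ^ j' * m') = j'"
    using assms by simp_all
  with eq have "j = j'" by metis
  moreover have "p ^ j \<noteq> 0" using p by simp
  ultimately show ?thesis using eq by (metis mult_left_cancel)
qed

lemma exists_prime_power_decomposition:
  fixes p :: nat
  assumes "prime p" "n > 0"
  obtains j m where "n = p ^ j * m" "\<not> p dvd m" "m > 0" "prime_factors m = prime_factors n - {p}"
proof -
  have np: "\<not> is_unit p" using assms by auto
  obtain m where m: "n = p ^ multiplicity p n * m" "\<not> p dvd m"
    using multiplicity_decompose'[of n p] np assms by auto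
  have m0: "m > 0" using m assms by (auto intro!: Nat.gr0I)
  have "prime_factors n = prime_factors (p ^ multiplicity p n) \<union> prime_factors m"
    using m m0 assms by (subst m(1), subst prime_factors_product) auto
  moreover have "prime_factors (p ^ multiplicity p n) \<subseteq> {p}"
    using assms by (cases "multiplicity p n = 0") (simp_all add: prime_factors_power prime_prime_factors)
  moreover have "p \<notin> prime_factors m" using m by (auto simp: prime_factors_dvd)
  ultimately have "prime_factors m = prime_factors n - {p}" by auto
  with m m0 show ?thesis using that by blast
qed

lemma prime_factors_prime_power_times:
  fixes p :: nat
  assumes "prime p" "m > 0"
  shows "prime_factors (p ^ j * m) \<subseteq> insert p (prime_factors m)"
proof -
  have "prime_factors (p ^ j * m) = prime_factors (p ^ j) \<union> prime_factors m"
    using assms by (intro prime_factors_product) auto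
  moreover have "prime_factors (p ^ j) \<subseteq> {p}"
    using assms by (cases "j = 0") (simp_all add: prime_factors_power prime_prime_factors)
  ultimately show ?thesis by auto
qed

text \<open>Unique splitting of n into its p-part and a cofactor prime to p: the combinatorial
  content of the induction step for the Euler product.\<close>

lemma bij_betw_smooth_insert:
  assumes p: "prime p" "p \<notin> P"
  shows "bij_betw (\<lambda>(j, m). p ^ j * m) (UNIV \<times> smooth_numbers P) (smooth_numbers (insert p P))"
proof (rule bij_betwI')
  fix x y :: "nat \<times> nat" assume x: "x \<in> UNIV \<times> smooth_numbers P" and y: "y \<in> UNIV \<times> smooth_numbers P"
  obtain j m j' m' where [simp]: "x = (j, m)" "y = (j', m')" by (metis surj_pair)
  have "\<not> p dvd m" "\<not> p dvd m'" "m > 0" "m' > 0"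
    using x y p by (auto simp: smooth_numbers_def prime_factors_dvd)
  thus "((case x of (j, m) \<Rightarrow> p ^ j * m) = (case y of (j, m) \<Rightarrow> p ^ j * m)) = (x = y)"
    using power_times_coprime_inj[OF p(1), of m m' j j'] by auto
next
  fix x :: "nat \<times> nat" assume x: "x \<in> UNIV \<times> smooth_numbers P"
  obtain j m where [simp]: "x = (j, m)" by (metis surj_pair)
  have "m > 0" "prime_factors m \<subseteq> P" using x by (auto simp: smooth_numbers_def)
  thus "(case x of (j, m) \<Rightarrow> p ^ j * m) \<in> smooth_numbers (insert p P)"
    using prime_factors_prime_power_times[OF p(1), of m j] p by (auto simp: smooth_numbers_def prime_gt_0_nat)
next
  fix n assume n: "n \<in> smooth_numbers (insert p P)"
  hence "n > 0" by (simp add: smooth_numbers_def)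
  from exists_prime_power_decomposition[OF p(1) this] obtain j m
    where jm: "n = p ^ j * m" "\<not> p dvd m" "m > 0" "prime_factors m = prime_factors n - {p}" .
  have "m \<in> smooth_numbers P"
    using jm(3,4) n unfolding smooth_numbers_def by blast
  hence "(j, m) \<in> UNIV \<times> smooth_numbers P" by simp
  moreover have "n = (case (j, m) of (j, m) \<Rightarrow> p ^ j * m)" using jm(1) by simp
  ultimately show "\<exists>x\<in>UNIV \<times> smooth_numbers P. n = (case x of (j, m) \<Rightarrow> p ^ j * m)"
    by (rule bexI[rotated])
qed

text \<open>Absolute summability is carried along in the induction because multiplying by the next
  local factor is a product of two unconditional sums. As \<open>P\<close> is finite, convergence of
  the local series suffices; this makes the result available at \<sigma> = 1, where the full
  Dirichlet series diverges.\<close>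

lemma Euler_product_smooth:
  fixes g :: "nat \<Rightarrow> 'a :: {banach, real_normed_field, second_countable_topology}"
  assumes g1: "g 1 = 1" and mult: "\<And>m n. m > 0 \<Longrightarrow> n > 0 \<Longrightarrow> coprime m n \<Longrightarrow> g (m * n) = g m * g n"
    and "finite P" "\<And>p. p \<in> P \<Longrightarrow> prime p" "\<And>p. p \<in> P \<Longrightarrow> summable (\<lambda>j. norm (g (p ^ j)))"
  shows "(\<lambda>n. norm (g n)) summable_on smooth_numbers P \<and> (g has_sum (\<Prod>p\<in>P. \<Sum>j. g (p ^ j))) (smooth_numbers P)"
  using assms(3-)
proof (induction P rule: finite_induct)
  case empty
  show ?case using has_sum_finite[of "{1}" g] g1 by (simp add: smooth_numbers_empty)
next
  case (insert p P)
  hence p: "prime p" "p \<notin> P" by auto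
  have IH: "(\<lambda>n. norm (g n)) summable_on smooth_numbers P" "(g has_sum (\<Prod>p\<in>P. \<Sum>j. g (p ^ j))) (smooth_numbers P)"
    using insert by auto
  have s: "summable (\<lambda>j. norm (g (p ^ j)))" using insert.prems by auto
  have 1: "(\<lambda>j. norm (g (p ^ j))) summable_on UNIV"
    using s by (intro norm_summable_imp_summable_on) simp
  have 2: "((\<lambda>j. g (p ^ j)) has_sum (\<Sum>j. g (p ^ j))) UNIV"
    by (rule norm_summable_imp_has_sum[OF s]) (rule summable_sums[OF summable_norm_cancel[OF s]])
  note 3 = abs_summable_has_sum_times[OF 1 2 IH]
  note bij = bij_betw_smooth_insert[OF p]
  have eq: "g (p ^ j * m) = g (p ^ j) * g m" if "m \<in> smooth_numbers P" for j m
  proof -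
    have "\<not> p dvd m" "m > 0" using that p by (auto simp: smooth_numbers_def prime_factors_dvd)
    thus ?thesis using p by (intro mult) (auto simp: prime_gt_0_nat intro: prime_imp_coprime coprime_power_left_iff[THEN iffD2])
  qed
  have "(\<lambda>x. norm (g (case x of (j, m) \<Rightarrow> p ^ j * m))) summable_on (UNIV \<times> smooth_numbers P)"
    using 3(1) by (subst summable_on_cong[where g = "\<lambda>x. norm (case x of (j, m) \<Rightarrow> g (p ^ j) * g m)"]) (auto simp: eq)
  hence "(\<lambda>n. norm (g n)) summable_on smooth_numbers (insert p P)"
    using summable_on_reindex_bij_betw[OF bij, of "\<lambda>n. norm (g n)"] by simp
  moreover have "((\<lambda>x. g (case x of (j, m) \<Rightarrow> p ^ j * m)) has_sum ((\<Sum>j. g (p ^ j)) * (\<Prod>p\<in>P. \<Sum>j. g (p ^ j)))) (UNIV \<times> smooth_numbers P)"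
    using 3(2) by (subst has_sum_cong[where g = "\<lambda>x. (case x of (j, m) \<Rightarrow> g (p ^ j) * g m)"]) (auto simp: eq)
  hence "(g has_sum (\<Prod>p\<in>insert p P. \<Sum>j. g (p ^ j))) (smooth_numbers (insert p P))"
    using has_sum_reindex_bij_betw[OF bij, of g] insert.hyps by simp
  ultimately show ?case by blast
qed

lemma smooth_numbers_supset: "{1..N} \<subseteq> smooth_numbers {p. prime p \<and> p \<le> N}"
proof
  fix n assume n: "n \<in> {1..N}"
  have "prime p \<and> p \<le> N" if "p \<in> prime_factors n" for p
    using that n dvd_imp_le[of p n] by (auto simp: prime_factors_dvd)
  with n show "n \<in> smooth_numbers {p. prime p \<and> p \<le> N}"
    unfolding smooth_numbers_def by auto
qed

text \<open>The product over p \<le> N sums g over the N-smooth numbers, and these include 1, ...,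
  N. The difference from G is therefore dominated by the tail of the norms beyond N.\<close>

lemma Euler_product_limit:
  fixes g :: "nat \<Rightarrow> 'a :: {banach, real_normed_field, second_countable_topology}"
  assumes g1: "g 1 = 1" and mult: "\<And>m n. m > 0 \<Longrightarrow> n > 0 \<Longrightarrow> coprime m n \<Longrightarrow> g (m * n) = g m * g n"
    and summ: "(\<lambda>n. norm (g n)) summable_on {0<..}" and sum: "(g has_sum G) {0<..}"
    and pp: "\<And>p. prime p \<Longrightarrow> summable (\<lambda>j. norm (g (p ^ j)))"
  shows "(\<lambda>N. \<Prod>p | prime p \<and> p \<le> N. \<Sum>j. g (p ^ j)) \<longlonglongrightarrow> G"
proof (rule LIMSEQ_I)
  fix e :: real assume e: "e > 0"
  define T where "T = (\<Sum>\<^sub>\<infinity>n\<in>{0<..}. norm (g n))"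
  have T: "((\<lambda>n. norm (g n)) has_sum T) {0<..}" unfolding T_def using summ by (rule has_sum_infsum)
  hence "\<forall>\<^sub>F Y in finite_subsets_at_top {0<..}. dist (\<Sum>n\<in>Y. norm (g n)) T < e"
    using e unfolding has_sum_def by (rule tendstoD)
  then obtain F where F: "finite F" "F \<subseteq> {0<..}"
    and F': "\<forall>Y. finite Y \<and> F \<subseteq> Y \<and> Y \<subseteq> {0<..} \<longrightarrow> dist (\<Sum>n\<in>Y. norm (g n)) T < e"
    unfolding eventually_finite_subsets_at_top by (elim exE conjE)
  show "\<exists>no. \<forall>N\<ge>no. norm ((\<Prod>p | prime p \<and> p \<le> N. \<Sum>j. g (p ^ j)) - G) < e"
  proof (intro exI allI impI)
    fix N assume N: "N \<ge> Max (insert 0 F)"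
    let ?P = "{p. prime p \<and> p \<le> N}" and ?S = "smooth_numbers {p. prime p \<and> p \<le> N}"
    have "F \<subseteq> {1..N}"
    proof
      fix n assume n: "n \<in> F"
      hence "n \<le> Max (insert 0 F)" using F by (intro Max_ge) auto
      moreover have "n > 0" using n F by auto
      ultimately show "n \<in> {1..N}" using N by simp
    qed
    hence close: "dist (\<Sum>n\<in>{1..N}. norm (g n)) T < e" by (intro F'[rule_format]) auto
    have S: "?S \<subseteq> {0<..}" by (auto simp: smooth_numbers_def)
    have "finite ?P" by (rule finite_subset[of _ "{..N}"]) auto
    hence eul: "(g has_sum (\<Prod>p\<in>?P. \<Sum>j. g (p ^ j))) ?S"
      by (intro conjunct2[OF Euler_product_smooth] g1 mult pp) simp_all
    have "(g has_sum (G - (\<Prod>p\<in>?P. \<Sum>j. g (p ^ j)))) ({0<..} - ?S)"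
      by (rule has_sum_Diff[OF sum eul S])
    hence "norm (G - (\<Prod>p\<in>?P. \<Sum>j. g (p ^ j))) \<le> (\<Sum>\<^sub>\<infinity>n\<in>{0<..} - ?S. norm (g n))"
      using norm_infsum_bound[OF summable_on_subset_banach[OF summ, of "{0<..} - ?S"]]
      by (simp only: infsumI Diff_subset simp_thms)
    also have "\<dots> \<le> (\<Sum>\<^sub>\<infinity>n\<in>{0<..} - {1..N}. norm (g n))"
    proof (rule infsum_mono_neutral)
      show "norm (g n) \<le> 0" if "n \<in> {0<..} - ?S - ({0<..} - {1..N})" for n
        using that smooth_numbers_supset[of N] by blast
    qed (auto intro!: summable_on_subset_banach[OF summ])
    also have "\<dots> = T - (\<Sum>n\<in>{1..N}. norm (g n))"
      by (rule infsumI, rule has_sum_Diff[OF T]) (auto intro!: has_sum_finite)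
    also have "\<dots> < e" using close by (simp add: dist_real_def abs_less_iff)
    finally show "norm ((\<Prod>p | prime p \<and> p \<le> N. \<Sum>j. g (p ^ j)) - G) < e"
      by (simp add: norm_minus_commute)
  qed
qed

section \<open>Local factors\<close>

lemma summable_geometric_bound:
  fixes a :: "nat \<Rightarrow> real"
  assumes "\<And>j. 0 \<le> a j" "\<And>j. a j \<le> M * (3 / 4) ^ j"
  shows "summable a" "suminf a \<le> 4 * M"
proof -
  have g: "summable (\<lambda>j. M * (3 / 4) ^ j :: real)" by (intro summable_mult summable_geometric) auto
  show s: "summable a" using assms by (intro summable_comparison_test[OF _ g]) auto
  have "suminf a \<le> (\<Sum>j. M * (3 / 4) ^ j)" by (rule suminf_le[OF assms(2) s g])
  also have "\<dots> = 4 * M" by (subst suminf_mult) (auto simp: suminf_geometric)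
  finally show "suminf a \<le> 4 * M" .
qed

lemma norm_power_diff_le:
  fixes z :: complex
  assumes "norm z \<le> 1"
  shows "norm (z ^ j - 1) \<le> real j * norm (z - 1)"
proof (induction j)
  case (Suc j)
  have "z ^ Suc j - 1 = z * (z ^ j - 1) + (z - 1)" by (simp add: algebra_simps)
  also have "norm \<dots> \<le> norm z * norm (z ^ j - 1) + norm (z - 1)"
    by (metis norm_mult norm_triangle_ineq)
  also have "norm z * norm (z ^ j - 1) \<le> 1 * (real j * norm (z - 1))"
    using assms Suc by (intro mult_mono) auto
  finally show ?case by (simp add: algebra_simps)
qed simp

text \<open>Here \<open>a j\<close> stands for f (p ^ j) and \<open>q\<close> for p powr -\<sigma>.
  The factor j + 1 in the growth condition pays for |z ^ j - 1| \<le> j * |z - 1|, and 3 / 2 times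
  \<open>q \<le> 1 / 2\<close> leaves the geometric ratio 3 / 4.\<close>

locale local_factor =
  fixes a :: "nat \<Rightarrow> real" and \<alpha> B q :: real
  assumes a0: "a 0 = 1" and a1: "a (Suc 0) = \<alpha>" and a_nonneg: "a j \<ge> 0"
    and a_le: "real (Suc j) * a j \<le> B * (3 / 2) ^ j" and q: "0 \<le> q" "q \<le> 1 / 2"
begin

definition fac :: "complex \<Rightarrow> complex" where
  "fac z = (\<Sum>j. of_real (a j * q ^ j) * z ^ j)"

definition rfac :: real where
  "rfac = (\<Sum>j. a j * q ^ j)"

definition rest :: "complex \<Rightarrow> complex" where
  "rest z = (\<Sum>j. of_real (a (j + 2) * q ^ (j + 2)) * z ^ (j + 2))"

definition rrest :: real where
  "rrest = (\<Sum>j. a (j + 2) * q ^ (j + 2))"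

lemma alpha_nonneg: "\<alpha> \<ge> 0" using a_nonneg[of 1] a1 by simp

lemma B_ge: "B \<ge> 1" using a_le[of 0] a0 by simp

lemma term_le: "real (Suc j) * (a j * q ^ j) \<le> B * (3 / 4) ^ j"
proof -
  have "real (Suc j) * a j * q ^ j \<le> (B * (3 / 2) ^ j) * (1 / 2) ^ j"
    using q B_ge by (intro mult_mono a_le power_mono) auto
  also have "\<dots> = B * (3 / 4) ^ j" by (simp flip: power_mult_distrib)
  finally show ?thesis by (simp add: mult.assoc)
qed

lemma term_le': "a j * q ^ j \<le> B * (3 / 4) ^ j"
proof -
  have "1 * (a j * q ^ j) \<le> real (Suc j) * (a j * q ^ j)"
    using a_nonneg[of j] q by (intro mult_right_mono) auto
  with term_le[of j] show ?thesis by simp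
qed

lemma term2_le: "real (Suc (j + 2)) * (a (j + 2) * q ^ (j + 2)) \<le> (9 / 4 * B * q ^ 2) * (3 / 4) ^ j"
proof -
  have "q ^ 2 * q ^ j \<le> q ^ 2 * (1 / 2) ^ j"
    using q by (intro mult_left_mono power_mono) auto
  hence "q ^ (j + 2) \<le> q ^ 2 * (1 / 2) ^ j"
    unfolding power_add by (subst mult.commute)
  hence "real (Suc (j + 2)) * a (j + 2) * q ^ (j + 2) \<le> (B * (3 / 2) ^ (j + 2)) * (q ^ 2 * (1 / 2) ^ j)"
    by (intro mult_mono a_le) (use q B_ge in auto)
  also have "\<dots> = (9 / 4 * B * q ^ 2) * ((3 / 2) * (1 / 2)) ^ j"
    unfolding power_mult_distrib by (simp add: power2_eq_square)
  finally show ?thesis by (simp add: mult.assoc)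
qed

lemma term2_le': "a (j + 2) * q ^ (j + 2) \<le> (9 / 4 * B * q ^ 2) * (3 / 4) ^ j"
proof -
  have "1 * (a (j + 2) * q ^ (j + 2)) \<le> real (Suc (j + 2)) * (a (j + 2) * q ^ (j + 2))"
    using a_nonneg[of "j + 2"] q by (intro mult_right_mono) auto
  with term2_le[of j] show ?thesis by simp
qed

lemma nonneg_term: "a j * q ^ j \<ge> 0" using a_nonneg q by simp

lemma summable_term: "summable (\<lambda>j. a j * q ^ j)"
  by (rule summable_geometric_bound(1)[OF nonneg_term term_le'])

lemma summable_norm_term:
  assumes "norm z \<le> 1"
  shows "summable (\<lambda>j. norm (complex_of_real (a j * q ^ j) * z ^ j))"
proof (rule summable_comparison_test[OF _ summable_term], intro exI allI impI)
  fix j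
  have "\<bar>a j * q ^ j\<bar> * norm z ^ j \<le> (a j * q ^ j) * 1"
    using nonneg_term[of j] assms by (intro mult_mono) (auto intro: power_le_one)
  thus "norm (norm (complex_of_real (a j * q ^ j) * z ^ j)) \<le> a j * q ^ j"
    by (simp only: norm_mult norm_power norm_of_real real_norm_def abs_mult abs_norm_cancel abs_abs power_abs mult_1_right)
qed

lemma summable_cterm: "norm z \<le> 1 \<Longrightarrow> summable (\<lambda>j. complex_of_real (a j * q ^ j) * z ^ j)"
  by (rule summable_norm_cancel[OF summable_norm_term])

lemma rfac_eq: "rfac = 1 + \<alpha> * q + rrest"
  unfolding rfac_def rrest_def using suminf_split_initial_segment[OF summable_term, of 2]
  by (simp add: a0 a1 numeral_2_eq_2)

lemma fac_eq: "norm z \<le> 1 \<Longrightarrow> fac z = 1 + of_real (\<alpha> * q) * z + rest z"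
  unfolding fac_def rest_def using suminf_split_initial_segment[OF summable_cterm, of z 2]
  by (simp add: a0 a1 numeral_2_eq_2)

lemma rrest_bounds: "0 \<le> rrest" "rrest \<le> 9 * B * q ^ 2"
proof -
  note s = summable_geometric_bound[OF nonneg_term[of "_ + 2"] term2_le']
  show "0 \<le> rrest" unfolding rrest_def by (rule suminf_nonneg[OF s(1) nonneg_term])
  show "rrest \<le> 9 * B * q ^ 2" unfolding rrest_def using s(2) by simp
qed

lemma rfac_ge: "rfac \<ge> 1 + \<alpha> * q" and rfac_ge_1: "rfac \<ge> 1"
  using rfac_eq rrest_bounds alpha_nonneg q by simp_all

lemma norm_fac_le: "norm z \<le> 1 \<Longrightarrow> norm (fac z) \<le> rfac"
proof -
  assume z: "norm z \<le> 1"
  have "norm (fac z) \<le> (\<Sum>j. norm (complex_of_real (a j * q ^ j) * z ^ j))"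
    unfolding fac_def by (rule summable_norm[OF summable_norm_term[OF z]])
  also have "\<dots> \<le> rfac" unfolding rfac_def
  proof (rule suminf_le[OF _ summable_norm_term[OF z] summable_term])
    fix j
    have "\<bar>a j * q ^ j\<bar> * norm z ^ j \<le> (a j * q ^ j) * 1"
      using nonneg_term[of j] z by (intro mult_mono) (auto intro: power_le_one)
    thus "norm (complex_of_real (a j * q ^ j) * z ^ j) \<le> a j * q ^ j"
      by (simp only: norm_mult norm_power norm_of_real mult_1_right)
  qed
  finally show ?thesis .
qed

lemma norm_rest_diff_le:
  assumes z: "norm z \<le> 1"
  shows "norm (rest z - of_real rrest) \<le> 9 * B * q ^ 2 * norm (z - 1)"
proof -
  have s2: "summable (\<lambda>j. a (j + 2) * q ^ (j + 2))"
    by (rule summable_geometric_bound(1)[OF nonneg_term term2_le'])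
  have sz: "summable (\<lambda>j. complex_of_real (a (j + 2) * q ^ (j + 2)) * z ^ (j + 2))"
    by (rule summable_ignore_initial_segment[OF summable_cterm[OF z]])
  have t: "norm (complex_of_real (a (j + 2) * q ^ (j + 2)) * (z ^ (j + 2) - 1))
      \<le> (9 / 4 * B * q ^ 2 * norm (z - 1)) * (3 / 4) ^ j" for j
  proof -
    have "norm (complex_of_real (a (j + 2) * q ^ (j + 2)) * (z ^ (j + 2) - 1))
        = (a (j + 2) * q ^ (j + 2)) * norm (z ^ (j + 2) - 1)"
      using nonneg_term[of "j + 2"] by (simp only: norm_mult norm_of_real abs_of_nonneg)
    also have "\<dots> \<le> (a (j + 2) * q ^ (j + 2)) * (real (Suc (j + 2)) * norm (z - 1))"
      by (intro mult_left_mono nonneg_term order_trans[OF norm_power_diff_le[OF z]] mult_right_mono) auto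
    also have "\<dots> \<le> (9 / 4 * B * q ^ 2) * (3 / 4) ^ j * norm (z - 1)"
      using mult_right_mono[OF term2_le[of j], of "norm (z - 1)"] by (simp add: mult_ac)
    finally show ?thesis by (simp add: mult_ac)
  qed
  note S = summable_geometric_bound[OF norm_ge_zero t]
  have "of_real rrest = (\<Sum>j. complex_of_real (a (j + 2) * q ^ (j + 2)))"
    unfolding rrest_def by (rule suminf_of_real[OF s2])
  hence "rest z - of_real rrest = (\<Sum>j. complex_of_real (a (j + 2) * q ^ (j + 2)) * z ^ (j + 2) - complex_of_real (a (j + 2) * q ^ (j + 2)))"
    unfolding rest_def using suminf_diff[OF sz summable_of_real[OF s2]] by simp
  also have "\<dots> = (\<Sum>j. complex_of_real (a (j + 2) * q ^ (j + 2)) * (z ^ (j + 2) - 1))"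
    by (simp add: algebra_simps)
  also have "norm \<dots> \<le> (\<Sum>j. norm (complex_of_real (a (j + 2) * q ^ (j + 2)) * (z ^ (j + 2) - 1)))"
    by (rule summable_norm[OF S(1)])
  also have "\<dots> \<le> 4 * (9 / 4 * B * q ^ 2 * norm (z - 1))" by (rule S(2))
  finally show ?thesis by (simp add: mult_ac)
qed

text \<open>The lower bound is ln (1 + t) \<ge> t - t^2 for t \<le> 1 and trivial for larger t; the
  upper bound is 1 + u \<le> exp u. The quadratic errors will be summable over primes.\<close>

lemma rfac_exp_bounds: "exp (\<alpha> * q - \<alpha>\<^sup>2 * q\<^sup>2) \<le> rfac" "rfac \<le> exp (\<alpha> * q + 9 * B * q\<^sup>2)"
proof -
  define t where "t = \<alpha> * q"
  have t: "t \<ge> 0" using alpha_nonneg q by (simp add: t_def)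
  have "exp (t - t\<^sup>2) \<le> 1 + t"
  proof -
    show ?thesis
    proof (cases "t \<le> 1")
      case True
      have "t - t\<^sup>2 \<le> ln (1 + t)" by (rule ln_one_plus_pos_lower_bound) (use t True in auto)
      thus ?thesis using t by (metis add_pos_nonneg exp_le_cancel_iff exp_ln zero_less_one)
    next
      case False
      hence "t - t\<^sup>2 \<le> 0" by (simp add: power2_eq_square)
      hence "exp (t - t\<^sup>2) \<le> 1" by simp
      also have "1 \<le> 1 + t" using t by simp
      finally show ?thesis .
    qed
  qed
  thus "exp (\<alpha> * q - \<alpha>\<^sup>2 * q\<^sup>2) \<le> rfac" using rfac_ge by (simp add: t_def power_mult_distrib)
  have "rfac \<le> 1 + (\<alpha> * q + 9 * B * q\<^sup>2)" using rfac_eq rrest_bounds by simp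
  also have "\<dots> \<le> exp (\<alpha> * q + 9 * B * q\<^sup>2)" by (rule exp_ge_add_one_self)
  finally show "rfac \<le> exp (\<alpha> * q + 9 * B * q\<^sup>2)" .
qed

text \<open>Both sides are 1 + w up to an error with two small factors: q^2, which makes the sum
  over primes converge, and |z - 1|, which tends to 0 when z is a characteristic-function argument.
  The second factor is gained by comparing with the values at z = 1.\<close>

lemma fac_ratio_close:
  assumes z: "norm z \<le> 1"
  shows "norm (fac z / of_real rfac - exp (of_real (\<alpha> * q) * (z - 1)))
         \<le> (9 * B + \<alpha> * (\<alpha> + 9 * B) + 2 * exp \<alpha> * \<alpha>\<^sup>2) * q\<^sup>2 * norm (z - 1)"
proof -
  define w where "w = complex_of_real (\<alpha> * q) * (z - 1)"
  define R where "R = rest z - of_real rrest"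
  have d: "norm (z - 1) \<le> 2" using z norm_triangle_ineq4[of z 1] by simp
  have nw: "norm w = \<alpha> * q * norm (z - 1)" using alpha_nonneg q by (simp add: w_def norm_mult abs_mult)
  have fz: "fac z = of_real rfac + w + R"
    using fac_eq[OF z] rfac_eq by (simp add: w_def R_def algebra_simps)
  have r0: "rfac \<noteq> 0" using rfac_ge_1 by auto
  \<comment> \<open>An exact expansion: what remains beyond 1 + w is the difference of the terms of
    degree at least 2, and w times 1 - 1 / \<open>rfac\<close>, where the latter is O(q).\<close>
  have "fac z / of_real rfac - 1 - w = R / of_real rfac - w * of_real (1 - 1 / rfac)"
    using r0 by (simp add: fz field_simps)
  also have "norm \<dots> \<le> norm (R / of_real rfac) + norm (w * of_real (1 - 1 / rfac))"
    by (rule norm_triangle_ineq4)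
  also have "norm (R / of_real rfac) \<le> norm R / 1"
    using rfac_ge_1 divide_left_mono[of 1 rfac "norm R"] by (simp add: norm_divide)
  also have "norm R / 1 \<le> 9 * B * q\<^sup>2 * norm (z - 1)" using norm_rest_diff_le[OF z] by (simp add: R_def)
  also have "norm (w * of_real (1 - 1 / rfac)) \<le> (\<alpha> * q * norm (z - 1)) * (\<alpha> * q + 9 * B * q\<^sup>2)"
  proof -
    have "\<bar>1 - 1 / rfac\<bar> = (rfac - 1) / rfac" using rfac_ge_1 by (simp add: field_simps)
    also have "\<dots> \<le> (rfac - 1) / 1" using rfac_ge_1 by (intro divide_left_mono) auto
    also have "\<dots> \<le> \<alpha> * q + 9 * B * q\<^sup>2" using rfac_eq rrest_bounds by simp
    finally have "\<bar>1 - 1 / rfac\<bar> \<le> \<alpha> * q + 9 * B * q\<^sup>2" .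
    thus ?thesis unfolding norm_mult norm_of_real nw using alpha_nonneg q by (intro mult_left_mono) auto
  qed
  also have "(\<alpha> * q * norm (z - 1)) * (\<alpha> * q + 9 * B * q\<^sup>2) \<le> (\<alpha> * (\<alpha> + 9 * B)) * q\<^sup>2 * norm (z - 1)"
  proof -
    have "9 * B * q\<^sup>2 \<le> 9 * B * q" using q B_ge by (intro mult_left_mono) (auto simp: power2_eq_square mult_le_one mult_left_le)
    hence "(\<alpha> * q * norm (z - 1)) * (\<alpha> * q + 9 * B * q\<^sup>2) \<le> (\<alpha> * q * norm (z - 1)) * (\<alpha> * q + 9 * B * q)"
      using alpha_nonneg q by (intro mult_left_mono) auto
    thus ?thesis by (simp add: power2_eq_square algebra_simps)
  qed
  finally have 1: "norm (fac z / of_real rfac - 1 - w) \<le> 9 * B * q\<^sup>2 * norm (z - 1) + (\<alpha> * (\<alpha> + 9 * B)) * q\<^sup>2 * norm (z - 1)"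
    by simp
  \<comment> \<open>Since q \<le> 1 / 2 and |z - 1| \<le> 2, the norm of w is at most \<alpha>,
    which bounds the exponential factor in Taylor's remainder.\<close>
  have "norm (exp w - (\<Sum>i\<le>1. w ^ i / fact i)) \<le> exp \<bar>Re w\<bar> * norm w ^ Suc 1 / fact 1"
    by (rule Taylor_exp)
  hence "norm (exp w - 1 - w) \<le> exp \<bar>Re w\<bar> * (norm w)\<^sup>2" by (simp add: algebra_simps numeral_2_eq_2)
  also have "\<dots> \<le> exp \<alpha> * (norm w)\<^sup>2"
  proof (intro mult_right_mono)
    have "\<bar>Re w\<bar> \<le> norm w" by (rule abs_Re_le_cmod)
    also have "\<dots> \<le> \<alpha> * (1 / 2) * 2" unfolding nw using alpha_nonneg q d by (intro mult_mono) auto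
    finally show "exp \<bar>Re w\<bar> \<le> exp \<alpha>" by simp
  qed auto
  also have "(norm w)\<^sup>2 = \<alpha>\<^sup>2 * q\<^sup>2 * (norm (z - 1) * norm (z - 1))"
    unfolding nw by (simp add: power2_eq_square mult_ac)
  also have "\<dots> \<le> \<alpha>\<^sup>2 * q\<^sup>2 * (2 * norm (z - 1))" using d by (intro mult_left_mono mult_right_mono) auto
  finally have 2: "norm (exp w - 1 - w) \<le> 2 * exp \<alpha> * \<alpha>\<^sup>2 * q\<^sup>2 * norm (z - 1)"
    by (simp add: mult_ac)
  have "fac z / of_real rfac - exp w = (fac z / of_real rfac - 1 - w) - (exp w - 1 - w)" by simp
  also have "norm \<dots> \<le> norm (fac z / of_real rfac - 1 - w) + norm (exp w - 1 - w)" by (rule norm_triangle_ineq4)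
  finally show ?thesis using 1 2 unfolding w_def by (simp add: algebra_simps)
qed

end

section \<open>The function Omega and sums over primes\<close>

lemma prime_Omega_mult: "m > 0 \<Longrightarrow> n > 0 \<Longrightarrow> prime_Omega (m * n) = prime_Omega m + prime_Omega n"
  by (simp add: prime_Omega_def prime_factorization_mult)

lemma prime_Omega_1: "prime_Omega (Suc 0) = 0"
  by (simp add: prime_Omega_def)

lemma prime_Omega_prime_power: "prime p \<Longrightarrow> prime_Omega (p ^ j) = j"
  by (simp add: prime_Omega_def prime_factorization_prime_power)

definition primes_upto :: "nat \<Rightarrow> nat set" where
  "primes_upto N = {p. prime p \<and> p \<le> N}"

lemma finite_primes_upto [simp, intro]: "finite (primes_upto N)"
  unfolding primes_upto_def by (rule finite_subset[of _ "{..N}"]) auto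

lemma primes_upto_subset: "primes_upto N \<subseteq> {1..N}"
  unfolding primes_upto_def using prime_ge_1_nat by auto

lemma prime_of_primes_upto: "p \<in> primes_upto N \<Longrightarrow> prime p"
  by (simp add: primes_upto_def)

lemma sum_inverse_squares_primes_le: "(\<Sum>p\<in>primes_upto N. 1 / real p ^ 2) \<le> 2"
proof -
  have "(\<Sum>p\<in>primes_upto N. 1 / real p ^ 2) \<le> (\<Sum>p\<in>{1..N}. 1 / real p ^ 2)"
    using primes_upto_subset by (intro sum_mono2) auto
  also have "\<dots> \<le> 2" using sum_inverse_squares_le[of "real N"] by simp
  finally show ?thesis .
qed

lemma real_powr_prime_bounds:
  assumes "prime p" "\<sigma> \<ge> 1"
  shows "real p powr (-\<sigma>) \<le> 1 / real p" "0 \<le> real p powr (-\<sigma>)" "real p powr (-\<sigma>) \<le> 1 / 2"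
    "(real p powr (-\<sigma>))\<^sup>2 \<le> 1 / real p ^ 2"
proof -
  have p: "real p \<ge> 2" using prime_ge_2_nat[OF assms(1)] by simp
  have "real p powr (-\<sigma>) \<le> real p powr (-1)" using p assms by (intro powr_mono) auto
  also have "\<dots> = 1 / real p" using p by (simp add: powr_minus_divide)
  finally show 1: "real p powr (-\<sigma>) \<le> 1 / real p" .
  show 0: "0 \<le> real p powr (-\<sigma>)" by simp
  have "1 / real p \<le> 1 / 2" using p by (intro divide_left_mono) auto
  with 1 show "real p powr (-\<sigma>) \<le> 1 / 2" by linarith
  have "(real p powr (-\<sigma>))\<^sup>2 \<le> (1 / real p)\<^sup>2" using 0 1 by (intro power_mono)
  thus "(real p powr (-\<sigma>))\<^sup>2 \<le> 1 / real p ^ 2" by (simp add: power_divide)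
qed

text \<open>Mean value theorem for \<open>t powr (-\<delta>) / \<delta>\<close>, an antiderivative
  up to sign; summation telescopes and brackets the zeta sum around 1 / \<delta>.\<close>

lemma powr_telescope_bounds:
  assumes "n \<ge> (1::nat)" "\<delta> > 0"
  defines "h \<equiv> \<lambda>n. real n powr (-\<delta>) / \<delta>"
  shows "h n - h (Suc n) \<le> real n powr (- (1 + \<delta>))" "real (Suc n) powr (- (1 + \<delta>)) \<le> h n - h (Suc n)"
proof -
  define H where "H = (\<lambda>t. - (t powr (-\<delta>) / \<delta>))"
  have e: "- \<delta> - 1 = - (1 + \<delta>)" by simp
  have deriv: "(H has_real_derivative t powr (- \<delta> - 1)) (at t)" if "real n \<le> t" for t
    unfolding H_def using that assms by (auto intro!: derivative_eq_intros)
  obtain t where t: "real n < t" "t < real (Suc n)" "H (real (Suc n)) - H (real n) = (real (Suc n) - real n) * t powr (- (1 + \<delta>))"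
    using MVT2[of "real n" "real (Suc n)" H "\<lambda>t. t powr (- \<delta> - 1)"] deriv unfolding e by auto
  hence eq: "h n - h (Suc n) = t powr (- (1 + \<delta>))" by (simp add: H_def h_def)
  show "h n - h (Suc n) \<le> real n powr (- (1 + \<delta>))"
    unfolding eq using t assms by (intro powr_mono2') auto
  show "real (Suc n) powr (- (1 + \<delta>)) \<le> h n - h (Suc n)"
    unfolding eq using t assms by (intro powr_mono2') auto
qed

lemma sum_powr_bounds:
  assumes "\<delta> > 0"
  shows "(\<Sum>n\<in>{1..N}. real n powr (- (1 + \<delta>))) \<le> 1 + 1 / \<delta>"
    and "1 / \<delta> - real (Suc N) powr (-\<delta>) / \<delta> \<le> (\<Sum>n\<in>{1..N}. real n powr (- (1 + \<delta>)))"
proof -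
  have "(\<Sum>n\<in>{1..Suc N}. real n powr (- (1 + \<delta>))) \<le> 1 + 1 / \<delta> - real (Suc N) powr (-\<delta>) / \<delta>" for N
  proof (induction N)
    case (Suc N)
    with powr_telescope_bounds(2)[of "Suc N", OF _ assms] show ?case by simp
  qed simp
  hence *: "(\<Sum>n\<in>{1..Suc N}. real n powr (- (1 + \<delta>))) \<le> 1 + 1 / \<delta>" for N
    by (rule order_trans) (use assms in simp)
  show "(\<Sum>n\<in>{1..N}. real n powr (- (1 + \<delta>))) \<le> 1 + 1 / \<delta>"
    using *[of "N - 1"] assms by (cases N) auto
  show "1 / \<delta> - real (Suc N) powr (-\<delta>) / \<delta> \<le> (\<Sum>n\<in>{1..N}. real n powr (- (1 + \<delta>)))"
  proof (induction N)
    case (Suc N)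
    with powr_telescope_bounds(1)[of "Suc N", OF _ assms] show ?case by simp
  qed simp
qed

definition prime_zeta_upto :: "real \<Rightarrow> nat \<Rightarrow> real" where
  "prime_zeta_upto \<sigma> N = (\<Sum>p\<in>primes_upto N. real p powr (-\<sigma>))"

lemma prime_zeta_upto_le: "\<delta> > 0 \<Longrightarrow> prime_zeta_upto (1 + \<delta>) N \<le> 1 + 1 / \<delta>"
proof -
  assume d: "\<delta> > 0"
  have "prime_zeta_upto (1 + \<delta>) N \<le> (\<Sum>n\<in>{1..N}. real n powr (- (1 + \<delta>)))"
    unfolding prime_zeta_upto_def using primes_upto_subset by (intro sum_mono2) auto
  with sum_powr_bounds(1)[OF d, of N] show ?thesis by simp
qed

section \<open>The Dirichlet series of a multiplicative weight\<close>

text \<open>The divisor bound is kept in the form it takes on prime powers, where it is polynomial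
  in j. The ratio 3 / 2 lies above 1, so it absorbs any polynomial, and below 2, so that all local
  series converge for \<sigma> \<ge> 1, even at p = 2.\<close>

locale weight_fun =
  fixes f :: "nat \<Rightarrow> real" and \<alpha> B :: real
  assumes alpha_pos: "\<alpha> > 0"
    and f_multiplicative: "multiplicative f"
    and f_nonneg: "n \<ge> 1 \<Longrightarrow> f n \<ge> 0"
    and f_prime: "prime p \<Longrightarrow> f p = \<alpha>"
    and f_prime_power: "prime p \<Longrightarrow> real (Suc j) * f (p ^ j) \<le> B * (3 / 2) ^ j"
begin

lemma f_Suc_0: "f (Suc 0) = 1"
  using f_multiplicative by (auto simp: multiplicative_def)

lemma f_mult: "m > 0 \<Longrightarrow> n > 0 \<Longrightarrow> coprime m n \<Longrightarrow> f (m * n) = f m * f n"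
  using f_multiplicative by (auto simp: multiplicative_def)

lemma local_factor:
  assumes "prime p" "\<sigma> \<ge> 1"
  shows "local_factor (\<lambda>j. f (p ^ j)) \<alpha> B (real p powr (-\<sigma>))"
  using assms real_powr_prime_bounds[OF assms] f_prime_power[OF assms(1)] f_prime
  by unfold_locales (auto simp: f_Suc_0 f_nonneg prime_gt_0_nat Suc_le_eq)

lemma B_ge_1: "B \<ge> 1"
  using f_prime_power[of 2 0] by (simp add: f_Suc_0)

definition w :: "real \<Rightarrow> nat \<Rightarrow> real" where
  "w \<sigma> n = f n * real n powr (-\<sigma>)"

text \<open>Coefficients of the Dirichlet series of f(n) * z^Omega(n). It is multiplicative in n,
  and for z on the unit circle it generates the characteristic function of Omega.\<close>

definition zw :: "real \<Rightarrow> complex \<Rightarrow> nat \<Rightarrow> complex" where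
  "zw \<sigma> z n = of_real (w \<sigma> n) * z ^ prime_Omega n"

lemma w_nonneg: "n \<ge> 1 \<Longrightarrow> w \<sigma> n \<ge> 0"
  by (simp add: w_def f_nonneg)

lemma w_1: "w \<sigma> (Suc 0) = 1" by (simp add: w_def f_Suc_0)

lemma w_mult: "m > 0 \<Longrightarrow> n > 0 \<Longrightarrow> coprime m n \<Longrightarrow> w \<sigma> (m * n) = w \<sigma> m * w \<sigma> n"
  by (simp add: w_def f_mult powr_mult)

lemma zw_mult: "m > 0 \<Longrightarrow> n > 0 \<Longrightarrow> coprime m n \<Longrightarrow> zw \<sigma> z (m * n) = zw \<sigma> z m * zw \<sigma> z n"
  by (simp add: zw_def w_mult prime_Omega_mult power_add)

lemma zw_1: "zw \<sigma> z (Suc 0) = 1"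
  by (simp add: zw_def w_1 prime_Omega_1)

lemma w_prime_power: "prime p \<Longrightarrow> w \<sigma> (p ^ j) = f (p ^ j) * (real p powr (-\<sigma>)) ^ j"
proof -
  assume p: "prime p"
  have "real (p ^ j) powr (-\<sigma>) = (real p powr (-\<sigma>)) ^ j"
    using prime_gt_0_nat[OF p] by (simp add: powr_powr powr_realpow[symmetric] mult.commute)
  thus ?thesis by (simp add: w_def)
qed

definition Rfac :: "real \<Rightarrow> nat \<Rightarrow> real" where
  "Rfac \<sigma> p = (\<Sum>j. w \<sigma> (p ^ j))"

definition Cfac :: "real \<Rightarrow> complex \<Rightarrow> nat \<Rightarrow> complex" where
  "Cfac \<sigma> z p = (\<Sum>j. zw \<sigma> z (p ^ j))"

lemma
  assumes "prime p" "\<sigma> \<ge> 1"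
  shows Rfac_eq: "Rfac \<sigma> p = local_factor.rfac (\<lambda>j. f (p ^ j)) (real p powr (-\<sigma>))"
    and Cfac_eq: "Cfac \<sigma> z p = local_factor.fac (\<lambda>j. f (p ^ j)) (real p powr (-\<sigma>)) z"
proof -
  interpret local_factor "\<lambda>j. f (p ^ j)" \<alpha> B "real p powr (-\<sigma>)" by (rule local_factor[OF assms])
  show "Rfac \<sigma> p = rfac" unfolding Rfac_def rfac_def using assms by (simp add: w_prime_power)
  show "Cfac \<sigma> z p = fac z" unfolding Cfac_def fac_def zw_def
    using assms by (simp add: w_prime_power prime_Omega_prime_power)
qed

lemma summable_w_prime_power:
  assumes "prime p" "\<sigma> \<ge> 1"
  shows "summable (\<lambda>j. norm (w \<sigma> (p ^ j)))"
proof -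
  interpret local_factor "\<lambda>j. f (p ^ j)" \<alpha> B "real p powr (-\<sigma>)" by (rule local_factor[OF assms])
  have "norm (w \<sigma> (p ^ j)) = f (p ^ j) * (real p powr (-\<sigma>)) ^ j" for j
    using nonneg_term[of j] assms by (simp add: w_prime_power del: abs_mult)
  thus ?thesis using summable_term by simp
qed

lemma summable_zw_prime_power:
  assumes "prime p" "\<sigma> \<ge> 1" "norm z \<le> 1"
  shows "summable (\<lambda>j. norm (zw \<sigma> z (p ^ j)))"
proof -
  interpret local_factor "\<lambda>j. f (p ^ j)" \<alpha> B "real p powr (-\<sigma>)" by (rule local_factor[OF assms(1,2)])
  show ?thesis using summable_norm_term[OF assms(3)] assms
    by (simp add: zw_def w_prime_power prime_Omega_prime_power)
qed

lemma Rfac_ge_1: "prime p \<Longrightarrow> \<sigma> \<ge> 1 \<Longrightarrow> Rfac \<sigma> p \<ge> 1"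
  using local_factor.rfac_ge_1[OF local_factor] by (simp add: Rfac_eq)

text \<open>The quadratic terms of the local bounds are summed by means of the series of 1 / p^2,
  which is at most 2; this gives \<open>2 * \<alpha>\<^sup>2\<close> and \<open>18 * B\<close>. The
  product is finite, so \<sigma> = 1 is included.\<close>

lemma prod_Rfac_bounds:
  assumes "\<sigma> \<ge> 1"
  shows "exp (\<alpha> * prime_zeta_upto \<sigma> N - 2 * \<alpha>\<^sup>2) \<le> (\<Prod>p\<in>primes_upto N. Rfac \<sigma> p)"
    and "(\<Prod>p\<in>primes_upto N. Rfac \<sigma> p) \<le> exp (\<alpha> * prime_zeta_upto \<sigma> N + 18 * B)"
proof -
  let ?q = "\<lambda>p. real p powr (-\<sigma>)"
  have Q: "(\<Sum>p\<in>primes_upto N. (?q p)\<^sup>2) \<le> 2"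
    using sum_mono[of "primes_upto N" "\<lambda>p. (?q p)\<^sup>2" "\<lambda>p. 1 / real p ^ 2"]
      real_powr_prime_bounds(4)[OF _ assms] sum_inverse_squares_primes_le[of N]
    by (force simp: primes_upto_def)
  have lf: "exp (\<alpha> * ?q p - \<alpha>\<^sup>2 * (?q p)\<^sup>2) \<le> Rfac \<sigma> p" "Rfac \<sigma> p \<le> exp (\<alpha> * ?q p + 9 * B * (?q p)\<^sup>2)"
    if "p \<in> primes_upto N" for p
    using that local_factor.rfac_exp_bounds[OF local_factor[OF _ assms], of p] assms
    by (auto simp: Rfac_eq primes_upto_def)
  have "exp (\<alpha> * prime_zeta_upto \<sigma> N - 2 * \<alpha>\<^sup>2) \<le> exp (\<Sum>p\<in>primes_upto N. \<alpha> * ?q p - \<alpha>\<^sup>2 * (?q p)\<^sup>2)"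
    using mult_left_mono[OF Q, of "\<alpha>\<^sup>2"] by (simp add: prime_zeta_upto_def sum_subtractf sum_distrib_left[symmetric])
  also have "\<dots> = (\<Prod>p\<in>primes_upto N. exp (\<alpha> * ?q p - \<alpha>\<^sup>2 * (?q p)\<^sup>2))" by (rule exp_sum) simp
  also have "\<dots> \<le> (\<Prod>p\<in>primes_upto N. Rfac \<sigma> p)" using lf by (intro prod_mono) auto
  finally show "exp (\<alpha> * prime_zeta_upto \<sigma> N - 2 * \<alpha>\<^sup>2) \<le> (\<Prod>p\<in>primes_upto N. Rfac \<sigma> p)" .
  have "(\<Prod>p\<in>primes_upto N. Rfac \<sigma> p) \<le> (\<Prod>p\<in>primes_upto N. exp (\<alpha> * ?q p + 9 * B * (?q p)\<^sup>2))"
    using lf Rfac_ge_1[OF prime_of_primes_upto assms] by (intro prod_mono) (force intro: order_trans[of 0 1])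
  also have "\<dots> = exp (\<Sum>p\<in>primes_upto N. \<alpha> * ?q p + 9 * B * (?q p)\<^sup>2)" by (rule exp_sum[symmetric]) simp
  also have "\<dots> \<le> exp (\<alpha> * prime_zeta_upto \<sigma> N + 18 * B)"
    using mult_left_mono[OF Q, of "9 * B"] B_ge_1 by (simp add: prime_zeta_upto_def sum.distrib sum_distrib_left[symmetric])
  finally show "(\<Prod>p\<in>primes_upto N. Rfac \<sigma> p) \<le> exp (\<alpha> * prime_zeta_upto \<sigma> N + 18 * B)" .
qed

text \<open>By nonnegativity any finite partial sum over smooth numbers stays below the finite Euler
  product. This gives convergence for \<sigma> > 1 and, at \<sigma> = 1, the size of logarithmic
  sums over smooth numbers.\<close>

lemma sum_w_le_prod:
  assumes "\<sigma> \<ge> 1" "finite F" "F \<subseteq> smooth_numbers (primes_upto N)"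
  shows "(\<Sum>n\<in>F. w \<sigma> n) \<le> (\<Prod>p\<in>primes_upto N. Rfac \<sigma> p)"
proof -
  have "(w \<sigma> has_sum (\<Prod>p\<in>primes_upto N. \<Sum>j. w \<sigma> (p ^ j))) (smooth_numbers (primes_upto N))"
    using assms w_1 by (intro conjunct2[OF Euler_product_smooth] w_mult summable_w_prime_power)
      (auto simp: primes_upto_def)
  thus ?thesis unfolding Rfac_def using assms
    by (intro finite_sum_le_has_sum) (auto simp: smooth_numbers_def intro!: w_nonneg)
qed

definition E :: "real \<Rightarrow> real" where
  "E \<sigma> = (\<Sum>\<^sub>\<infinity>n\<in>{0<..}. w \<sigma> n)"

lemma summable_w:
  assumes "\<sigma> > 1"
  shows "w \<sigma> summable_on {0<..}"
proof (rule nonneg_bdd_above_summable_on)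
  show "bdd_above (sum (w \<sigma>) ` {F. F \<subseteq> {0<..} \<and> finite F})"
  proof (rule bdd_aboveI2)
    fix F :: "nat set" assume F: "F \<in> {F. F \<subseteq> {0<..} \<and> finite F}"
    define N where "N = Max (insert 0 F)"
    have "n \<in> {1..N}" if "n \<in> F" for n
      using that F Max_ge[of "insert 0 F" n] by (auto simp: N_def Suc_le_eq)
    hence "F \<subseteq> smooth_numbers (primes_upto N)" using smooth_numbers_supset[of N] unfolding primes_upto_def by blast
    hence "sum (w \<sigma>) F \<le> (\<Prod>p\<in>primes_upto N. Rfac \<sigma> p)" using F assms by (intro sum_w_le_prod) auto
    also have "\<dots> \<le> exp (\<alpha> * prime_zeta_upto \<sigma> N + 18 * B)" using assms by (intro prod_Rfac_bounds) auto
    also have "\<dots> \<le> exp (\<alpha> * (1 + 1 / (\<sigma> - 1)) + 18 * B)"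
      using prime_zeta_upto_le[of "\<sigma> - 1" N] assms alpha_pos by simp
    finally show "sum (w \<sigma>) F \<le> exp (\<alpha> * (1 + 1 / (\<sigma> - 1)) + 18 * B)" .
  qed
qed (auto intro!: w_nonneg)

lemma has_sum_w: "\<sigma> > 1 \<Longrightarrow> (w \<sigma> has_sum E \<sigma>) {0<..}"
  unfolding E_def using summable_w by simp

lemma norm_w_summable: "\<sigma> > 1 \<Longrightarrow> (\<lambda>n. norm (w \<sigma> n)) summable_on {0<..}"
  using summable_w by (subst summable_on_cong[where g = "w \<sigma>"]) (auto simp: w_nonneg abs_of_nonneg)

lemma E_limit:
  assumes "\<sigma> > 1"
  shows "(\<lambda>N. \<Prod>p\<in>primes_upto N. Rfac \<sigma> p) \<longlonglongrightarrow> E \<sigma>"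
  unfolding Rfac_def primes_upto_def
  using assms w_1 by (intro Euler_product_limit w_mult norm_w_summable has_sum_w summable_w_prime_power) auto

lemma norm_zw_le: "n > 0 \<Longrightarrow> norm z \<le> 1 \<Longrightarrow> norm (zw \<sigma> z n) \<le> w \<sigma> n"
  using w_nonneg[of n \<sigma>] by (auto simp: zw_def norm_mult norm_power intro!: mult_left_le power_le_one)

lemma norm_zw_summable:
  assumes "\<sigma> > 1" "norm z \<le> 1"
  shows "(\<lambda>n. norm (zw \<sigma> z n)) summable_on {0<..}"
  by (rule summable_on_comparison_test[OF summable_w[OF assms(1)]]) (use norm_zw_le assms in auto)

definition EZ :: "real \<Rightarrow> complex \<Rightarrow> complex" where
  "EZ \<sigma> z = (\<Sum>\<^sub>\<infinity>n\<in>{0<..}. zw \<sigma> z n)"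

lemma has_sum_zw: "\<sigma> > 1 \<Longrightarrow> norm z \<le> 1 \<Longrightarrow> (zw \<sigma> z has_sum EZ \<sigma> z) {0<..}"
  unfolding EZ_def using abs_summable_summable[OF norm_zw_summable] by simp

lemma EZ_limit:
  assumes "\<sigma> > 1" "norm z \<le> 1"
  shows "(\<lambda>N. \<Prod>p\<in>primes_upto N. Cfac \<sigma> z p) \<longlonglongrightarrow> EZ \<sigma> z"
  unfolding Cfac_def primes_upto_def
  using assms zw_1 by (intro Euler_product_limit zw_mult norm_zw_summable has_sum_zw summable_zw_prime_power) auto

end

lemma LIMSEQ_of_has_sum_positive:
  fixes g :: "nat \<Rightarrow> 'a :: real_normed_vector"
  assumes "(g has_sum s) {0<..}"
  shows "(\<lambda>N. \<Sum>n\<in>{1..N}. g n) \<longlonglongrightarrow> s"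
proof -
  have "{0<..} = Suc ` UNIV" by (auto simp: image_iff gr0_conv_Suc)
  hence "((g \<circ> Suc) has_sum s) UNIV" using assms by (simp add: has_sum_reindex)
  hence "(\<lambda>N. \<Sum>i<N. g (Suc i)) \<longlonglongrightarrow> s"
    using has_sum_imp_sums by (fastforce simp: sums_def o_def)
  thus ?thesis by (simp add: sum.atLeast1_atMost_eq)
qed

text \<open>The prime zeta function; the limit exists for \<sigma> > 1, where the partial sums
  increase and are bounded.\<close>

definition prime_zeta :: "real \<Rightarrow> real" where
  "prime_zeta \<sigma> = lim (prime_zeta_upto \<sigma>)"

lemma prime_zeta_LIMSEQ:
  assumes "\<sigma> > 1"
  shows "prime_zeta_upto \<sigma> \<longlonglongrightarrow> prime_zeta \<sigma>"
proof -
  have "incseq (prime_zeta_upto \<sigma>)"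
    unfolding prime_zeta_upto_def
    by (intro monoI sum_mono2) (auto simp: primes_upto_def)
  moreover have "prime_zeta_upto \<sigma> N \<le> 1 + 1 / (\<sigma> - 1)" for N
    using prime_zeta_upto_le[of "\<sigma> - 1" N] assms by simp
  ultimately obtain L where "prime_zeta_upto \<sigma> \<longlonglongrightarrow> L" using incseq_convergent by blast
  thus ?thesis unfolding prime_zeta_def by (simp add: limI)
qed

context weight_fun
begin

lemma E_exp_bounds:
  assumes "\<sigma> > 1"
  shows "exp (\<alpha> * prime_zeta \<sigma> - 2 * \<alpha>\<^sup>2) \<le> E \<sigma>" "E \<sigma> \<le> exp (\<alpha> * prime_zeta \<sigma> + 18 * B)"
proof -
  have "(\<lambda>N. exp (\<alpha> * prime_zeta_upto \<sigma> N - 2 * \<alpha>\<^sup>2)) \<longlonglongrightarrow> exp (\<alpha> * prime_zeta \<sigma> - 2 * \<alpha>\<^sup>2)"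
    by (intro tendsto_intros prime_zeta_LIMSEQ assms)
  thus "exp (\<alpha> * prime_zeta \<sigma> - 2 * \<alpha>\<^sup>2) \<le> E \<sigma>"
    by (rule LIMSEQ_le[OF _ E_limit[OF assms]]) (use prod_Rfac_bounds(1) assms in auto)
  have "(\<lambda>N. exp (\<alpha> * prime_zeta_upto \<sigma> N + 18 * B)) \<longlonglongrightarrow> exp (\<alpha> * prime_zeta \<sigma> + 18 * B)"
    by (intro tendsto_intros prime_zeta_LIMSEQ assms)
  thus "E \<sigma> \<le> exp (\<alpha> * prime_zeta \<sigma> + 18 * B)"
    by (rule LIMSEQ_le[OF E_limit[OF assms]]) (use prod_Rfac_bounds(2) assms in auto)
qed

end

lemma Suc_mult_power_bound: "real (Suc j) \<le> 2 * (3 / 2) ^ j"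
proof (induction j)
  case (Suc j)
  show ?case
  proof (cases "j = 0")
    case False
    hence "real (Suc (Suc j)) \<le> 3 / 2 * real (Suc j)" by (simp add: field_simps)
    also have "\<dots> \<le> 3 / 2 * (2 * (3 / 2) ^ j)" using Suc by (intro mult_left_mono) auto
    finally show ?thesis by simp
  qed simp
qed simp

text \<open>For the constant weight 1 the series \<open>unit.E\<close> is the Riemann zeta function.
  Its known size near 1 determines \<open>prime_zeta\<close> up to a bounded error, and this is then
  used for every other weight.\<close>

interpretation unit: weight_fun "\<lambda>_. 1" 1 2
  by unfold_locales (use Suc_mult_power_bound in \<open>auto simp: multiplicative_def\<close>)

lemma unit_E_bounds:
  assumes "\<delta> > 0"
  shows "1 / \<delta> \<le> unit.E (1 + \<delta>)" "unit.E (1 + \<delta>) \<le> 1 + 1 / \<delta>"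
proof -
  have lim: "(\<lambda>N. \<Sum>n\<in>{1..N}. real n powr (- (1 + \<delta>))) \<longlonglongrightarrow> unit.E (1 + \<delta>)"
    using LIMSEQ_of_has_sum_positive[OF unit.has_sum_w[of "1 + \<delta>"]] assms by (simp add: unit.w_def)
  have "((\<lambda>x. x powr (-\<delta>)) \<longlongrightarrow> 0) at_top" using assms by (intro tendsto_neg_powr filterlim_ident) auto
  hence "(\<lambda>N. real (Suc N) powr (-\<delta>)) \<longlonglongrightarrow> 0"
    by (rule filterlim_compose) (rule filterlim_compose[OF filterlim_real_sequentially filterlim_Suc])
  hence "(\<lambda>N. 1 / \<delta> - real (Suc N) powr (-\<delta>) / \<delta>) \<longlonglongrightarrow> 1 / \<delta> - 0 / \<delta>"
    by (intro tendsto_intros) (use assms in auto)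
  hence "(\<lambda>N. 1 / \<delta> - real (Suc N) powr (-\<delta>) / \<delta>) \<longlonglongrightarrow> 1 / \<delta>" by simp
  thus "1 / \<delta> \<le> unit.E (1 + \<delta>)"
    by (rule LIMSEQ_le[OF _ lim]) (use sum_powr_bounds(2)[OF assms] in auto)
  show "unit.E (1 + \<delta>) \<le> 1 + 1 / \<delta>"
    by (rule LIMSEQ_le_const2[OF lim]) (use sum_powr_bounds(1)[OF assms] in auto)
qed

text \<open>The exponential of the prime sum equals zeta (1 + \<delta>) up to the factors exp 2 and
  exp 36 of the unit weight (36 = 18 * 2), and zeta (1 + \<delta>) lies between 1 / \<delta> and 1 +
  1 / \<delta>.\<close>

lemma prime_zeta_bounds:
  assumes "0 < \<delta>" "\<delta> \<le> 1"
  shows "\<bar>prime_zeta (1 + \<delta>) - ln (1 / \<delta>)\<bar> \<le> 36"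
proof -
  have d: "1 / \<delta> > 0" "1 / \<delta> \<ge> 1" using assms by auto
  have "exp (prime_zeta (1 + \<delta>) - 2) \<le> 1 + 1 / \<delta>"
    using unit.E_exp_bounds(1)[of "1 + \<delta>"] unit_E_bounds(2)[of \<delta>] assms by simp
  also have "\<dots> \<le> 1 / \<delta> * 2" using d by linarith
  also have "\<dots> \<le> 1 / \<delta> * exp 1" using d exp_ge_add_one_self[of "1::real"] by (intro mult_left_mono) auto
  also have "\<dots> = exp (ln (1 / \<delta>) + 1)" using d by (simp add: exp_add)
  finally have 1: "prime_zeta (1 + \<delta>) - 2 \<le> ln (1 / \<delta>) + 1" by simp
  have "exp (ln (1 / \<delta>)) = 1 / \<delta>" using d by simp
  also have "\<dots> \<le> exp (prime_zeta (1 + \<delta>) + 36)"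
    using unit.E_exp_bounds(2)[of "1 + \<delta>"] unit_E_bounds(1)[of \<delta>] assms by simp
  finally have "ln (1 / \<delta>) \<le> prime_zeta (1 + \<delta>) + 36" by simp
  with 1 show ?thesis by linarith
qed

context weight_fun
begin

lemma E_bounds:
  obtains c C where "0 < c" "0 < C" "\<And>\<delta>. 0 < \<delta> \<Longrightarrow> \<delta> \<le> 1 \<Longrightarrow> c * \<delta> powr (-\<alpha>) \<le> E (1 + \<delta>)"
    "\<And>\<delta>. 0 < \<delta> \<Longrightarrow> \<delta> \<le> 1 \<Longrightarrow> E (1 + \<delta>) \<le> C * \<delta> powr (-\<alpha>)"
proof
  fix \<delta> :: real assume d: "0 < \<delta>" "\<delta> \<le> 1"
  have pw: "\<delta> powr (-\<alpha>) = exp (\<alpha> * ln (1 / \<delta>))"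
    using d by (simp add: powr_def ln_div)
  have z: "\<alpha> * \<bar>prime_zeta (1 + \<delta>) - ln (1 / \<delta>)\<bar> \<le> \<alpha> * 36"
    using prime_zeta_bounds[OF d] alpha_pos by (intro mult_left_mono) auto
  hence z': "\<bar>\<alpha> * prime_zeta (1 + \<delta>) - \<alpha> * ln (1 / \<delta>)\<bar> \<le> 36 * \<alpha>"
    using alpha_pos by (simp add: abs_mult right_diff_distrib[symmetric])
  have "exp (- 36 * \<alpha> - 2 * \<alpha>\<^sup>2) * \<delta> powr (-\<alpha>) \<le> exp (\<alpha> * prime_zeta (1 + \<delta>) - 2 * \<alpha>\<^sup>2)"
    unfolding pw exp_add[symmetric] using z' by simp
  also have "\<dots> \<le> E (1 + \<delta>)" using d by (intro E_exp_bounds) simp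
  finally show "exp (- 36 * \<alpha> - 2 * \<alpha>\<^sup>2) * \<delta> powr (-\<alpha>) \<le> E (1 + \<delta>)" .
  have "E (1 + \<delta>) \<le> exp (\<alpha> * prime_zeta (1 + \<delta>) + 18 * B)" using d by (intro E_exp_bounds) simp
  also have "\<dots> \<le> exp (36 * \<alpha> + 18 * B) * \<delta> powr (-\<alpha>)"
    unfolding pw exp_add[symmetric] using z' by simp
  finally show "E (1 + \<delta>) \<le> exp (36 * \<alpha> + 18 * B) * \<delta> powr (-\<alpha>)" .
qed auto

lemma E_pos: "\<sigma> > 1 \<Longrightarrow> E \<sigma> > 0"
  using E_exp_bounds(1)[of \<sigma>] exp_gt_zero less_le_trans by blast

text \<open>All local factors on both sides have norm at most 1, so the difference of the products
  is at most the sum of the local differences, which converges through 1 / p^2. The constant is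
  uniform in \<sigma> and z, since both will vary with x.\<close>

lemma EZ_ratio_close:
  obtains K where "\<And>\<sigma> z. \<sigma> > 1 \<Longrightarrow> norm z \<le> 1 \<Longrightarrow>
    norm (EZ \<sigma> z / of_real (E \<sigma>) - exp (of_real (\<alpha> * prime_zeta \<sigma>) * (z - 1))) \<le> K * norm (z - 1)"
proof
  fix \<sigma> :: real and z :: complex assume s: "\<sigma> > 1" and z: "norm z \<le> 1"
  define K where "K = 9 * B + \<alpha> * (\<alpha> + 9 * B) + 2 * exp \<alpha> * \<alpha>\<^sup>2"
  have K: "K \<ge> 0" unfolding K_def using alpha_pos B_ge_1 by (intro add_nonneg_nonneg mult_nonneg_nonneg) auto
  let ?q = "\<lambda>p. real p powr (-\<sigma>)"
  let ?a = "\<lambda>p. Cfac \<sigma> z p / of_real (Rfac \<sigma> p)" and ?b = "\<lambda>p. exp (of_real (\<alpha> * ?q p) * (z - 1))"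
  have lim1: "(\<lambda>N. \<Prod>p\<in>primes_upto N. ?a p) \<longlonglongrightarrow> EZ \<sigma> z / of_real (E \<sigma>)"
    unfolding prod_dividef of_real_prod[symmetric]
    by (intro tendsto_intros EZ_limit E_limit s z) (use E_pos[OF s] in auto)
  have lim2: "(\<lambda>N. \<Prod>p\<in>primes_upto N. ?b p) \<longlonglongrightarrow> exp (of_real (\<alpha> * prime_zeta \<sigma>) * (z - 1))"
  proof -
    have "(\<Prod>p\<in>primes_upto N. ?b p) = exp (of_real (\<alpha> * prime_zeta_upto \<sigma> N) * (z - 1))" for N
      by (simp add: exp_sum[symmetric] prime_zeta_upto_def sum_distrib_left sum_distrib_right)
    moreover have "(\<lambda>N. exp (of_real (\<alpha> * prime_zeta_upto \<sigma> N) * (z - 1))) \<longlonglongrightarrow> exp (of_real (\<alpha> * prime_zeta \<sigma>) * (z - 1))"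
      by (intro tendsto_intros prime_zeta_LIMSEQ s)
    ultimately show ?thesis by simp
  qed
  have "norm ((\<Prod>p\<in>primes_upto N. ?a p) - (\<Prod>p\<in>primes_upto N. ?b p)) \<le> 2 * K * norm (z - 1)" for N
  proof -
    have a: "norm (?a p) \<le> 1" if "p \<in> primes_upto N" for p
    proof -
      have p: "prime p" using that by (rule prime_of_primes_upto)
      have "norm (Cfac \<sigma> z p) \<le> Rfac \<sigma> p"
        using local_factor.norm_fac_le[OF local_factor[OF p], of \<sigma> z] z s by (simp add: Cfac_eq Rfac_eq p)
      moreover have "Rfac \<sigma> p \<ge> 1" using Rfac_ge_1[OF p] s by simp
      ultimately show ?thesis by (simp add: norm_divide divide_le_eq_1)
    qed
    have b: "norm (?b p) \<le> 1" for p
    proof -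
      have "Re z \<le> 1" using z complex_Re_le_cmod[of z] by linarith
      hence "\<alpha> * ?q p * (Re z - 1) \<le> 0" using alpha_pos by (intro mult_nonneg_nonpos) auto
      thus ?thesis by simp
    qed
    have "norm ((\<Prod>p\<in>primes_upto N. ?a p) - (\<Prod>p\<in>primes_upto N. ?b p)) \<le> (\<Sum>p\<in>primes_upto N. norm (?a p - ?b p))"
      using a b by (intro norm_prod_diff) auto
    also have "\<dots> \<le> (\<Sum>p\<in>primes_upto N. K * norm (z - 1) * (1 / real p ^ 2))"
    proof (rule sum_mono)
      fix p assume "p \<in> primes_upto N"
      hence p: "prime p" by (rule prime_of_primes_upto)
      have "norm (?a p - ?b p) \<le> K * (?q p)\<^sup>2 * norm (z - 1)"
        using local_factor.fac_ratio_close[OF local_factor[OF p], of \<sigma> z] z s unfolding K_def by (simp add: Cfac_eq Rfac_eq p)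
      also have "\<dots> \<le> K * (1 / real p ^ 2) * norm (z - 1)"
        using real_powr_prime_bounds(4)[OF p, of \<sigma>] s K by (intro mult_right_mono mult_left_mono) auto
      finally show "norm (?a p - ?b p) \<le> K * norm (z - 1) * (1 / real p ^ 2)" by (simp add: mult_ac)
    qed
    also have "\<dots> = K * norm (z - 1) * (\<Sum>p\<in>primes_upto N. 1 / real p ^ 2)" by (rule sum_distrib_left[symmetric])
    also have "\<dots> \<le> K * norm (z - 1) * 2"
      using K by (intro mult_left_mono sum_inverse_squares_primes_le) auto
    finally show ?thesis by simp
  qed
  hence "norm (EZ \<sigma> z / of_real (E \<sigma>) - exp (of_real (\<alpha> * prime_zeta \<sigma>) * (z - 1))) \<le> 2 * K * norm (z - 1)"
    by (intro LIMSEQ_le_const2[OF tendsto_norm[OF tendsto_diff[OF lim1 lim2]]]) auto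
  thus "norm (EZ \<sigma> z / of_real (E \<sigma>) - exp (of_real (\<alpha> * prime_zeta \<sigma>) * (z - 1)))
      \<le> (2 * (9 * B + \<alpha> * (\<alpha> + 9 * B) + 2 * exp \<alpha> * \<alpha>\<^sup>2)) * norm (z - 1)" unfolding K_def .
qed

end

section \<open>Logarithmic factors and the total weight of prime powers\<close>

text \<open>A logarithm that is at least 1 on all x \<ge> 1, so that bounds involving quotients hold
  from x = 1 on without exceptions for small x.\<close>

definition ell :: "real \<Rightarrow> real" where
  "ell x = 1 + ln x"

lemma ell_ge_1: "x \<ge> 1 \<Longrightarrow> ell x \<ge> 1"
  by (simp add: ell_def)

lemma ell_mono: "1 \<le> x \<Longrightarrow> x \<le> y \<Longrightarrow> ell x \<le> ell y"
  by (simp add: ell_def)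

text \<open>From 1 + a + b \<le> (1 + a) * (1 + b). Passing from x / q to x thus costs only a factor
  \<open>ell q\<close>, which the convergent series over q can afford.\<close>

lemma ell_div_le: "1 \<le> q \<Longrightarrow> 1 \<le> x / q \<Longrightarrow> ell x \<le> ell (x / q) * ell q"
proof -
  assume q: "1 \<le> q" "1 \<le> x / q"
  hence x: "x > 0" by (simp add: field_simps)
  have "ell x = 1 + ln (x / q) + ln q" using q x by (simp add: ell_def ln_div)
  moreover have "ln (x / q) * ln q \<ge> 0" using q by simp
  ultimately show ?thesis by (simp add: ell_def algebra_simps)
qed

lemma ell_le_sqrt: "x \<ge> 1 \<Longrightarrow> ell x \<le> 3 * sqrt x"
proof -
  assume x: "x \<ge> 1"
  have "ln x \<le> 2 * sqrt x" using ln_powr_bound[of x "1/2"] x by (simp add: powr_half_sqrt)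
  moreover have "sqrt x \<ge> 1" using x by simp
  ultimately show ?thesis unfolding ell_def by linarith
qed

lemma sqrt_div_sq: "n > 0 \<Longrightarrow> sqrt (real n) / real n ^ 2 = real n powr (- (1 + 1 / 2))"
proof -
  assume n: "n > 0"
  have "sqrt (real n) / real n ^ 2 = real n powr (1 / 2) / real n powr 2"
    using n by (simp add: powr_half_sqrt)
  also have "\<dots> = real n powr (1 / 2 - 2)" by (simp only: powr_diff)
  finally show ?thesis by simp
qed

lemma sum_sqrt_div_sq_le: "(\<Sum>n\<in>{1..N}. sqrt (real n) / real n ^ 2) \<le> 3"
proof -
  have "(\<Sum>n\<in>{1..N}. sqrt (real n) / real n ^ 2) = (\<Sum>n\<in>{1..N}. real n powr (- (1 + 1 / 2)))"
    by (intro sum.cong refl sqrt_div_sq) auto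
  also have "\<dots> \<le> 1 + 1 / (1 / 2)" by (rule sum_powr_bounds(1)) simp
  finally show ?thesis by simp
qed

lemma sq_times_geometric_le: "real j ^ 2 * (3 / 4) ^ j \<le> 256 * (9 / 10) ^ j"
proof -
  have "1 + real j * (1 / 16) \<le> (1 + 1 / 16) ^ j" by (rule Bernoulli_inequality) simp
  hence "real j \<le> 16 * (17 / 16) ^ j" by simp
  hence "real j ^ 2 * (3 / 4) ^ j \<le> (16 * (17 / 16) ^ j) ^ 2 * (3 / 4) ^ j"
    by (intro mult_right_mono power_mono) auto
  also have "\<dots> = 256 * ((17 / 16) ^ 2 * (3 / 4)) ^ j"
  proof -
    have "(16 * a ^ j) ^ 2 * b ^ j = 256 * (a ^ 2 * b) ^ j" for a b :: real
      by (simp add: power_mult_distrib power_mult[symmetric] mult.commute)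
    thus ?thesis by blast
  qed
  also have "\<dots> \<le> 256 * (9 / 10) ^ j" by (intro mult_left_mono power_mono) (auto simp: power2_eq_square)
  finally show ?thesis .
qed

lemma sum_sq_times_geometric_le: "finite J \<Longrightarrow> (\<Sum>j\<in>J. real j ^ 2 * (3 / 4) ^ j) \<le> 2560"
proof -
  assume J: "finite J"
  have "(\<Sum>j\<in>J. real j ^ 2 * (3 / 4) ^ j) \<le> (\<Sum>j\<in>J. 256 * (9 / 10) ^ j)"
    by (intro sum_mono sq_times_geometric_le)
  also have "\<dots> \<le> (\<Sum>j. 256 * (9 / 10) ^ j)"
    using J by (intro sum_le_suminf summable_mult summable_geometric) auto
  also have "\<dots> = 2560" by (subst suminf_mult) (auto simp: suminf_geometric)
  finally show ?thesis .
qed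

text \<open>Prime powers with exponent at least 2 carry bounded total weight. The logarithms are at
  most 34 * j * sqrt p, and (3 / (2 * p)) ^ j is at most 4 / p^2 * (3 / 4) ^ j because j \<ge> 2 and
  p \<ge> 2; the double sum then factors, and 1044480 = 136 * 2560 * 3.\<close>

lemma prime_power_weights_le:
  "(\<Sum>p\<in>primes_upto N. \<Sum>j\<in>{2..N}. real j * ln (real p) * (3 / 2) ^ j * (1 + ln (real p ^ j)) / real p ^ j) \<le> 1044480"
proof -
  have "real j * ln (real p) * (3 / 2) ^ j * (1 + ln (real p ^ j)) / real p ^ j
      \<le> 136 * (real j ^ 2 * (3 / 4) ^ j) * (sqrt (real p) / real p ^ 2)"
    if p: "p \<in> primes_upto N" and j: "j \<in> {2..N}" for p j
  proof -
    have p2: "real p \<ge> 2" using prime_ge_2_nat[OF prime_of_primes_upto[OF p]] by simp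
    have l: "ln (real p) \<ge> 0" using p2 by simp
    obtain i where i: "j = i + 2" using j by (metis atLeastAtMost_iff le_add_diff_inverse2)
    have "1 + ln (real p ^ j) \<le> real j + real j * ln (real p)" using p2 j by (simp add: ln_realpow)
    hence "ln (real p) * (1 + ln (real p ^ j)) \<le> ln (real p) * (real j * (1 + ln (real p)))"
      using l by (intro mult_left_mono) (auto simp: algebra_simps)
    also have "\<dots> \<le> real j * (2 + 2 * (ln (real p))\<^sup>2)"
    proof -
      have "ln (real p) * (1 + ln (real p)) \<le> 2 + 2 * (ln (real p))\<^sup>2"
        using sum_squares_bound[of "ln (real p)" 1] l by (simp add: power2_eq_square algebra_simps)
      hence "real j * (ln (real p) * (1 + ln (real p))) \<le> real j * (2 + 2 * (ln (real p))\<^sup>2)"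
        by (intro mult_left_mono) auto
      thus ?thesis by (simp only: mult_ac)
    qed
    also have "\<dots> \<le> real j * (34 * sqrt (real p))"
    proof -
      have "1 \<le> sqrt (real p)" using p2 by simp
      hence "2 + 2 * (ln (real p))\<^sup>2 \<le> 34 * sqrt (real p)" using ln_sq_le_sqrt[of "real p"] p2 by linarith
      thus ?thesis by (intro mult_left_mono) auto
    qed
    finally have 1: "ln (real p) * (1 + ln (real p ^ j)) \<le> real j * (34 * sqrt (real p))" .
    have "(3 / 2 / real p) ^ i \<le> (3 / 4) ^ i" using p2 by (intro power_mono) (auto simp: field_simps)
    hence "(3 / 2 / real p) ^ 2 * (3 / 2 / real p) ^ i \<le> (3 / 2 / real p) ^ 2 * (3 / 4) ^ i"
      by (intro mult_left_mono) auto
    hence 2: "(3 / 2 / real p) ^ j \<le> 4 / real p ^ 2 * (3 / 4) ^ j"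
      unfolding i power_add by (simp add: power_divide power2_eq_square mult_ac)
    have "real j * ln (real p) * (3 / 2) ^ j * (1 + ln (real p ^ j)) / real p ^ j
        = real j * (ln (real p) * (1 + ln (real p ^ j))) * (3 / 2 / real p) ^ j"
      by (simp add: power_divide)
    also have "\<dots> \<le> real j * (real j * (34 * sqrt (real p))) * (4 / real p ^ 2 * (3 / 4) ^ j)"
      by (rule mult_mono[OF mult_left_mono[OF 1] 2]) auto
    finally show ?thesis by (simp add: power2_eq_square mult_ac)
  qed
  hence "(\<Sum>p\<in>primes_upto N. \<Sum>j\<in>{2..N}. real j * ln (real p) * (3 / 2) ^ j * (1 + ln (real p ^ j)) / real p ^ j)
      \<le> (\<Sum>p\<in>primes_upto N. \<Sum>j\<in>{2..N}. 136 * (real j ^ 2 * (3 / 4) ^ j) * (sqrt (real p) / real p ^ 2))"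
    by (intro sum_mono)
  also have "\<dots> = 136 * (\<Sum>j\<in>{2..N}. real j ^ 2 * (3 / 4) ^ j) * (\<Sum>p\<in>primes_upto N. sqrt (real p) / real p ^ 2)"
    unfolding sum_distrib_left sum_distrib_right by (rule refl)
  also have "\<dots> \<le> 136 * 2560 * 3"
  proof -
    have "(\<Sum>p\<in>primes_upto N. sqrt (real p) / real p ^ 2) \<le> (\<Sum>n\<in>{1..N}. sqrt (real n) / real n ^ 2)"
      using primes_upto_subset by (intro sum_mono2) auto
    also have "\<dots> \<le> 3" by (rule sum_sqrt_div_sq_le)
    finally show ?thesis
      by (intro mult_mono mult_left_mono sum_sq_times_geometric_le) (auto intro!: sum_nonneg)
  qed
  finally show ?thesis by simp
qed

section \<open>Summatory functions\<close>

context weight_fun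
begin

definition Sh :: "(nat \<Rightarrow> real) \<Rightarrow> real \<Rightarrow> real" where
  "Sh h x = (\<Sum>n\<in>nats_le x. f n * h n)"

definition S :: "real \<Rightarrow> real" where
  "S x = (\<Sum>n\<in>nats_le x. f n)"

definition A :: "real \<Rightarrow> real" where
  "A x = (\<Sum>n\<in>nats_le x. f n / real n)"

text \<open>The order of magnitude of the logarithmic sum \<open>A x\<close>; that of
  \<open>S x\<close> will be x * lp x / ell x.\<close>

definition lp :: "real \<Rightarrow> real" where
  "lp x = ell x powr \<alpha>"

lemma f_nonneg': "n \<in> nats_le x \<Longrightarrow> f n \<ge> 0"
  by (auto simp: mem_nats_le intro: f_nonneg)

lemma S_nonneg: "S x \<ge> 0" unfolding S_def by (intro sum_nonneg f_nonneg')

lemma A_nonneg: "A x \<ge> 0" unfolding A_def by (intro sum_nonneg divide_nonneg_nonneg f_nonneg') auto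

lemma lp_ge_1: "x \<ge> 1 \<Longrightarrow> lp x \<ge> 1"
  unfolding lp_def using ell_ge_1 alpha_pos by (simp add: ge_one_powr_ge_zero)

lemma lp_mono: "1 \<le> x \<Longrightarrow> x \<le> y \<Longrightarrow> lp x \<le> lp y"
  unfolding lp_def using ell_mono[of x y] ell_ge_1[of x] alpha_pos by (intro powr_mono2) auto

lemma S_ge_1: "x \<ge> 1 \<Longrightarrow> S x \<ge> 1" and A_ge_1: "x \<ge> 1 \<Longrightarrow> A x \<ge> 1"
  using member_le_sum[of 1 "nats_le x" f] member_le_sum[of 1 "nats_le x" "\<lambda>n. f n / real n"] one_mem_nats_le[of x]
    f_nonneg'[of _ x] by (auto simp: S_def A_def f_Suc_0)

lemma A_mono: "x \<le> y \<Longrightarrow> A x \<le> A y"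
  unfolding A_def by (intro sum_mono2 nats_le_mono finite_nats_le divide_nonneg_nonneg f_nonneg'[of _ y]) auto

lemma S_le_A: "x \<ge> 0 \<Longrightarrow> S x \<le> x * A x"
  unfolding S_def A_def sum_distrib_left
proof (rule sum_mono)
  fix n assume "x \<ge> 0" "n \<in> nats_le x"
  thus "f n \<le> x * (f n / real n)"
    using f_nonneg'[of n x] mult_right_mono[of "real n" x "f n"] by (auto simp: mem_nats_le field_simps)
qed

lemma S_less_1: "x < 1 \<Longrightarrow> S x = 0"
  by (simp add: S_def nats_le_less_one)

lemma abs_Sh_le: "(\<And>n. n \<ge> 1 \<Longrightarrow> \<bar>h n\<bar> \<le> b) \<Longrightarrow> \<bar>Sh h x\<bar> \<le> b * S x"
proof -
  assume h: "\<And>n. n \<ge> 1 \<Longrightarrow> \<bar>h n\<bar> \<le> b"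
  have "\<bar>Sh h x\<bar> \<le> (\<Sum>n\<in>nats_le x. \<bar>f n * h n\<bar>)" unfolding Sh_def by (rule sum_abs)
  also have "\<dots> \<le> (\<Sum>n\<in>nats_le x. b * f n)"
  proof (rule sum_mono)
    fix n assume n: "n \<in> nats_le x"
    hence "f n * \<bar>h n\<bar> \<le> f n * b" using h f_nonneg'[OF n] by (intro mult_left_mono) (auto simp: mem_nats_le)
    thus "\<bar>f n * h n\<bar> \<le> b * f n" using f_nonneg'[OF n] by (simp add: abs_mult mult.commute)
  qed
  finally show ?thesis by (simp add: S_def sum_distrib_left)
qed

text \<open>Rankin's trick with \<delta> = 1 / \<open>ell x\<close>: for n \<le> x the factor n powr
  \<delta> is at most e, so the finite sum is at most e times the Dirichlet series at 1 +
  \<delta>.\<close>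

lemma A_upper: "\<exists>C>0. \<forall>x\<ge>1. A x \<le> C * lp x"
proof -
  obtain c C where C: "C > 0" "\<And>\<delta>. 0 < \<delta> \<Longrightarrow> \<delta> \<le> 1 \<Longrightarrow> E (1 + \<delta>) \<le> C * \<delta> powr (-\<alpha>)"
    using E_bounds by metis
  have "A x \<le> exp 1 * C * lp x" if x: "x \<ge> 1" for x
  proof -
    define \<delta> where "\<delta> = 1 / ell x"
    have d: "0 < \<delta>" "\<delta> \<le> 1" using ell_ge_1[OF x] by (auto simp: \<delta>_def)
    have "A x \<le> (\<Sum>n\<in>nats_le x. exp 1 * w (1 + \<delta>) n)"
      unfolding A_def
    proof (rule sum_mono)
      fix n assume n: "n \<in> nats_le x"
      have n1: "real n \<ge> 1" "real n \<le> x" using n by (auto simp: mem_nats_le)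
      have "\<delta> * ln (real n) \<le> \<delta> * ell x" using n1 d by (intro mult_left_mono) (auto simp: ell_def ln_le_cancel_iff intro: order_trans[of _ "ln x"])
      also have "\<dots> = 1" using ell_ge_1[OF x] by (simp add: \<delta>_def)
      finally have "real n powr \<delta> \<le> exp 1" using n1 by (simp add: powr_def)
      hence "f n / real n \<le> exp 1 * (f n / real n / real n powr \<delta>)"
        using n1 f_nonneg'[OF n] mult_right_mono[of "real n powr \<delta>" "exp 1" "f n"] by (simp add: field_simps)
      also have "f n / real n / real n powr \<delta> = w (1 + \<delta>) n"
        using n1 by (simp add: w_def powr_diff powr_minus_divide powr_add field_simps)
      finally show "f n / real n \<le> exp 1 * w (1 + \<delta>) n" .
    qed
    also have "\<dots> = exp 1 * (\<Sum>n\<in>nats_le x. w (1 + \<delta>) n)" by (simp add: sum_distrib_left)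
    also have "\<dots> \<le> exp 1 * E (1 + \<delta>)"
      using has_sum_w[of "1 + \<delta>"] d
      by (intro mult_left_mono finite_sum_le_has_sum) (auto simp: mem_nats_le intro!: w_nonneg)
    also have "\<dots> \<le> exp 1 * (C * \<delta> powr (-\<alpha>))" using C(2)[OF d] by (intro mult_left_mono) auto
    also have "\<delta> powr (-\<alpha>) = lp x"
      unfolding lp_def \<delta>_def using ell_ge_1[OF x] by (simp add: powr_divide powr_minus_divide)
    finally show ?thesis by (simp add: mult_ac)
  qed
  with C(1) show ?thesis by (intro exI[of _ "exp 1 * C"]) auto
qed

text \<open>For n \<ge> x half of the exponent \<delta> is spent on n powr (-\<delta> / 2) \<le> x
  powr (-\<delta> / 2); the other half keeps the series convergent.\<close>

lemma tail_w_le: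
  assumes "x \<ge> 1" "\<delta> > 0"
  shows "E (1 + \<delta>) \<le> (\<Sum>n\<in>nats_le x. w (1 + \<delta>) n) + x powr (-\<delta> / 2) * E (1 + \<delta> / 2)"
proof -
  let ?T = "{0<..} - nats_le x"
  have sub: "nats_le x \<subseteq> {0<..}" by (auto simp: mem_nats_le)
  have "(w (1 + \<delta>) has_sum (E (1 + \<delta>) - (\<Sum>n\<in>nats_le x. w (1 + \<delta>) n))) ?T"
    using assms by (intro has_sum_Diff has_sum_w has_sum_finite sub) auto
  moreover have "((\<lambda>n. x powr (-\<delta> / 2) * w (1 + \<delta> / 2) n) has_sum (x powr (-\<delta> / 2) * (E (1 + \<delta> / 2) - (\<Sum>n\<in>nats_le x. w (1 + \<delta> / 2) n)))) ?T"
    using assms by (intro has_sum_cmult_right has_sum_Diff has_sum_w has_sum_finite sub) auto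
  ultimately have "E (1 + \<delta>) - (\<Sum>n\<in>nats_le x. w (1 + \<delta>) n)
      \<le> x powr (-\<delta> / 2) * (E (1 + \<delta> / 2) - (\<Sum>n\<in>nats_le x. w (1 + \<delta> / 2) n))"
  proof (rule has_sum_mono)
    fix n assume n: "n \<in> ?T"
    hence n1: "n \<ge> 1" "real n \<ge> x" by (auto simp: mem_nats_le not_le)
    have e: "- (1 + \<delta>) = -\<delta> / 2 + - (1 + \<delta> / 2)" by simp
    have "w (1 + \<delta>) n = real n powr (-\<delta> / 2) * w (1 + \<delta> / 2) n"
      unfolding w_def e powr_add by simp
    also have "\<dots> \<le> x powr (-\<delta> / 2) * w (1 + \<delta> / 2) n"
      using n1 assms by (intro mult_right_mono powr_mono2' w_nonneg) auto
    finally show "w (1 + \<delta>) n \<le> x powr (-\<delta> / 2) * w (1 + \<delta> / 2) n" .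
  qed
  also have "\<dots> \<le> x powr (-\<delta> / 2) * E (1 + \<delta> / 2)"
    using sum_nonneg[of "nats_le x" "w (1 + \<delta> / 2)"] w_nonneg by (intro mult_left_mono) (auto simp: mem_nats_le)
  finally show ?thesis by simp
qed

text \<open>Take \<delta> = K / \<open>ell x\<close> with a large constant K. The tail beyond x is
  then at most half of the lower bound for \<open>E (1 + \<delta>)\<close>, so the terms up to x
  carry the other half. For bounded x the term n = 1 is enough.\<close>

lemma A_lower: "\<exists>c>0. \<forall>x\<ge>1. A x \<ge> c * lp x"
proof -
  obtain c C where c: "0 < c" "0 < C" "\<And>\<delta>. 0 < \<delta> \<Longrightarrow> \<delta> \<le> 1 \<Longrightarrow> c * \<delta> powr (-\<alpha>) \<le> E (1 + \<delta>)"
    "\<And>\<delta>. 0 < \<delta> \<Longrightarrow> \<delta> \<le> 1 \<Longrightarrow> E (1 + \<delta>) \<le> C * \<delta> powr (-\<alpha>)"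
    using E_bounds by metis
  \<comment> \<open>Since \<open>ell x \<le> 2 * ln x\<close>, the tail is damped by exp (-K / 4); K
    makes this beat the factor C * 2 powr \<alpha>, which comes from comparing E at 1 + \<delta> / 2
    with E at 1 + \<delta>.\<close>
  define K where "K = max 2 (4 * ln (2 * C * 2 powr \<alpha> / c))"
  have K: "K \<ge> 2" by (simp add: K_def)
  have expK: "C * 2 powr \<alpha> * exp (- K / 4) \<le> c / 2"
  proof -
    have "ln (2 * C * 2 powr \<alpha> / c) \<le> K / 4" by (simp add: K_def)
    hence "exp (ln (2 * C * 2 powr \<alpha> / c)) \<le> exp (K / 4)" by simp
    hence "2 * C * 2 powr \<alpha> / c \<le> exp (K / 4)" using c by simp
    thus ?thesis using c by (simp add: field_simps exp_minus)
  qed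
  define c' where "c' = min (c / 2) 1 * K powr (-\<alpha>)"
  have "c' > 0" using c K by (simp add: c'_def)
  moreover have "A x \<ge> c' * lp x" if x: "x \<ge> 1" for x
  proof (cases "ell x \<ge> K")
    case False
    hence "lp x \<le> K powr \<alpha>" unfolding lp_def using ell_ge_1[OF x] alpha_pos by (intro powr_mono2) auto
    hence "c' * lp x \<le> (1 * K powr (-\<alpha>)) * K powr \<alpha>"
      unfolding c'_def using lp_ge_1[OF x] by (intro mult_mono) auto
    also have "\<dots> = 1" using K by (simp add: powr_minus_divide)
    finally show ?thesis using A_ge_1[OF x] by simp
  next
    case True
    define \<delta> where "\<delta> = K / ell x"
    have ell: "ell x \<ge> 2" "ln x \<ge> 1" using True K by (auto simp: ell_def)
    have d: "0 < \<delta>" "\<delta> \<le> 1" using True K ell by (auto simp: \<delta>_def)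
    have dp: "\<delta> powr (-\<alpha>) = K powr (-\<alpha>) * lp x"
      unfolding \<delta>_def lp_def using K ell by (simp add: powr_divide powr_minus_divide)
    have "x powr (-\<delta> / 2) \<le> exp (-K / 4)"
    proof -
      have "ell x \<le> 2 * ln x" using ell by (simp add: ell_def)
      hence "K * ell x \<le> K * (2 * ln x)" using K by (intro mult_left_mono) auto
      hence "K / 4 \<le> \<delta> / 2 * ln x" using ell by (simp add: \<delta>_def field_simps)
      thus ?thesis using x by (simp add: powr_def)
    qed
    hence "x powr (-\<delta> / 2) * E (1 + \<delta> / 2) \<le> exp (-K / 4) * (C * (\<delta> / 2) powr (-\<alpha>))"
      using c(4)[of "\<delta> / 2"] d E_pos[of "1 + \<delta> / 2"] by (intro mult_mono) auto
    also have "(\<delta> / 2) powr (-\<alpha>) = \<delta> powr (-\<alpha>) * 2 powr \<alpha>"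
      using d by (simp add: powr_divide powr_minus_divide)
    also have "exp (-K / 4) * (C * (\<delta> powr (-\<alpha>) * 2 powr \<alpha>)) = (C * 2 powr \<alpha> * exp (- K / 4)) * \<delta> powr (-\<alpha>)"
      by simp
    also have "\<dots> \<le> c / 2 * \<delta> powr (-\<alpha>)" using expK by (intro mult_right_mono) auto
    finally have "c * \<delta> powr (-\<alpha>) \<le> (\<Sum>n\<in>nats_le x. w (1 + \<delta>) n) + c / 2 * \<delta> powr (-\<alpha>)"
      using tail_w_le[OF x d(1)] c(3)[OF d] by linarith
    hence "c / 2 * \<delta> powr (-\<alpha>) \<le> (\<Sum>n\<in>nats_le x. w (1 + \<delta>) n)" by simp
    also have "\<dots> \<le> A x"
      unfolding A_def
    proof (rule sum_mono)
      fix n assume n: "n \<in> nats_le x"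
      have "real n powr (- (1 + \<delta>)) \<le> real n powr (-1)"
        using n d by (intro powr_mono) (auto simp: mem_nats_le)
      also have "\<dots> = 1 / real n" using n by (simp add: mem_nats_le powr_minus_divide)
      finally show "w (1 + \<delta>) n \<le> f n / real n"
        unfolding w_def using mult_left_mono[OF _ f_nonneg'[OF n]] by fastforce
    qed
    finally have "c / 2 * K powr (-\<alpha>) * lp x \<le> A x" by (simp add: dp mult_ac)
    moreover have "c' * lp x \<le> c / 2 * K powr (-\<alpha>) * lp x"
      unfolding c'_def using lp_ge_1[OF x] by (intro mult_right_mono) auto
    ultimately show ?thesis by simp
  qed
  ultimately show ?thesis by blast
qed

end

lemma sum_ell_div_sq_le: "(\<Sum>n\<in>nats_le x. ell (real n) / real n ^ 2) \<le> 9"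
proof -
  have "(\<Sum>n\<in>nats_le x. ell (real n) / real n ^ 2) \<le> (\<Sum>n\<in>nats_le x. 3 * (sqrt (real n) / real n ^ 2))"
  proof (rule sum_mono)
    fix n assume "n \<in> nats_le x"
    hence "ell (real n) \<le> 3 * sqrt (real n)" by (intro ell_le_sqrt) (auto simp: mem_nats_le)
    hence "ell (real n) / real n ^ 2 \<le> 3 * sqrt (real n) / real n ^ 2" by (intro divide_right_mono) auto
    thus "ell (real n) / real n ^ 2 \<le> 3 * (sqrt (real n) / real n ^ 2)" by simp
  qed
  also have "\<dots> = 3 * (\<Sum>n\<in>{1..nat \<lfloor>x\<rfloor>}. sqrt (real n) / real n ^ 2)"
    by (simp add: sum_distrib_left nats_le_eq)
  also have "\<dots> \<le> 3 * 3" by (intro mult_left_mono sum_sqrt_div_sq_le) auto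
  finally show ?thesis by simp
qed

section \<open>Pairs at which multiplicativity gives no factor \<alpha>\<close>

lemma mangoldt_nonzeroE:
  assumes "(mangoldt d :: real) \<noteq> 0"
  obtains p i where "prime p" "i \<ge> 1" "d = p ^ i"
proof -
  have "primepow d" using assms by (auto simp: mangoldt_def split: if_splits)
  then obtain p i where "prime p" "i > 0" "d = p ^ i" by (auto simp: primepow_def)
  thus ?thesis using that[of p i] by simp
qed

text \<open>What the identities ask of h: boundedness and near invariance under multiplication by a
  prime. The prime may divide m, which is harmless for functions of Omega, as Omega counts
  multiplicity.\<close>

definition prime_stable :: "(nat \<Rightarrow> real) \<Rightarrow> real \<Rightarrow> real \<Rightarrow> bool" where
  "prime_stable h b \<eta> \<longleftrightarrow> \<eta> \<ge> 0 \<and> (\<forall>n\<ge>1. \<bar>h n\<bar> \<le> b) \<and>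
     (\<forall>p m. prime p \<longrightarrow> m \<ge> 1 \<longrightarrow> \<bar>h (p * m) - h m\<bar> \<le> \<eta>)"

lemma prime_stable_nonneg: "prime_stable h b \<eta> \<Longrightarrow> b \<ge> 0"
  by (force simp: prime_stable_def dest: spec[of _ "1::nat"])

context weight_fun
begin

text \<open>The complement of the pairs for which f (d * m) = \<alpha> * f m is guaranteed. Where
  \<open>mangoldt d\<close> is nonzero these are proper prime powers d, and primes d dividing
  m.\<close>

definition bad :: "nat \<Rightarrow> nat \<Rightarrow> bool" where
  "bad d m \<longleftrightarrow> \<not> (prime d \<and> \<not> d dvd m)"

text \<open>Contains both f (d * m) and \<alpha> * f m, so that one quantity bounds the cost of
  dropping the bad pairs from the true convolution and of adding them to the model one.\<close>

definition Err :: "real \<Rightarrow> real" where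
  "Err x = (\<Sum>d\<in>nats_le x. \<Sum>m\<in>nats_le (x / real d).
     if bad d m then mangoldt d * (f (d * m) + \<alpha> * f m) else 0)"

lemma f_prime_power_le: "prime p \<Longrightarrow> i \<le> j \<Longrightarrow> f (p ^ i) \<le> B * (3 / 2) ^ j"
proof -
  assume p: "prime p" and i: "i \<le> j"
  have "f (p ^ i) \<ge> 0" using p by (intro f_nonneg) (simp add: prime_gt_0_nat Suc_le_eq)
  hence "1 * f (p ^ i) \<le> real (Suc i) * f (p ^ i)" by (intro mult_right_mono) auto
  also have "\<dots> \<le> B * (3 / 2) ^ i" by (rule f_prime_power[OF p])
  also have "\<dots> \<le> B * (3 / 2) ^ j" using i B_ge_1 by (intro mult_left_mono power_increasing) auto
  finally show ?thesis by simp
qed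

text \<open>Write d = p ^ i and m = p ^ a * m' with p not dividing m', and put j = i + a. Badness of
  the pair means j \<ge> 2, and for given p, j and m' the exponent i takes at most j values, which
  is the origin of the factor j.\<close>

lemma Err_le_sum:
  assumes "N = nat \<lfloor>x\<rfloor>"
  shows "Err x \<le> B * (1 + \<alpha>) * (\<Sum>p\<in>primes_upto N. \<Sum>j\<in>{2..N}. real j * ln (real p) * (3 / 2) ^ j * S (x / real p ^ j))"
proof -
  let ?g = "\<lambda>(d, m). if bad d m then mangoldt d * (f (d * m) + \<alpha> * f m) else 0"
  let ?s = "SIGMA d:nats_le x. nats_le (x / real d)"
  let ?s' = "{(d, m). (d, m) \<in> ?s \<and> bad d m \<and> (mangoldt d :: real) \<noteq> 0}"
  let ?t = "SIGMA p:primes_upto N. SIGMA j:{2..N}. SIGMA i:{1..j}. nats_le (x / real p ^ j)"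
  let ?h = "\<lambda>(p, j, i, m). B * (1 + \<alpha>) * (ln (real p) * (3 / 2) ^ j * f m)"
  let ?\<phi> = "\<lambda>(p, j, i, m). (p ^ i, p ^ (j - i) * m)"
  have fin: "finite ?s" by (intro finite_SigmaI) auto
  have "Err x = (\<Sum>z\<in>?s. ?g z)"
    unfolding Err_def by (subst sum.Sigma) auto
  also have "\<dots> = (\<Sum>z\<in>?s'. ?g z)"
    using fin by (intro sum.mono_neutral_right) (auto split: if_splits)
  also have "\<dots> \<le> (\<Sum>z\<in>?t. ?h z)"
  proof (rule sum_le_included[where i = ?\<phi>])
    show "finite ?s'" by (rule finite_subset[OF _ fin]) auto
    show "finite ?t" by (intro finite_SigmaI) auto
    show "\<forall>z\<in>?t. 0 \<le> ?h z"
    proof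
      fix z assume "z \<in> ?t"
      then obtain p j i m where z: "z = (p, j, i, m)" "p \<in> primes_upto N" "m \<in> nats_le (x / real p ^ j)" by auto
      have "ln (real p) \<ge> 0" using prime_ge_1_nat[OF prime_of_primes_upto[OF z(2)]] by simp
      thus "0 \<le> ?h z" using f_nonneg'[OF z(3)] B_ge_1 alpha_pos by (simp add: z(1))
    qed
    show "\<forall>z\<in>?s'. \<exists>y\<in>?t. ?\<phi> y = z \<and> ?g z \<le> ?h y"
    proof
      fix z assume "z \<in> ?s'"
      then obtain d m where z: "z = (d, m)" "bad d m" "(mangoldt d :: real) \<noteq> 0"
        and dm: "1 \<le> d" "1 \<le> m" "real d * real m \<le> x"
        unfolding Sigma_nats_le_eq by auto
      obtain p i where p: "prime p" "i \<ge> 1" "d = p ^ i" using mangoldt_nonzeroE[OF z(3)] .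
      obtain a m' where m': "m = p ^ a * m'" "\<not> p dvd m'" "m' > 0"
        using exists_prime_power_decomposition[OF p(1), of m] dm by (metis Suc_le_eq One_nat_def)
      define j where "j = i + a"
      have "j \<ge> 2"
      proof (rule ccontr)
        assume "\<not> j \<ge> 2"
        hence "i = 1" "a = 0" using p(2) by (auto simp: j_def)
        hence "prime d \<and> \<not> d dvd m" using p m' by simp
        thus False using z(2) by (simp add: bad_def)
      qed
      have p1: "p \<ge> 2" using p by (simp add: prime_ge_2_nat)
      have pj: "real p ^ j * real m' \<le> x"
        using dm(3) by (simp add: p(3) m'(1) j_def power_add mult_ac)
      have "real p ^ j * 1 \<le> real p ^ j * real m'" using m' by (intro mult_left_mono) auto
      hence pjx: "real (p ^ j) \<le> x" using pj by simp
      have pjN: "p ^ j \<le> N" using pjx assms by (simp add: le_nat_floor)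
      have "p ^ 1 \<le> p ^ j" using p1 \<open>j \<ge> 2\<close> by (intro power_increasing) auto
      hence pN: "p \<le> N" using pjN by simp
      have "j < 2 ^ j" by (rule less_exp)
      also have "(2::nat) ^ j \<le> p ^ j" using p1 by (intro power_mono) auto
      finally have jN: "j \<le> N" using pjN by simp
      have m'n: "m' \<in> nats_le (x / real p ^ j)"
        using m'(3) pj p1 by (auto simp: mem_nats_le field_simps)
      have y: "(p, j, i, m') \<in> ?t" using p pN jN \<open>j \<ge> 2\<close> m'n by (auto simp: primes_upto_def j_def)
      have cop: "coprime (p ^ k) m'" for k using p(1) m'(2) by (simp add: prime_imp_coprime coprime_power_left_iff)
      have pk: "p ^ k > 0" for k using p1 by simp
      have fdm: "f (d * m) = f (p ^ j) * f m'"
        using f_mult[OF pk m'(3) cop, of j] by (simp add: p(3) m'(1) j_def power_add mult_ac)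
      have fm: "f m = f (p ^ a) * f m'" using f_mult[OF pk m'(3) cop, of a] by (simp add: m'(1))
      have fm'0: "f m' \<ge> 0" using m'(3) by (intro f_nonneg) auto
      have "f (d * m) + \<alpha> * f m = (f (p ^ j) + \<alpha> * f (p ^ a)) * f m'"
        by (simp add: fdm fm algebra_simps)
      also have "\<dots> \<le> (B * (3 / 2) ^ j + \<alpha> * (B * (3 / 2) ^ j)) * f m'"
        using alpha_pos fm'0 by (intro mult_right_mono add_mono mult_left_mono f_prime_power_le p(1)) (auto simp: j_def)
      finally have "f (d * m) + \<alpha> * f m \<le> B * (1 + \<alpha>) * ((3 / 2) ^ j * f m')" by (simp add: algebra_simps)
      hence "ln (real p) * (f (d * m) + \<alpha> * f m) \<le> ln (real p) * (B * (1 + \<alpha>) * ((3 / 2) ^ j * f m'))"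
        using p1 by (intro mult_left_mono) auto
      moreover have "mangoldt d = ln (real p)" using p by simp
      ultimately have "?g z \<le> ?h (p, j, i, m')" using z by (simp add: mult_ac)
      moreover have "?\<phi> (p, j, i, m') = z" by (simp add: z(1) p(3) m'(1) j_def)
      ultimately show "\<exists>y\<in>?t. ?\<phi> y = z \<and> ?g z \<le> ?h y" using y by blast
    qed
  qed
  also have "\<dots> = (\<Sum>p\<in>primes_upto N. \<Sum>j\<in>{2..N}. \<Sum>i\<in>{1..j}. \<Sum>m\<in>nats_le (x / real p ^ j).
      B * (1 + \<alpha>) * (ln (real p) * (3 / 2) ^ j * f m))"
    by (simp add: sum.Sigma[symmetric])
  also have "\<dots> = B * (1 + \<alpha>) * (\<Sum>p\<in>primes_upto N. \<Sum>j\<in>{2..N}. real j * ln (real p) * (3 / 2) ^ j * S (x / real p ^ j))"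
    by (simp add: S_def sum_distrib_left sum_distrib_right mult_ac)
  finally show ?thesis .
qed

text \<open>The majorant R is left open for a bootstrap: first R = \<open>A x\<close>, from the
  trivial bound for S, yields the true order of S; then that order serves as the sharper R.\<close>

lemma Err_bound_general:
  assumes R: "R \<ge> 0" and SR: "\<And>q. q \<ge> 1 \<Longrightarrow> S (x / q) \<le> x / q * R * ell q" and x: "x \<ge> 0"
  shows "Err x \<le> B * (1 + \<alpha>) * 1044480 * x * R"
proof -
  define N where "N = nat \<lfloor>x\<rfloor>"
  have "Err x \<le> B * (1 + \<alpha>) * (\<Sum>p\<in>primes_upto N. \<Sum>j\<in>{2..N}. real j * ln (real p) * (3 / 2) ^ j * S (x / real p ^ j))"
    by (rule Err_le_sum) (simp add: N_def)
  also have "\<dots> \<le> B * (1 + \<alpha>) * (\<Sum>p\<in>primes_upto N. \<Sum>j\<in>{2..N}. real j * ln (real p) * (3 / 2) ^ j * (x / real p ^ j * R * ell (real p ^ j)))"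
  proof (intro mult_left_mono sum_mono SR)
    fix p j assume p: "p \<in> primes_upto N"
    have p1: "real p \<ge> 1" using prime_ge_1_nat[OF prime_of_primes_upto[OF p]] by simp
    show "1 \<le> real p ^ j" using p1 by simp
    show "0 \<le> real j * ln (real p) * (3 / 2) ^ j" using p1 by simp
  qed (use B_ge_1 alpha_pos in auto)
  also have "\<dots> = B * (1 + \<alpha>) * (x * R) * (\<Sum>p\<in>primes_upto N. \<Sum>j\<in>{2..N}. real j * ln (real p) * (3 / 2) ^ j * (1 + ln (real p ^ j)) / real p ^ j)"
    by (simp add: sum_distrib_left ell_def mult_ac)
  also have "\<dots> \<le> B * (1 + \<alpha>) * (x * R) * 1044480"
    using R x B_ge_1 alpha_pos by (intro mult_left_mono prime_power_weights_le) auto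
  finally show ?thesis by (simp add: mult_ac)
qed

lemma sum_f_psi_le: "x \<ge> 0 \<Longrightarrow> (\<Sum>m\<in>nats_le x. f m * psi (x / real m)) \<le> 8 * x * A x"
  unfolding A_def sum_distrib_left
proof (rule sum_mono)
  fix m assume x: "x \<ge> 0" and m: "m \<in> nats_le x"
  have "f m * psi (x / real m) \<le> f m * (8 * (x / real m))"
    using x by (intro mult_left_mono psi_le f_nonneg'[OF m]) auto
  thus "f m * psi (x / real m) \<le> 8 * x * (f m / real m)" by (simp add: mult_ac)
qed

lemma sum_mangoldt_S: "(\<Sum>d\<in>nats_le x. mangoldt d * S (x / real d)) = (\<Sum>m\<in>nats_le x. f m * psi (x / real m))"
  unfolding S_def psi_def sum_distrib_left by (subst sum_nats_le_swap) (simp add: mult.commute)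

lemma sum_mangoldt_Sh: "(\<Sum>d\<in>nats_le x. mangoldt d * Sh h (x / real d)) = (\<Sum>m\<in>nats_le x. f m * h m * psi (x / real m))"
  unfolding Sh_def psi_def sum_distrib_left by (subst sum_nats_le_swap) (simp add: mult_ac)

lemma sum_mangoldt_S_le: "x \<ge> 0 \<Longrightarrow> (\<Sum>d\<in>nats_le x. mangoldt d * S (x / real d)) \<le> 8 * x * A x"
  unfolding sum_mangoldt_S by (rule sum_f_psi_le)

text \<open>Split ln x = ln (x / n) + ln n and expand ln n as a divisor sum of
  \<open>mangoldt\<close>.\<close>

lemma Sh_ln_eq:
  assumes "x \<ge> 1"
  shows "Sh h x * ln x = (\<Sum>n\<in>nats_le x. f n * h n * ln (x / real n))
     + (\<Sum>d\<in>nats_le x. \<Sum>m\<in>nats_le (x / real d). mangoldt d * (f (d * m) * h (d * m)))"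
proof -
  have "Sh h x * ln x = (\<Sum>n\<in>nats_le x. f n * h n * ln (x / real n) + f n * h n * ln (real n))"
    unfolding Sh_def sum_distrib_right using assms
    by (intro sum.cong refl) (auto simp: mem_nats_le ln_div algebra_simps)
  also have "\<dots> = (\<Sum>n\<in>nats_le x. f n * h n * ln (x / real n)) + (\<Sum>n\<in>nats_le x. f n * h n * ln (real n))"
    by (rule sum.distrib)
  also have "(\<Sum>n\<in>nats_le x. f n * h n * ln (real n)) = (\<Sum>n\<in>nats_le x. \<Sum>d | d dvd n. mangoldt d * (f n * h n))"
    using mangoldt_sum[where ?'a = real]
    by (intro sum.cong refl) (auto simp: mem_nats_le sum_distrib_right[symmetric])
  also have "\<dots> = (\<Sum>d\<in>nats_le x. \<Sum>m\<in>nats_le (x / real d). mangoldt d * (f (d * m) * h (d * m)))"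
    by (rule sum_nats_le_divisors)
  finally show ?thesis .
qed

text \<open>A one-sided estimate for weights that do not increase when a new prime is attached. It
  is applied to h = 1 and to the indicator of smooth numbers.\<close>

lemma good_sum_le:
  assumes h: "\<And>n. n \<ge> 1 \<Longrightarrow> 0 \<le> h n \<and> h n \<le> 1"
    and mono: "\<And>p m. prime p \<Longrightarrow> m \<ge> 1 \<Longrightarrow> \<not> p dvd m \<Longrightarrow> h (p * m) \<le> h m"
  shows "(\<Sum>d\<in>nats_le x. \<Sum>m\<in>nats_le (x / real d). mangoldt d * (f (d * m) * h (d * m)))
    \<le> Err x + \<alpha> * (\<Sum>m\<in>nats_le x. f m * h m * psi (x / real m))"
proof -
  have "(\<Sum>d\<in>nats_le x. \<Sum>m\<in>nats_le (x / real d). mangoldt d * (f (d * m) * h (d * m)))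
    \<le> (\<Sum>d\<in>nats_le x. \<Sum>m\<in>nats_le (x / real d).
        (if bad d m then mangoldt d * (f (d * m) + \<alpha> * f m) else 0) + \<alpha> * (mangoldt d * (f m * h m)))"
  proof (intro sum_mono)
    fix d m assume "d \<in> nats_le x" and "m \<in> nats_le (x / real d)"
    hence d: "d \<ge> 1" and m: "m \<ge> 1" and dm: "d * m \<ge> 1" by (auto simp: mem_nats_le)
    have fm: "f m \<ge> 0" and fdm: "f (d * m) \<ge> 0" using m dm by (auto intro!: f_nonneg)
    show "mangoldt d * (f (d * m) * h (d * m)) \<le> (if bad d m then mangoldt d * (f (d * m) + \<alpha> * f m) else 0) + \<alpha> * (mangoldt d * (f m * h m))"
    proof (cases "bad d m")
      case True
      have "f (d * m) * h (d * m) \<le> f (d * m) * 1" using fdm h[OF dm] by (intro mult_left_mono) auto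
      also have "\<dots> \<le> f (d * m) + \<alpha> * f m" using fm alpha_pos by simp
      finally have "mangoldt d * (f (d * m) * h (d * m)) \<le> mangoldt d * (f (d * m) + \<alpha> * f m)"
        by (intro mult_left_mono mangoldt_nonneg)
      moreover have "0 \<le> \<alpha> * (mangoldt d * (f m * h m))"
        using alpha_pos fm h[OF m] mangoldt_nonneg[of d] by (intro mult_nonneg_nonneg) auto
      ultimately show ?thesis using True by simp
    next
      case False
      hence pd: "prime d" "\<not> d dvd m" by (auto simp: bad_def)
      have "f (d * m) = \<alpha> * f m" using f_mult[of d m] pd d m by (simp add: f_prime prime_imp_coprime)
      moreover have "f m * h (d * m) \<le> f m * h m" using mono[OF pd(1) m pd(2)] fm by (intro mult_left_mono)
      hence "\<alpha> * (mangoldt d * (f m * h (d * m))) \<le> \<alpha> * (mangoldt d * (f m * h m))"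
        by (rule mult_left_mono[OF mult_left_mono[OF _ mangoldt_nonneg]]) (use alpha_pos in auto)
      ultimately show ?thesis using False by (simp add: mult_ac)
    qed
  qed
  also have "\<dots> = Err x + \<alpha> * (\<Sum>d\<in>nats_le x. mangoldt d * Sh h (x / real d))"
    by (simp add: sum.distrib Err_def Sh_def sum_distrib_left)
  finally show ?thesis unfolding sum_mangoldt_Sh .
qed

text \<open>All parts of the identity for \<open>S x * ln x\<close> are O(x * A x): the first
  because ln u \<le> u, the convolution by Chebyshev, the bad pairs by the crude majorant. The known
  order of \<open>A x\<close> finishes the bound.\<close>

lemma S_upper: "\<exists>C>0. \<forall>x\<ge>1. S x \<le> C * (x * (lp x / ell x))"
proof -
  obtain C where C: "C > 0" "\<And>x. x \<ge> 1 \<Longrightarrow> A x \<le> C * lp x" using A_upper by blast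
  define D where "D = 1 + (1 + B * (1 + \<alpha>) * 1044480 + 8 * \<alpha>)"
  have D: "D > 0" using B_ge_1 alpha_pos by (simp add: D_def add_pos_nonneg)
  have "S x \<le> D * C * (x * (lp x / ell x))" if x: "x \<ge> 1" for x
  proof -
    have Err: "Err x \<le> B * (1 + \<alpha>) * 1044480 * x * A x"
    proof (rule Err_bound_general)
      fix q :: real assume q: "q \<ge> 1"
      have "S (x / q) \<le> x / q * A (x / q)" using x q by (intro S_le_A) auto
      also have "\<dots> \<le> x / q * (A x * ell q)"
      proof (intro mult_left_mono)
        have "A (x / q) \<le> A x" using x q by (intro A_mono) (simp add: divide_le_eq mult_le_cancel_left1)
        also have "A x * 1 \<le> A x * ell q" using ell_ge_1[OF q] A_nonneg by (intro mult_left_mono) auto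
        finally show "A (x / q) \<le> A x * ell q" by simp
      qed (use x q in auto)
      finally show "S (x / q) \<le> x / q * A x * ell q" by simp
    qed (use x A_nonneg in auto)
    have "S x * ln x = Sh (\<lambda>_. 1) x * ln x" by (simp add: S_def Sh_def)
    also have "\<dots> = (\<Sum>n\<in>nats_le x. f n * ln (x / real n))
       + (\<Sum>d\<in>nats_le x. \<Sum>m\<in>nats_le (x / real d). mangoldt d * (f (d * m) * 1))"
      by (subst Sh_ln_eq[OF x]) simp
    also have "(\<Sum>n\<in>nats_le x. f n * ln (x / real n)) \<le> x * A x"
      unfolding A_def sum_distrib_left
    proof (rule sum_mono)
      fix n assume n: "n \<in> nats_le x"
      have "ln (x / real n) \<le> x / real n" using ln_le_minus_one[of "x / real n"] nats_le_divI[OF n] by simp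
      hence "f n * ln (x / real n) \<le> f n * (x / real n)" by (intro mult_left_mono f_nonneg'[OF n])
      thus "f n * ln (x / real n) \<le> x * (f n / real n)" by (simp add: mult_ac)
    qed
    also have "(\<Sum>d\<in>nats_le x. \<Sum>m\<in>nats_le (x / real d). mangoldt d * (f (d * m) * 1))
        \<le> Err x + \<alpha> * (\<Sum>m\<in>nats_le x. f m * 1 * psi (x / real m))"
      by (rule good_sum_le) auto
    also have "\<dots> \<le> B * (1 + \<alpha>) * 1044480 * x * A x + \<alpha> * (8 * x * A x)"
      using Err sum_f_psi_le[of x] x alpha_pos by (intro add_mono mult_left_mono) auto
    finally have "S x * ell x \<le> D * (x * A x)"
      using S_le_A[of x] x by (simp add: ell_def D_def algebra_simps)
    also have "\<dots> \<le> D * (x * (C * lp x))" using C(2)[OF x] D x by (intro mult_left_mono) auto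
    finally show ?thesis using ell_ge_1[OF x] by (simp add: field_simps)
  qed
  thus ?thesis using C(1) D by (intro exI[of _ "D * C"]) auto
qed

lemma S_div_upper: "\<exists>C>0. \<forall>x\<ge>1. \<forall>q\<ge>1. S (x / q) \<le> x / q * (C * (lp x / ell x)) * ell q"
proof -
  obtain C where C: "C > 0" "\<And>x. x \<ge> 1 \<Longrightarrow> S x \<le> C * (x * (lp x / ell x))" using S_upper by blast
  have "S (x / q) \<le> x / q * (C * (lp x / ell x)) * ell q" if x: "x \<ge> 1" and q: "q \<ge> 1" for x q
  proof (cases "x / q \<ge> 1")
    case False
    thus ?thesis using C x q ell_ge_1[OF x] ell_ge_1[OF q] lp_ge_1[OF x] by (simp add: S_less_1)
  next
    case True
    have e: "ell (x / q) \<ge> 1" "ell x \<ge> 1" using ell_ge_1 x True by auto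
    have "S (x / q) \<le> C * (x / q * (lp (x / q) / ell (x / q)))" by (rule C(2)[OF True])
    also have "\<dots> \<le> C * (x / q * (lp x * (ell q / ell x)))"
    proof -
      have "lp (x / q) / ell (x / q) \<le> lp x / ell (x / q)"
        using True x q e by (intro divide_right_mono lp_mono) (auto simp: divide_le_eq mult_le_cancel_left1)
      moreover have "1 / ell (x / q) \<le> ell q / ell x" using ell_div_le[OF q True] e by (simp add: field_simps)
      hence "lp x * (1 / ell (x / q)) \<le> lp x * (ell q / ell x)" using lp_ge_1[OF x] by (intro mult_left_mono) auto
      ultimately have "lp (x / q) / ell (x / q) \<le> lp x * (ell q / ell x)" by simp
      thus ?thesis using C(1) x q by (intro mult_left_mono) auto
    qed
    finally show ?thesis by (simp add: mult_ac)
  qed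
  thus ?thesis using C(1) by blast
qed

lemma Err_bound: "\<exists>C>0. \<forall>x\<ge>1. Err x \<le> C * (x * (lp x / ell x))"
proof -
  obtain C where C: "C > 0" "\<And>x q. x \<ge> 1 \<Longrightarrow> q \<ge> 1 \<Longrightarrow> S (x / q) \<le> x / q * (C * (lp x / ell x)) * ell q"
    using S_div_upper by blast
  have "Err x \<le> B * (1 + \<alpha>) * 1044480 * x * (C * (lp x / ell x))" if x: "x \<ge> 1" for x
    using C x lp_ge_1[OF x] ell_ge_1[OF x] by (intro Err_bound_general) auto
  thus ?thesis using C(1) B_ge_1 alpha_pos
    by (intro exI[of _ "B * (1 + \<alpha>) * 1044480 * C"]) (auto simp: mult_ac)
qed

text \<open>Again the harmonic sum replaces the logarithm. The resulting series of S (x / k) / k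
  converges like that of ell k / k^2, so the logarithm costs only a constant: most of the mass of S
  sits at n comparable to x.\<close>

lemma sum_f_ln_div_bound: "\<exists>C>0. \<forall>x\<ge>1. (\<Sum>n\<in>nats_le x. f n * ln (x / real n)) \<le> C * (x * (lp x / ell x))"
proof -
  obtain C where C: "C > 0" "\<And>x q. x \<ge> 1 \<Longrightarrow> q \<ge> 1 \<Longrightarrow> S (x / q) \<le> x / q * (C * (lp x / ell x)) * ell q"
    using S_div_upper by blast
  have "(\<Sum>n\<in>nats_le x. f n * ln (x / real n)) \<le> 9 * C * (x * (lp x / ell x))" if x: "x \<ge> 1" for x
  proof -
    have "(\<Sum>n\<in>nats_le x. f n * ln (x / real n)) \<le> (\<Sum>n\<in>nats_le x. \<Sum>k\<in>nats_le (x / real n). f n * (1 / real k))"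
      unfolding sum_distrib_left[symmetric]
      by (intro sum_mono mult_left_mono ln_le_harmonic nats_le_divI f_nonneg')
    also have "\<dots> = (\<Sum>k\<in>nats_le x. S (x / real k) / real k)"
      unfolding S_def by (subst sum_nats_le_swap) (simp add: sum_divide_distrib)
    also have "\<dots> \<le> (\<Sum>k\<in>nats_le x. x / real k * (C * (lp x / ell x)) * ell (real k) / real k)"
      using x by (intro sum_mono divide_right_mono C(2)) (auto simp: mem_nats_le)
    also have "\<dots> = C * (x * (lp x / ell x)) * (\<Sum>k\<in>nats_le x. ell (real k) / real k ^ 2)"
      by (simp add: sum_distrib_left power2_eq_square mult_ac)
    also have "\<dots> \<le> C * (x * (lp x / ell x)) * 9"
      using C(1) x lp_ge_1[OF x] ell_ge_1[OF x] by (intro mult_left_mono sum_ell_div_sq_le) auto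
    finally show ?thesis by (simp add: mult_ac)
  qed
  thus ?thesis using C(1) by (intro exI[of _ "9 * C"]) auto
qed

text \<open>On good pairs f (d * m) * h (d * m) may be replaced by \<alpha> * f m * h m at relative
  cost \<eta>. The bad pairs and the ln (x / n) term are smaller than the order x * lp x of the main
  term by a factor \<open>ell x\<close>. The constant is uniform in h, because h will change with
  x.\<close>

lemma first_order_identity:
  "\<exists>C>0. \<forall>h b \<eta> x. x \<ge> 1 \<longrightarrow> prime_stable h b \<eta> \<longrightarrow>
     \<bar>Sh h x * ln x - \<alpha> * (\<Sum>d\<in>nats_le x. mangoldt d * Sh h (x / real d))\<bar>
       \<le> C * (b * (x * (lp x / ell x)) + \<eta> * (x * lp x))"
proof -
  obtain C1 where C1: "C1 > 0" "\<And>x. x \<ge> 1 \<Longrightarrow> Err x \<le> C1 * (x * (lp x / ell x))" using Err_bound by blast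
  obtain C2 where C2: "C2 > 0" "\<And>x. x \<ge> 1 \<Longrightarrow> (\<Sum>n\<in>nats_le x. f n * ln (x / real n)) \<le> C2 * (x * (lp x / ell x))"
    using sum_f_ln_div_bound by blast
  obtain C3 where C3: "C3 > 0" "\<And>x. x \<ge> 1 \<Longrightarrow> A x \<le> C3 * lp x" using A_upper by blast
  define C where "C = C1 + C2 + 8 * \<alpha> * C3"
  have "\<bar>Sh h x * ln x - \<alpha> * (\<Sum>d\<in>nats_le x. mangoldt d * Sh h (x / real d))\<bar>
       \<le> C * (b * (x * (lp x / ell x)) + \<eta> * (x * lp x))"
    if x: "x \<ge> 1" and st: "prime_stable h b \<eta>" for h b \<eta> x
  proof -
    have eta: "\<eta> \<ge> 0" and b: "\<And>n. n \<ge> 1 \<Longrightarrow> \<bar>h n\<bar> \<le> b"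
      and shift: "\<And>p m. prime p \<Longrightarrow> m \<ge> 1 \<Longrightarrow> \<bar>h (p * m) - h m\<bar> \<le> \<eta>"
      using st by (auto simp: prime_stable_def)
    have b0: "b \<ge> 0" by (rule prime_stable_nonneg[OF st])
    let ?X = "x * (lp x / ell x)" and ?Y = "x * lp x"
    have XY: "?X \<ge> 0" "?Y \<ge> 0" using x lp_ge_1[OF x] ell_ge_1[OF x] by auto
    have 1: "\<bar>\<Sum>n\<in>nats_le x. f n * h n * ln (x / real n)\<bar> \<le> b * (C2 * ?X)"
    proof -
      have "\<bar>\<Sum>n\<in>nats_le x. f n * h n * ln (x / real n)\<bar> \<le> (\<Sum>n\<in>nats_le x. b * (f n * ln (x / real n)))"
      proof (intro order_trans[OF sum_abs] sum_mono)
        fix n assume n: "n \<in> nats_le x"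
        have l: "ln (x / real n) \<ge> 0" using nats_le_divI[OF n] by simp
        have "\<bar>h n\<bar> * (f n * ln (x / real n)) \<le> b * (f n * ln (x / real n))"
          using b n l f_nonneg'[OF n] by (intro mult_right_mono) (auto simp: mem_nats_le)
        thus "\<bar>f n * h n * ln (x / real n)\<bar> \<le> b * (f n * ln (x / real n))"
          using l f_nonneg'[OF n] by (simp add: abs_mult mult_ac)
      qed
      also have "\<dots> = b * (\<Sum>n\<in>nats_le x. f n * ln (x / real n))" by (simp add: sum_distrib_left)
      also have "\<dots> \<le> b * (C2 * ?X)" using b0 C2(2)[OF x] by (intro mult_left_mono)
      finally show ?thesis .
    qed
    let ?D = "\<Sum>d\<in>nats_le x. \<Sum>m\<in>nats_le (x / real d). mangoldt d * (f (d * m) * h (d * m))"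
    have eq: "\<alpha> * (\<Sum>d\<in>nats_le x. mangoldt d * Sh h (x / real d))
        = (\<Sum>d\<in>nats_le x. \<Sum>m\<in>nats_le (x / real d). mangoldt d * (\<alpha> * f m * h m))"
      by (simp add: Sh_def sum_distrib_left mult_ac)
    have "\<bar>?D - \<alpha> * (\<Sum>d\<in>nats_le x. mangoldt d * Sh h (x / real d))\<bar>
       \<le> (\<Sum>d\<in>nats_le x. \<Sum>m\<in>nats_le (x / real d).
          b * (if bad d m then mangoldt d * (f (d * m) + \<alpha> * f m) else 0) + \<alpha> * \<eta> * (mangoldt d * f m))"
      unfolding eq sum_subtractf[symmetric] right_diff_distrib[symmetric]
    proof (intro order_trans[OF sum_abs] sum_mono)
      fix d m assume "d \<in> nats_le x" and "m \<in> nats_le (x / real d)"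
      hence d: "d \<ge> 1" and m: "m \<ge> 1" and dm: "d * m \<ge> 1" by (auto simp: mem_nats_le)
      have fm: "f m \<ge> 0" and fdm: "f (d * m) \<ge> 0" using m dm by (auto intro!: f_nonneg)
      have L: "(mangoldt d :: real) \<ge> 0" by (rule mangoldt_nonneg)
      have nn: "\<alpha> * \<eta> * (mangoldt d * f m) \<ge> 0" using alpha_pos eta L fm by simp
      show "\<bar>mangoldt d * (f (d * m) * h (d * m) - \<alpha> * f m * h m)\<bar>
        \<le> b * (if bad d m then mangoldt d * (f (d * m) + \<alpha> * f m) else 0) + \<alpha> * \<eta> * (mangoldt d * f m)"
      proof -
       have am: "\<bar>mangoldt d * (f (d * m) * h (d * m) - \<alpha> * f m * h m)\<bar> = mangoldt d * \<bar>f (d * m) * h (d * m) - \<alpha> * f m * h m\<bar>"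
         by (simp add: abs_mult)
       show ?thesis
       proof (cases "bad d m")
        case True
        have "\<bar>f (d * m) * h (d * m) - \<alpha> * f m * h m\<bar> \<le> f (d * m) * \<bar>h (d * m)\<bar> + \<alpha> * f m * \<bar>h m\<bar>"
          using fm fdm alpha_pos by (intro order_trans[OF abs_triangle_ineq4]) (simp add: abs_mult)
        also have "\<dots> \<le> f (d * m) * b + \<alpha> * f m * b"
          using fm fdm alpha_pos b m dm by (intro add_mono mult_left_mono) auto
        finally have "mangoldt d * \<bar>f (d * m) * h (d * m) - \<alpha> * f m * h m\<bar> \<le> mangoldt d * (f (d * m) * b + \<alpha> * f m * b)"
          by (intro mult_left_mono L)
        thus ?thesis unfolding am using True nn by (simp add: algebra_simps)
      next
        case False
        hence pd: "prime d" "\<not> d dvd m" by (auto simp: bad_def)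
        have "f (d * m) = \<alpha> * f m" using f_mult[of d m] pd d m by (simp add: f_prime prime_imp_coprime)
        hence "\<bar>f (d * m) * h (d * m) - \<alpha> * f m * h m\<bar> = \<alpha> * f m * \<bar>h (d * m) - h m\<bar>"
          using fm alpha_pos by (simp add: abs_mult right_diff_distrib[symmetric])
        also have "\<dots> \<le> \<alpha> * f m * \<eta>" using shift pd m fm alpha_pos by (intro mult_left_mono) auto
        finally have "mangoldt d * \<bar>f (d * m) * h (d * m) - \<alpha> * f m * h m\<bar> \<le> mangoldt d * (\<alpha> * f m * \<eta>)"
          by (intro mult_left_mono L)
        thus ?thesis unfolding am using False by (simp add: mult_ac)
       qed
      qed
    qed
    also have "\<dots> = b * Err x + \<alpha> * \<eta> * (\<Sum>d\<in>nats_le x. mangoldt d * S (x / real d))"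
      by (simp add: sum.distrib Err_def S_def sum_distrib_left)
    also have "\<dots> \<le> b * (C1 * ?X) + \<alpha> * \<eta> * (8 * x * A x)"
      using b0 eta alpha_pos x C1(2)[OF x] by (intro add_mono mult_left_mono sum_mangoldt_S_le) auto
    also have "\<dots> \<le> b * (C1 * ?X) + \<alpha> * \<eta> * (8 * x * (C3 * lp x))"
      using eta alpha_pos x C3(2)[OF x] by (intro add_left_mono mult_left_mono) auto
    finally have 2: "\<bar>?D - \<alpha> * (\<Sum>d\<in>nats_le x. mangoldt d * Sh h (x / real d))\<bar>
       \<le> b * (C1 * ?X) + \<alpha> * \<eta> * (8 * x * (C3 * lp x))" .
    have "\<bar>Sh h x * ln x - \<alpha> * (\<Sum>d\<in>nats_le x. mangoldt d * Sh h (x / real d))\<bar>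
        \<le> b * (C2 * ?X) + (b * (C1 * ?X) + \<alpha> * \<eta> * (8 * x * (C3 * lp x)))"
      using 1 2 unfolding Sh_ln_eq[OF x] by linarith
    also have "\<dots> = (C1 + C2) * (b * ?X) + 8 * \<alpha> * C3 * (\<eta> * ?Y)"
      by (simp add: algebra_simps add_divide_distrib)
    also have "\<dots> \<le> C * (b * ?X) + C * (\<eta> * ?Y)"
      using mult_nonneg_nonneg[OF b0 XY(1)] mult_nonneg_nonneg[OF eta XY(2)] C1(1) C2(1) C3(1) alpha_pos
      by (intro add_mono mult_right_mono) (auto simp: C_def)
    finally show ?thesis by (simp add: distrib_left)
  qed
  moreover have "C > 0" using C1(1) C2(1) C3(1) alpha_pos by (auto simp: C_def intro!: add_pos_pos)
  ultimately show ?thesis by blast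
qed

end

section \<open>The two operators of the second-order identity\<close>

text \<open>\<open>T1\<close> and \<open>T2\<close> are the convolutions with the two halves of
  Selberg's sum: with \<Lambda> * ln, and with the Dirichlet convolution of \<Lambda> with
  itself.\<close>

definition T1 :: "(real \<Rightarrow> real) \<Rightarrow> real \<Rightarrow> real" where
  "T1 G x = (\<Sum>d\<in>nats_le x. mangoldt d * ln (real d) * G (x / real d))"

definition T2 :: "(real \<Rightarrow> real) \<Rightarrow> real \<Rightarrow> real" where
  "T2 G x = (\<Sum>d\<in>nats_le x. mangoldt d * (\<Sum>e\<in>nats_le (x / real d). mangoldt e * G (x / real d / real e)))"

lemma ln_nats_le_nonneg: "d \<in> nats_le x \<Longrightarrow> ln (real d) \<ge> 0"
  by (auto simp: mem_nats_le)

lemma div_nats_le_le: "d \<in> nats_le x \<Longrightarrow> x / real d \<le> x"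
  using divide_left_mono[of 1 "real d" x] by (simp add: mem_nats_le)

lemma T1_mono:
  assumes "\<And>y. 1 \<le> y \<Longrightarrow> y \<le> x \<Longrightarrow> \<bar>G y\<bar> \<le> H y"
  shows "\<bar>T1 G x\<bar> \<le> T1 H x"
  unfolding T1_def
proof (intro order_trans[OF sum_abs] sum_mono)
  fix d assume d: "d \<in> nats_le x"
  have "mangoldt d * ln (real d) * \<bar>G (x / real d)\<bar> \<le> mangoldt d * ln (real d) * H (x / real d)"
    using assms[OF nats_le_divI[OF d] div_nats_le_le[OF d]] ln_nats_le_nonneg[OF d] mangoldt_nonneg[of d]
    by (intro mult_left_mono) auto
  thus "\<bar>mangoldt d * ln (real d) * G (x / real d)\<bar> \<le> mangoldt d * ln (real d) * H (x / real d)"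
    using ln_nats_le_nonneg[OF d] by (simp add: abs_mult)
qed

lemma T2_mono:
  assumes "\<And>y. 1 \<le> y \<Longrightarrow> y \<le> x \<Longrightarrow> \<bar>G y\<bar> \<le> H y"
  shows "\<bar>T2 G x\<bar> \<le> T2 H x"
  unfolding T2_def
proof (intro order_trans[OF sum_abs] sum_mono)
  fix d assume d: "d \<in> nats_le x"
  have "\<bar>\<Sum>e\<in>nats_le (x / real d). mangoldt e * G (x / real d / real e)\<bar>
      \<le> (\<Sum>e\<in>nats_le (x / real d). mangoldt e * H (x / real d / real e))"
  proof (intro order_trans[OF sum_abs] sum_mono)
    fix e assume e: "e \<in> nats_le (x / real d)"
    have "\<bar>G (x / real d / real e)\<bar> \<le> H (x / real d / real e)"
      using order_trans[OF div_nats_le_le[OF e] div_nats_le_le[OF d]] by (rule assms[OF nats_le_divI[OF e]])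
    thus "\<bar>mangoldt e * G (x / real d / real e)\<bar> \<le> mangoldt e * H (x / real d / real e)"
      using mangoldt_nonneg[of e] by (simp add: abs_mult mult_left_mono)
  qed
  thus "\<bar>mangoldt d * (\<Sum>e\<in>nats_le (x / real d). mangoldt e * G (x / real d / real e))\<bar>
      \<le> mangoldt d * (\<Sum>e\<in>nats_le (x / real d). mangoldt e * H (x / real d / real e))"
    using mangoldt_nonneg[of d] by (simp add: abs_mult mult_left_mono)
qed

lemma T1_linear: "T1 (\<lambda>y. a * G y + b * H y) x = a * T1 G x + b * T1 H x"
  unfolding T1_def sum_distrib_left sum.distrib[symmetric]
  by (rule sum.cong) (auto simp: algebra_simps)

lemma T2_linear: "T2 (\<lambda>y. a * G y + b * H y) x = a * T2 G x + b * T2 H x"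
  unfolding T2_def sum_distrib_left sum.distrib[symmetric]
  by (intro sum.cong refl) (auto simp: algebra_simps)

context weight_fun
begin

text \<open>The logarithmic average left over when \<open>selberg_sum (x / m)\<close> is replaced by
  its main term 2 * (x / m) * ln (x / m).\<close>

definition W :: "(nat \<Rightarrow> real) \<Rightarrow> real \<Rightarrow> real" where
  "W h x = (\<Sum>m\<in>nats_le x. f m * h m / real m * ln (x / real m))"

lemma T1_T2_eq_selberg: "T1 (Sh h) x + T2 (Sh h) x = (\<Sum>m\<in>nats_le x. f m * h m * selberg_sum (x / real m))"
proof -
  have "T1 (Sh h) x = (\<Sum>m\<in>nats_le x. \<Sum>d\<in>nats_le (x / real m). f m * h m * (mangoldt d * ln (real d)))"
    unfolding T1_def Sh_def sum_distrib_left by (subst sum_nats_le_swap) (simp add: mult_ac)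
  moreover have "T2 (Sh h) x = (\<Sum>m\<in>nats_le x. \<Sum>d\<in>nats_le (x / real m). \<Sum>e\<in>nats_le (x / real m / real d). f m * h m * (mangoldt d * mangoldt e))"
    by (subst sum_nats_le_triple) (simp add: T2_def Sh_def sum_distrib_left mult_ac)
  ultimately show ?thesis
    by (simp add: selberg_sum_def psi_def distrib_left sum.distrib sum_distrib_left)
qed

lemma T1_T2_Selberg:
  assumes x: "x \<ge> 1" and b: "\<And>n. n \<ge> 1 \<Longrightarrow> \<bar>h n\<bar> \<le> b"
  shows "\<bar>T1 (Sh h) x + T2 (Sh h) x - 2 * x * W h x\<bar> \<le> 120 * b * x * A x"
proof -
  have "T1 (Sh h) x + T2 (Sh h) x - 2 * x * W h x
      = (\<Sum>m\<in>nats_le x. f m * h m * (selberg_sum (x / real m) - 2 * (x / real m) * ln (x / real m)))"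
    unfolding T1_T2_eq_selberg by (simp add: W_def sum_distrib_left sum_subtractf algebra_simps)
  also have "\<bar>\<dots>\<bar> \<le> (\<Sum>m\<in>nats_le x. 120 * b * x * (f m / real m))"
  proof (intro order_trans[OF sum_abs] sum_mono)
    fix m assume m: "m \<in> nats_le x"
    have b0: "b \<ge> 0" using b[of 1] by simp
    have "\<bar>h m\<bar> * \<bar>selberg_sum (x / real m) - 2 * (x / real m) * ln (x / real m)\<bar> \<le> b * (120 * (x / real m))"
      using m b b0 by (intro mult_mono Selberg_formula nats_le_divI[OF m]) (auto simp: mem_nats_le)
    hence "f m * (\<bar>h m\<bar> * \<bar>selberg_sum (x / real m) - 2 * (x / real m) * ln (x / real m)\<bar>) \<le> f m * (b * (120 * (x / real m)))"
      by (intro mult_left_mono f_nonneg'[OF m])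
    thus "\<bar>f m * h m * (selberg_sum (x / real m) - 2 * (x / real m) * ln (x / real m))\<bar> \<le> 120 * b * x * (f m / real m)"
      using f_nonneg'[OF m] by (simp add: abs_mult mult_ac)
  qed
  finally show ?thesis by (simp add: A_def sum_distrib_left)
qed

lemma S_eq_Sh: "S = Sh (\<lambda>_. 1)"
  by (simp add: fun_eq_iff S_def Sh_def)

text \<open>Mertens' estimate has error at most 9 at both ends, so with T = exp 19 the interval from
  y / T to y carries at least 19 - 2 * 9 = 1 of the sum of \<open>mangoldt d / d\<close>; there 1 /
  d is at most T / y.\<close>

lemma psi_lower: "\<exists>T\<ge>1. \<forall>y\<ge>T. psi y \<ge> y / T"
proof (intro exI[of _ "exp 19"] conjI allI impI)
  fix y :: real assume y: "y \<ge> exp 19"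
  define T :: real where "T = exp 19"
  have T1: "T \<ge> 1" by (simp add: T_def)
  have yT: "y \<ge> T" using y by (simp add: T_def)
  have y1: "y \<ge> 1" using T1 yT by linarith
  have "y / T \<le> y / 1" using T1 y1 by (intro divide_left_mono) auto
  with T1 yT y1 have T: "T \<ge> 1" "y / T \<ge> 1" "y \<ge> 1" "y / T \<le> y" by (simp_all add: le_divide_eq)
  have sub: "nats_le (y / T) \<subseteq> nats_le y" using T by (intro nats_le_mono)
  have l: "ln (y / T) = ln y - 19" using T by (simp add: ln_div T_def)
  have "1 \<le> (\<Sum>d\<in>nats_le y. mangoldt d / real d) - (\<Sum>d\<in>nats_le (y / T). mangoldt d / real d)"
    using Mertens_mangoldt[OF T(3)] Mertens_mangoldt[OF T(2)] unfolding l by linarith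
  also have "\<dots> = (\<Sum>d\<in>nats_le y - nats_le (y / T). mangoldt d / real d)" using sub by (simp add: sum_diff)
  also have "\<dots> \<le> (\<Sum>d\<in>nats_le y - nats_le (y / T). mangoldt d * (T / y))"
  proof (rule sum_mono)
    fix d assume "d \<in> nats_le y - nats_le (y / T)"
    hence d: "real d \<ge> y / T" "real d > 0" by (auto simp: mem_nats_le)
    have "mangoldt d / real d \<le> mangoldt d / (y / T)" using d T yT T1 by (intro frac_le mangoldt_nonneg) auto
    thus "mangoldt d / real d \<le> mangoldt d * (T / y)" by simp
  qed
  also have "\<dots> \<le> (\<Sum>d\<in>nats_le y. mangoldt d * (T / y))"
    using T mangoldt_nonneg by (intro sum_mono2) auto
  also have "\<dots> = psi y * (T / y)" unfolding psi_def by (rule sum_distrib_right[symmetric])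
  finally show "psi y \<ge> y / exp 19" using T by (simp add: field_simps T_def)
next
  show "1 \<le> exp (19 :: real)" by (subst one_le_exp_iff) linarith
qed

text \<open>The first-order identity for h = 1, where \<eta> = 0, is restricted to m \<le> x / T;
  there x / m is in the range of the lower Chebyshev bound, and \<open>A (x / T)\<close> has the
  order of \<open>lp x\<close>. The error is beaten once \<open>ell x\<close> is large; below that
  threshold S \<ge> 1 is enough.\<close>

lemma S_lower: "\<exists>c>0. \<forall>x\<ge>1. S x \<ge> c * (x * (lp x / ell x))"
proof -
  obtain T where T: "T \<ge> 1" "\<And>y. y \<ge> T \<Longrightarrow> psi y \<ge> y / T" using psi_lower by blast
  obtain c where c: "c > 0" "\<And>x. x \<ge> 1 \<Longrightarrow> A x \<ge> c * lp x" using A_lower by blast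
  obtain C where C: "C > 0" "\<And>h b \<eta> x. x \<ge> 1 \<Longrightarrow> prime_stable h b \<eta> \<Longrightarrow>
     \<bar>Sh h x * ln x - \<alpha> * (\<Sum>d\<in>nats_le x. mangoldt d * Sh h (x / real d))\<bar>
       \<le> C * (b * (x * (lp x / ell x)) + \<eta> * (x * lp x))"
    using first_order_identity by blast
  have eT: "ell T \<ge> 1" using ell_ge_1 T by simp
  define c1 where "c1 = \<alpha> / T * (c / (ell T powr \<alpha>)) / T"
  have c1: "c1 > 0" using alpha_pos T c eT by (simp add: c1_def)
  have big: "S x \<ge> c1 / 2 * (x * (lp x / ell x))" if x: "x \<ge> T" "ell x \<ge> 2 * C / c1" for x
  proof -
    have x1: "x \<ge> 1" "x / T \<ge> 1" using x T by auto
    have ex: "ell x \<ge> 1" using ell_ge_1 x1 by simp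
    have "\<bar>S x * ln x - \<alpha> * (\<Sum>d\<in>nats_le x. mangoldt d * S (x / real d))\<bar> \<le> C * (1 * (x * (lp x / ell x)) + 0 * (x * lp x))"
      unfolding S_eq_Sh using x1 by (intro C(2)) (auto simp: prime_stable_def)
    hence 1: "S x * ln x \<ge> \<alpha> * (\<Sum>m\<in>nats_le x. f m * psi (x / real m)) - C * (x * (lp x / ell x))"
      by (simp add: sum_mangoldt_S)
    have "x / T * A (x / T) = (\<Sum>m\<in>nats_le (x / T). f m * (x / real m / T))"
      by (simp add: A_def sum_distrib_left mult_ac)
    also have "\<dots> \<le> (\<Sum>m\<in>nats_le (x / T). f m * psi (x / real m))"
    proof (intro sum_mono mult_left_mono T(2))
      fix m assume m: "m \<in> nats_le (x / T)"
      show "T \<le> x / real m" using m T by (auto simp: mem_nats_le field_simps)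
      show "f m \<ge> 0" by (rule f_nonneg'[OF m])
    qed
    also have "\<dots> \<le> (\<Sum>m\<in>nats_le x. f m * psi (x / real m))"
      using x1 T by (intro sum_mono2 nats_le_mono mult_nonneg_nonneg psi_nonneg f_nonneg'[of _ x])
        (auto simp: divide_le_eq mult_le_cancel_left1)
    finally have 2: "\<alpha> * (x / T * A (x / T)) \<le> \<alpha> * (\<Sum>m\<in>nats_le x. f m * psi (x / real m))"
      using alpha_pos by (intro mult_left_mono) auto
    have "lp x \<le> (ell (x / T) * ell T) powr \<alpha>"
      unfolding lp_def using ell_div_le[OF T(1) x1(2)] ex alpha_pos by (intro powr_mono2) auto
    also have "\<dots> = lp (x / T) * ell T powr \<alpha>"
      using ell_ge_1[OF x1(2)] eT by (simp add: lp_def powr_mult)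
    finally have "c * (lp x / ell T powr \<alpha>) \<le> c * lp (x / T)" using c eT by (intro mult_left_mono) (auto simp: field_simps)
    also have "\<dots> \<le> A (x / T)" by (rule c(2)[OF x1(2)])
    finally have a: "\<alpha> * (x / T * (c * (lp x / ell T powr \<alpha>))) \<le> \<alpha> * (x / T * A (x / T))"
      using alpha_pos x1 T by (intro mult_left_mono) auto
    define Z where "Z = \<alpha> * (x / T * (c * (lp x / ell T powr \<alpha>)))"
    have "Z \<ge> 0" unfolding Z_def using alpha_pos c(1) x1 T(1) lp_ge_1[OF x1(1)] by simp
    hence "Z / T \<le> Z / 1" using T(1) by (intro divide_left_mono) auto
    moreover have "c1 * (x * lp x) = Z / T" by (simp add: c1_def Z_def)
    ultimately have 3: "c1 * (x * lp x) \<le> \<alpha> * (x / T * A (x / T))" using a unfolding Z_def by linarith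
    have "C * (x * (lp x / ell x)) \<le> c1 / 2 * (x * lp x)"
    proof -
      have "C / ell x \<le> c1 / 2" using x(2) c1 ex C(1) by (simp add: field_simps)
      hence "C / ell x * (x * lp x) \<le> c1 / 2 * (x * lp x)" using x1 lp_ge_1[OF x1(1)] by (intro mult_right_mono) auto
      thus ?thesis by simp
    qed
    hence "c1 / 2 * (x * lp x) \<le> S x * ln x" using 1 2 3 by linarith
    also have "\<dots> \<le> S x * ell x" using S_nonneg by (intro mult_left_mono) (auto simp: ell_def)
    finally show ?thesis using ex by (simp add: field_simps)
  qed
  define X where "X = max T (exp (2 * C / c1))"
  have X: "X \<ge> 1" using T by (simp add: X_def)
  define c2 where "c2 = min (c1 / 2) (1 / (X * lp X))"
  have "c2 > 0" using c1 X lp_ge_1[OF X] by (simp add: c2_def)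
  moreover have "S x \<ge> c2 * (x * (lp x / ell x))" if x: "x \<ge> 1" for x
  proof -
    have nn: "x * (lp x / ell x) \<ge> 0" using x lp_ge_1[OF x] ell_ge_1[OF x] by simp
    show ?thesis
    proof (cases "x \<ge> X")
      case True
      have "ln x \<ge> 2 * C / c1" using True x by (subst ln_ge_iff) (auto simp: X_def)
      hence "S x \<ge> c1 / 2 * (x * (lp x / ell x))" using True by (intro big) (auto simp: X_def ell_def)
      moreover have "c2 * (x * (lp x / ell x)) \<le> c1 / 2 * (x * (lp x / ell x))"
        using nn by (intro mult_right_mono) (auto simp: c2_def)
      ultimately show ?thesis by simp
    next
      case False
      have "x * (lp x / ell x) \<le> x * (lp x / 1)"
        using x lp_ge_1[OF x] ell_ge_1[OF x] by (intro mult_left_mono divide_left_mono) auto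
      also have "\<dots> \<le> X * lp X" using False x lp_ge_1[OF x] lp_mono[of x X] X by (auto intro!: mult_mono)
      finally have "c2 * (x * (lp x / ell x)) \<le> 1 / (X * lp X) * (X * lp X)"
        using nn X lp_ge_1[OF X] by (intro mult_mono[of c2]) (simp_all add: c2_def)
      also have "\<dots> = 1" using X lp_ge_1[OF X] by simp
      also have "\<dots> \<le> S x" by (rule S_ge_1[OF x])
      finally show ?thesis .
    qed
  qed
  ultimately show ?thesis by (intro exI[of _ c2] conjI allI impI)
qed

text \<open>Multiply the first-order identity by ln x, split ln x = ln d + ln (x / d) inside the
  sum, and apply the first-order identity once more at x / d.\<close>

lemma second_order_identity:
  "\<exists>C>0. \<forall>h b \<eta> x. x \<ge> 1 \<longrightarrow> prime_stable h b \<eta> \<longrightarrow>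
     \<bar>Sh h x * (ln x)\<^sup>2 - \<alpha> * T1 (Sh h) x - \<alpha>\<^sup>2 * T2 (Sh h) x\<bar> \<le> C * (b * (x * lp x) + \<eta> * (x * lp x * ell x))"
proof -
  obtain C1 where C1: "C1 > 0" "\<And>h b \<eta> x. x \<ge> 1 \<Longrightarrow> prime_stable h b \<eta> \<Longrightarrow>
     \<bar>Sh h x * ln x - \<alpha> * (\<Sum>d\<in>nats_le x. mangoldt d * Sh h (x / real d))\<bar>
       \<le> C1 * (b * (x * (lp x / ell x)) + \<eta> * (x * lp x))"
    using first_order_identity by blast
  obtain c where c: "c > 0" "\<And>x. x \<ge> 1 \<Longrightarrow> S x \<ge> c * (x * (lp x / ell x))" using S_lower by blast
  obtain C3 where C3: "C3 > 0" "\<And>x. x \<ge> 1 \<Longrightarrow> A x \<le> C3 * lp x" using A_upper by blast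
  define C where "C = C1 * (1 + \<alpha> * (8 * C3 / c + 9))"
  have "C > 0" using C1(1) C3(1) c(1) alpha_pos unfolding C_def by (intro mult_pos_pos add_pos_pos) auto
  moreover have "\<bar>Sh h x * (ln x)\<^sup>2 - \<alpha> * T1 (Sh h) x - \<alpha>\<^sup>2 * T2 (Sh h) x\<bar> \<le> C * (b * (x * lp x) + \<eta> * (x * lp x * ell x))"
    if x: "x \<ge> 1" and st: "prime_stable h b \<eta>" for h b \<eta> x
  proof -
    have eta: "\<eta> \<ge> 0" and b: "\<And>n. n \<ge> 1 \<Longrightarrow> \<bar>h n\<bar> \<le> b"
      and shift: "\<And>p m. prime p \<Longrightarrow> m \<ge> 1 \<Longrightarrow> \<bar>h (p * m) - h m\<bar> \<le> \<eta>"
      using st by (auto simp: prime_stable_def)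
    have b0: "b \<ge> 0" by (rule prime_stable_nonneg[OF st])
    have ex: "ell x \<ge> 1" "0 \<le> ln x" "ln x \<le> ell x" using ell_ge_1[OF x] x by (auto simp: ell_def)
    have lx: "lp x \<ge> 1" using lp_ge_1[OF x] .
    let ?M = "\<Sum>d\<in>nats_le x. mangoldt d * Sh h (x / real d)"
    let ?X = "b * (x * lp x)" and ?Y = "\<eta> * (x * lp x * ell x)"
    have XY: "?X \<ge> 0" "?Y \<ge> 0" using b0 eta x lx ex by auto
    have "\<bar>(Sh h x * ln x - \<alpha> * ?M) * ln x\<bar> \<le> C1 * (b * (x * (lp x / ell x)) + \<eta> * (x * lp x)) * ell x"
      unfolding abs_mult using C1(2)[OF x st] ex by (intro mult_mono) auto
    also have "\<dots> = C1 * (?X + ?Y)" using ex by (simp add: field_simps)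
    finally have 1: "\<bar>Sh h x * (ln x)\<^sup>2 - \<alpha> * (?M * ln x)\<bar> \<le> C1 * (?X + ?Y)"
      by (simp add: algebra_simps power2_eq_square)
    have M: "?M * ln x = T1 (Sh h) x + (\<Sum>d\<in>nats_le x. mangoldt d * (Sh h (x / real d) * ln (x / real d)))"
      unfolding T1_def sum_distrib_right sum.distrib[symmetric] using x
      by (intro sum.cong refl) (auto simp: mem_nats_le ln_div algebra_simps)
    have "\<bar>(\<Sum>d\<in>nats_le x. mangoldt d * (Sh h (x / real d) * ln (x / real d))) - \<alpha> * T2 (Sh h) x\<bar>
        = \<bar>\<Sum>d\<in>nats_le x. mangoldt d * (Sh h (x / real d) * ln (x / real d) - \<alpha> * (\<Sum>e\<in>nats_le (x / real d). mangoldt e * Sh h (x / real d / real e)))\<bar>"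
      by (simp add: T2_def right_diff_distrib sum_subtractf sum_distrib_left mult_ac)
    also have "\<dots> \<le> (\<Sum>d\<in>nats_le x. C1 * b / c * (mangoldt d * S (x / real d)) + C1 * \<eta> * x * lp x * (mangoldt d / real d))"
    proof (intro order_trans[OF sum_abs] sum_mono)
      fix d assume d: "d \<in> nats_le x"
      define y where "y = x / real d"
      have y: "y \<ge> 1" "y \<le> x" using nats_le_divI[OF d] div_nats_le_le[OF d] by (auto simp: y_def)
      have "\<bar>Sh h y * ln y - \<alpha> * (\<Sum>e\<in>nats_le y. mangoldt e * Sh h (y / real e))\<bar>
         \<le> C1 * (b * (y * (lp y / ell y)) + \<eta> * (y * lp y))"
        by (rule C1(2)[OF y(1) st])
      \<comment> \<open>By the lower bound for S, the error y * lp y / ell y is at most S y / c, and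
        the \<Lambda>-average of S over d is O(x * A x) by Chebyshev. The \<eta> part is summed by
        Mertens' estimate.\<close>
      also have "\<dots> \<le> C1 * (b * (S y / c) + \<eta> * (y * lp x))"
        using C1(1) b0 eta y c(2)[OF y(1)] c(1) lp_mono[OF y]
        by (intro mult_left_mono add_mono) (auto simp: field_simps)
      finally have "mangoldt d * \<bar>Sh h y * ln y - \<alpha> * (\<Sum>e\<in>nats_le y. mangoldt e * Sh h (y / real e))\<bar>
          \<le> mangoldt d * (C1 * (b * (S y / c) + \<eta> * (y * lp x)))"
        by (intro mult_left_mono mangoldt_nonneg)
      also have "\<dots> = C1 * b / c * (mangoldt d * S y) + C1 * \<eta> * x * lp x * (mangoldt d / real d)"
        by (simp add: y_def algebra_simps)
      finally show "\<bar>mangoldt d * (Sh h (x / real d) * ln (x / real d) - \<alpha> * (\<Sum>e\<in>nats_le (x / real d). mangoldt e * Sh h (x / real d / real e)))\<bar>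
          \<le> C1 * b / c * (mangoldt d * S (x / real d)) + C1 * \<eta> * x * lp x * (mangoldt d / real d)"
        unfolding y_def abs_mult abs_mangoldt .
    qed
    also have "\<dots> = C1 * b / c * (\<Sum>d\<in>nats_le x. mangoldt d * S (x / real d)) + C1 * \<eta> * x * lp x * (\<Sum>d\<in>nats_le x. mangoldt d / real d)"
      by (simp add: sum.distrib sum_distrib_left)
    also have "\<dots> \<le> C1 * b / c * (8 * x * (C3 * lp x)) + C1 * \<eta> * x * lp x * (9 * ell x)"
    proof (intro add_mono mult_left_mono)
      have "(\<Sum>d\<in>nats_le x. mangoldt d * S (x / real d)) \<le> 8 * x * A x" using x by (intro sum_mangoldt_S_le) auto
      also have "\<dots> \<le> 8 * x * (C3 * lp x)" using C3(2)[OF x] x by (intro mult_left_mono) auto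
      finally show "(\<Sum>d\<in>nats_le x. mangoldt d * S (x / real d)) \<le> 8 * x * (C3 * lp x)" .
      show "(\<Sum>d\<in>nats_le x. mangoldt d / real d) \<le> 9 * ell x"
        using Mertens_mangoldt[OF x] ex by (simp add: ell_def)
    qed (use C1(1) b0 c(1) eta x lx in auto)
    also have "\<dots> = C1 * (8 * C3 / c) * ?X + C1 * 9 * ?Y" by (simp add: mult_ac)
    also have "\<dots> \<le> C1 * (8 * C3 / c + 9) * ?X + C1 * (8 * C3 / c + 9) * ?Y"
      using C1(1) C3(1) c(1) XY by (intro add_mono mult_right_mono mult_left_mono) auto
    finally have 2: "\<bar>(\<Sum>d\<in>nats_le x. mangoldt d * (Sh h (x / real d) * ln (x / real d))) - \<alpha> * T2 (Sh h) x\<bar>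
        \<le> C1 * (8 * C3 / c + 9) * (?X + ?Y)" by (simp only: distrib_left)
    let ?R = "\<Sum>d\<in>nats_le x. mangoldt d * (Sh h (x / real d) * ln (x / real d))"
    have "\<bar>\<alpha> * ?R - \<alpha>\<^sup>2 * T2 (Sh h) x\<bar> = \<alpha> * \<bar>?R - \<alpha> * T2 (Sh h) x\<bar>"
      using alpha_pos by (simp add: abs_mult power2_eq_square mult.assoc flip: right_diff_distrib)
    also have "\<dots> \<le> \<alpha> * (C1 * (8 * C3 / c + 9) * (?X + ?Y))" using 2 alpha_pos by (intro mult_left_mono) auto
    finally have 3: "\<bar>\<alpha> * ?R - \<alpha>\<^sup>2 * T2 (Sh h) x\<bar> \<le> \<alpha> * (C1 * (8 * C3 / c + 9) * (?X + ?Y))" .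
    have "\<alpha> * (?M * ln x) = \<alpha> * T1 (Sh h) x + \<alpha> * ?R" unfolding M by (rule distrib_left)
    with 1 3 have "\<bar>Sh h x * (ln x)\<^sup>2 - \<alpha> * T1 (Sh h) x - \<alpha>\<^sup>2 * T2 (Sh h) x\<bar>
        \<le> C1 * (?X + ?Y) + \<alpha> * (C1 * (8 * C3 / c + 9) * (?X + ?Y))" by linarith
    also have "\<dots> = C * (?X + ?Y)" by (simp add: C_def algebra_simps)
    finally show ?thesis .
  qed
  ultimately show ?thesis by blast
qed

end

section \<open>The contraction argument\<close>

lemma T1_nonneg: "(\<And>y. G y \<ge> 0) \<Longrightarrow> T1 G x \<ge> 0"
  unfolding T1_def by (intro sum_nonneg mult_nonneg_nonneg mangoldt_nonneg ln_nats_le_nonneg) auto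

lemma T2_nonneg: "(\<And>y. G y \<ge> 0) \<Longrightarrow> T2 G x \<ge> 0"
  unfolding T2_def by (intro sum_nonneg mult_nonneg_nonneg mangoldt_nonneg) auto

lemma ell_bounds_ln: "ln x \<ge> 1 \<Longrightarrow> ell x \<le> 2 * ln x"
  by (simp add: ell_def)

context weight_fun
begin

text \<open>Controls what the operators receive from arguments below z. The bound contains
  \<open>A z\<close> instead of \<open>A x\<close>, which is smaller by a factor of order \<theta>
  powr \<alpha> when z = x powr \<theta>.\<close>

lemma T1_T2_truncated:
  assumes x: "x \<ge> 1" and z: "1 \<le> z" "z \<le> x"
  defines "g \<equiv> \<lambda>n. if real n \<le> z then 1 else 0"
  shows "T1 (Sh g) x + T2 (Sh g) x \<le> 122 * x * ell x * A z"
proof -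
  have "T1 (Sh g) x + T2 (Sh g) x = (\<Sum>m\<in>nats_le x. f m * g m * selberg_sum (x / real m))"
    by (rule T1_T2_eq_selberg)
  also have "\<dots> = (\<Sum>m\<in>nats_le z. f m * selberg_sum (x / real m))"
    using z by (intro sum.mono_neutral_cong_right) (auto simp: g_def mem_nats_le)
  also have "\<dots> \<le> (\<Sum>m\<in>nats_le z. 122 * x * ell x * (f m / real m))"
  proof (rule sum_mono)
    fix m assume m: "m \<in> nats_le z"
    hence mx: "m \<in> nats_le x" using z by (auto simp: mem_nats_le)
    have y: "x / real m \<ge> 1" "x / real m \<le> x" by (rule nats_le_divI[OF mx], rule div_nats_le_le[OF mx])
    have "selberg_sum (x / real m) \<le> (x / real m) * (2 * ln (x / real m) + 120)"
      using Selberg_formula[OF y(1)] by (simp add: algebra_simps)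
    also have "\<dots> \<le> (x / real m) * (122 * ell x)"
    proof (rule mult_left_mono)
      have "ln (x / real m) \<le> ln x" using y by (subst ln_le_cancel_iff) auto
      moreover have "2 * u + 120 \<le> 122 * (1 + v)" if "u \<le> v" "0 \<le> v" for u v :: real
        using that by simp
      ultimately show "2 * ln (x / real m) + 120 \<le> 122 * ell x" using ln_ge_zero[OF x] unfolding ell_def by blast
    qed (use y in linarith)
    finally have "f m * selberg_sum (x / real m) \<le> f m * ((x / real m) * (122 * ell x))"
      by (intro mult_left_mono f_nonneg'[OF m])
    thus "f m * selberg_sum (x / real m) \<le> 122 * x * ell x * (f m / real m)" by (simp add: mult_ac)
  qed
  also have "\<dots> = 122 * x * ell x * A z" by (simp add: A_def sum_distrib_left)
  finally show ?thesis .
qed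

text \<open>For \<alpha> \<le> 1 subtract \<open>\<alpha>\<^sup>2 * (t1 + t2)\<close> from
  \<open>\<alpha> * t1 + \<alpha>\<^sup>2 * t2\<close>, leaving 1 - \<alpha> times
  \<open>\<alpha> * t1\<close>; for \<alpha> > 1 subtract \<open>\<alpha> * (t1 + t2)\<close>,
  leaving 1 - 1 / \<alpha> times \<open>\<alpha>\<^sup>2 * t2\<close>. At \<alpha> = 1 nothing
  survives.\<close>

definition \<kappa> :: real where "\<kappa> = (if \<alpha> \<le> 1 then 1 - \<alpha> else 1 - 1 / \<alpha>)"

lemma kappa: "0 \<le> \<kappa>" "\<kappa> < 1"
  using alpha_pos by (auto simp: \<kappa>_def)

text \<open>Selberg's formula makes \<open>t1 + t2\<close> small, so only a multiple \<open>\<kappa> < 1\<close> of one of the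
  two positive operators survives.\<close>

lemma kappa_bound:
  fixes t1 t2 s1 s2 e1 e2 \<mu> s :: real
  assumes t1: "\<bar>t1\<bar> \<le> \<mu> * s1 + e1" and t2: "\<bar>t2\<bar> \<le> \<mu> * s2 + e1"
    and s: "s1 \<ge> 0" "s2 \<ge> 0" "\<alpha> * s1 + \<alpha>\<^sup>2 * s2 \<le> s" and \<mu>: "\<mu> \<ge> 0" and e: "e1 \<ge> 0" "\<bar>t1 + t2\<bar> \<le> e2"
  shows "\<bar>\<alpha> * t1 + \<alpha>\<^sup>2 * t2\<bar> \<le> \<kappa> * \<mu> * s + (\<alpha> + \<alpha>\<^sup>2) * (e1 + e2)"
proof -
  have a: "\<alpha> > 0" "\<alpha>\<^sup>2 > 0" using alpha_pos by auto
  have e2: "e2 \<ge> 0" using e by linarith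
  have as: "\<alpha> * s1 \<ge> 0" "\<alpha>\<^sup>2 * s2 \<ge> 0" using a s by auto
  have ae: "\<alpha> * e1 \<ge> 0" "\<alpha>\<^sup>2 * e1 \<ge> 0" "\<alpha> * e2 \<ge> 0" "\<alpha>\<^sup>2 * e2 \<ge> 0" using a e e2 by auto
  show ?thesis
  proof (cases "\<alpha> \<le> 1")
    case True
    have "\<alpha> * t1 + \<alpha>\<^sup>2 * t2 = (1 - \<alpha>) * (\<alpha> * t1) + \<alpha>\<^sup>2 * (t1 + t2)"
      by (simp add: algebra_simps power2_eq_square)
    also have "\<bar>\<dots>\<bar> \<le> (1 - \<alpha>) * (\<alpha> * \<bar>t1\<bar>) + \<alpha>\<^sup>2 * \<bar>t1 + t2\<bar>"
      using True a by (intro order_trans[OF abs_triangle_ineq]) (simp add: abs_mult)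
    also have "\<dots> \<le> (1 - \<alpha>) * (\<alpha> * (\<mu> * s1 + e1)) + \<alpha>\<^sup>2 * e2"
      using t1 e a True by (intro add_mono mult_left_mono) auto
    also have "\<dots> = (1 - \<alpha>) * (\<mu> * (\<alpha> * s1)) + (1 - \<alpha>) * (\<alpha> * e1) + \<alpha>\<^sup>2 * e2" by (simp add: algebra_simps)
    also have "\<dots> \<le> (1 - \<alpha>) * (\<mu> * s) + 1 * (\<alpha> * e1) + \<alpha>\<^sup>2 * e2"
    proof -
      have "\<alpha> * s1 \<le> s" using as s by linarith
      hence "\<mu> * (\<alpha> * s1) \<le> \<mu> * s" using \<mu> by (intro mult_left_mono[of "\<alpha> * s1"])
      hence "(1 - \<alpha>) * (\<mu> * (\<alpha> * s1)) \<le> (1 - \<alpha>) * (\<mu> * s)" using True by (intro mult_left_mono[of "\<mu> * (\<alpha> * s1)"]) auto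
      moreover have "(1 - \<alpha>) * (\<alpha> * e1) \<le> 1 * (\<alpha> * e1)" using ae a by (intro mult_right_mono) auto
      ultimately show ?thesis by linarith
    qed
    also have "\<dots> \<le> \<kappa> * \<mu> * s + (\<alpha> + \<alpha>\<^sup>2) * (e1 + e2)"
      using ae True by (simp add: \<kappa>_def algebra_simps)
    finally show ?thesis .
  next
    case False
    have "\<alpha> * t1 + \<alpha>\<^sup>2 * t2 = (1 - 1 / \<alpha>) * (\<alpha>\<^sup>2 * t2) + \<alpha> * (t1 + t2)"
      using a by (simp add: field_simps power2_eq_square)
    also have "\<bar>\<dots>\<bar> \<le> (1 - 1 / \<alpha>) * (\<alpha>\<^sup>2 * \<bar>t2\<bar>) + \<alpha> * \<bar>t1 + t2\<bar>"
      using False a by (intro order_trans[OF abs_triangle_ineq]) (simp add: abs_mult)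
    also have "\<dots> \<le> (1 - 1 / \<alpha>) * (\<alpha>\<^sup>2 * (\<mu> * s2 + e1)) + \<alpha> * e2"
      using t2 e a False by (intro add_mono mult_left_mono) auto
    also have "\<dots> = (1 - 1 / \<alpha>) * (\<mu> * (\<alpha>\<^sup>2 * s2)) + (1 - 1 / \<alpha>) * (\<alpha>\<^sup>2 * e1) + \<alpha> * e2" by (simp add: algebra_simps)
    also have "\<dots> \<le> (1 - 1 / \<alpha>) * (\<mu> * s) + 1 * (\<alpha>\<^sup>2 * e1) + \<alpha> * e2"
    proof -
      have c: "0 \<le> 1 - 1 / \<alpha>" "1 - 1 / \<alpha> \<le> 1" using False a by auto
      have "\<alpha>\<^sup>2 * s2 \<le> s" using as s by linarith
      hence "\<mu> * (\<alpha>\<^sup>2 * s2) \<le> \<mu> * s" using \<mu> by (intro mult_left_mono[of "\<alpha>\<^sup>2 * s2"])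
      hence "(1 - 1 / \<alpha>) * (\<mu> * (\<alpha>\<^sup>2 * s2)) \<le> (1 - 1 / \<alpha>) * (\<mu> * s)" using c by (intro mult_left_mono[of "\<mu> * (\<alpha>\<^sup>2 * s2)"]) auto
      moreover have "(1 - 1 / \<alpha>) * (\<alpha>\<^sup>2 * e1) \<le> 1 * (\<alpha>\<^sup>2 * e1)" using ae c by (intro mult_right_mono) auto
      ultimately show ?thesis by linarith
    qed
    also have "\<dots> \<le> \<kappa> * \<mu> * s + (\<alpha> + \<alpha>\<^sup>2) * (e1 + e2)"
      using ae False by (simp add: \<kappa>_def algebra_simps)
    finally show ?thesis .
  qed
qed

text \<open>Division by S x * (ln x)^2, of order x * lp x * ell x, turns the errors into the listed
  ones: the range below z, the logarithmic average, the loss 1 / ln x of the identities, and the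
  instability \<eta>. Uniformity in all parameters lets h, z and \<mu> depend on x.\<close>

lemma contraction_inequality:
  "\<exists>K>0. \<forall>h b \<eta> x z \<mu>. ln x \<ge> 1 \<longrightarrow> 1 \<le> z \<longrightarrow> z \<le> x \<longrightarrow> \<mu> \<ge> 0 \<longrightarrow> prime_stable h b \<eta> \<longrightarrow>
     (\<forall>y. z \<le> y \<longrightarrow> y \<le> x \<longrightarrow> \<bar>Sh h y\<bar> \<le> \<mu> * S y) \<longrightarrow>
     \<bar>Sh h x\<bar> / S x \<le> \<kappa> * \<mu> + K * (b * A z / lp x + \<bar>W h x\<bar> / (ell x * lp x) + (b + \<mu>) / ln x + \<eta>)"
proof -
  obtain C where C: "C > 0" "\<And>h b \<eta> x. x \<ge> 1 \<Longrightarrow> prime_stable h b \<eta> \<Longrightarrow>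
     \<bar>Sh h x * (ln x)\<^sup>2 - \<alpha> * T1 (Sh h) x - \<alpha>\<^sup>2 * T2 (Sh h) x\<bar> \<le> C * (b * (x * lp x) + \<eta> * (x * lp x * ell x))"
    using second_order_identity by blast
  obtain c where c: "c > 0" "\<And>x. x \<ge> 1 \<Longrightarrow> S x \<ge> c * (x * (lp x / ell x))" using S_lower by blast
  obtain C3 where C3: "C3 > 0" "\<And>x. x \<ge> 1 \<Longrightarrow> A x \<le> C3 * lp x" using A_upper by blast
  define a where "a = \<alpha> + \<alpha>\<^sup>2"
  have a: "a > 0" using alpha_pos by (simp add: a_def add_pos_pos)
  define K where "K = 4 / c * (122 * a + 2 * a + 120 * a * C3 + C)"
  have K: "K > 0" using a c(1) C(1) C3(1) unfolding K_def by (intro mult_pos_pos add_pos_pos) auto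
  have "\<bar>Sh h x\<bar> / S x \<le> \<kappa> * \<mu> + K * (b * A z / lp x + \<bar>W h x\<bar> / (ell x * lp x) + (b + \<mu>) / ln x + \<eta>)"
    if lnx: "ln x \<ge> 1" and z: "1 \<le> z" "z \<le> x" and mu: "\<mu> \<ge> 0" and st: "prime_stable h b \<eta>"
      and hyp: "\<forall>y. z \<le> y \<longrightarrow> y \<le> x \<longrightarrow> \<bar>Sh h y\<bar> \<le> \<mu> * S y" for h b \<eta> x z \<mu>
  proof -
    have x: "x \<ge> 1" using z by simp
    have b0: "b \<ge> 0" by (rule prime_stable_nonneg[OF st])
    have bn: "\<And>n. n \<ge> 1 \<Longrightarrow> \<bar>h n\<bar> \<le> b" and eta: "\<eta> \<ge> 0" using st by (auto simp: prime_stable_def)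
    have L: "lp x \<ge> 1" "ell x \<ge> 1" using lp_ge_1[OF x] ell_ge_1[OF x] by auto
    define g where "g = (\<lambda>n::nat. if real n \<le> z then 1 else 0 :: real)"
    have Shg: "Sh g y \<ge> 0" for y unfolding Sh_def g_def by (intro sum_nonneg mult_nonneg_nonneg f_nonneg'[of _ y]) auto
    \<comment> \<open>A bound valid on the whole range: where the hypothesis is silent, below z, the
      trivial bound b is used, and \<open>Sh g\<close> carries that part into the operators.\<close>
    have pw: "\<bar>Sh h y\<bar> \<le> \<mu> * S y + b * Sh g y" if y: "1 \<le> y" "y \<le> x" for y
    proof (cases "z \<le> y")
      case True
      have "\<bar>Sh h y\<bar> \<le> \<mu> * S y" using hyp True y by blast
      also have "\<dots> \<le> \<mu> * S y + b * Sh g y" using b0 Shg by simp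
      finally show ?thesis .
    next
      case False
      have "Sh g y = S y" unfolding Sh_def S_def g_def using False by (intro sum.cong) (auto simp: mem_nats_le)
      hence "\<bar>Sh h y\<bar> \<le> b * Sh g y" using abs_Sh_le[OF bn] by simp
      also have "\<dots> \<le> \<mu> * S y + b * Sh g y" using mu S_nonneg[of y] by simp
      finally show ?thesis .
    qed
    let ?e1 = "b * (122 * x * ell x * A z)" and ?e2 = "2 * x * \<bar>W h x\<bar> + 120 * b * x * A x"
    have g12: "T1 (Sh g) x \<ge> 0" "T2 (Sh g) x \<ge> 0" "T1 (Sh g) x + T2 (Sh g) x \<le> 122 * x * ell x * A z"
      using T1_T2_truncated[OF x z] unfolding g_def[symmetric] by (auto intro!: T1_nonneg T2_nonneg Shg)
    have t1: "\<bar>T1 (Sh h) x\<bar> \<le> \<mu> * T1 S x + ?e1"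
    proof -
      have "\<bar>T1 (Sh h) x\<bar> \<le> T1 (\<lambda>y. \<mu> * S y + b * Sh g y) x" by (rule T1_mono) (rule pw)
      also have "\<dots> = \<mu> * T1 S x + b * T1 (Sh g) x" by (rule T1_linear)
      also have "\<dots> \<le> \<mu> * T1 S x + ?e1" using g12 b0 by (intro add_left_mono mult_left_mono) linarith
      finally show ?thesis .
    qed
    have t2: "\<bar>T2 (Sh h) x\<bar> \<le> \<mu> * T2 S x + ?e1"
    proof -
      have "\<bar>T2 (Sh h) x\<bar> \<le> T2 (\<lambda>y. \<mu> * S y + b * Sh g y) x" by (rule T2_mono) (rule pw)
      also have "\<dots> = \<mu> * T2 S x + b * T2 (Sh g) x" by (rule T2_linear)
      also have "\<dots> \<le> \<mu> * T2 S x + ?e1" using g12 b0 by (intro add_left_mono mult_left_mono) linarith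
      finally show ?thesis .
    qed
    have e2: "\<bar>T1 (Sh h) x + T2 (Sh h) x\<bar> \<le> ?e2"
    proof -
      have "\<bar>2 * x * W h x\<bar> = 2 * x * \<bar>W h x\<bar>" using x by (simp add: abs_mult)
      thus ?thesis using T1_T2_Selberg[of x h b, OF x bn] by linarith
    qed
    have one: "prime_stable (\<lambda>_. 1) 1 0" by (simp add: prime_stable_def)
    \<comment> \<open>For h = 1 the identity says that S reproduces itself, which bounds the total
      weighted mass of both operators applied to S.\<close>
    have s: "\<alpha> * T1 S x + \<alpha>\<^sup>2 * T2 S x \<le> S x * (ln x)\<^sup>2 + C * (x * lp x)"
      using C(2)[OF x one] unfolding S_eq_Sh[symmetric] by simp
    have kb: "\<bar>\<alpha> * T1 (Sh h) x + \<alpha>\<^sup>2 * T2 (Sh h) x\<bar> \<le> \<kappa> * \<mu> * (S x * (ln x)\<^sup>2 + C * (x * lp x)) + a * (?e1 + ?e2)"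
      unfolding a_def using b0 x L A_nonneg[of z]
      by (intro kappa_bound[OF t1 t2 T1_nonneg T2_nonneg s mu _ e2] S_nonneg) simp
    have "\<bar>Sh h x\<bar> * (ln x)\<^sup>2 = \<bar>Sh h x * (ln x)\<^sup>2\<bar>" by (simp add: abs_mult)
    also have "\<dots> \<le> \<kappa> * \<mu> * (S x * (ln x)\<^sup>2 + C * (x * lp x)) + a * (?e1 + ?e2) + C * (b * (x * lp x) + \<eta> * (x * lp x * ell x))"
      using kb C(2)[OF x st] by linarith
    also have "\<kappa> * \<mu> * (S x * (ln x)\<^sup>2 + C * (x * lp x)) \<le> \<kappa> * \<mu> * (S x * (ln x)\<^sup>2) + 1 * \<mu> * (C * (x * lp x))"
      unfolding distrib_left using kappa mu C(1) x L S_nonneg[of x] by (intro add_mono mult_right_mono) auto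
    also have "a * (?e1 + ?e2) \<le> a * (b * (122 * x * ell x * A z) + (2 * x * \<bar>W h x\<bar> + 120 * b * x * (C3 * lp x)))"
      using a b0 x C3(2)[OF x] by (intro mult_left_mono[OF add_mono[OF order_refl add_left_mono]] mult_left_mono[of "A x"]) auto
    finally have main: "\<bar>Sh h x\<bar> * (ln x)\<^sup>2 \<le> \<kappa> * \<mu> * (S x * (ln x)\<^sup>2)
       + (\<mu> * (C * (x * lp x)) + a * (b * (122 * x * ell x * A z) + (2 * x * \<bar>W h x\<bar> + 120 * b * x * (C3 * lp x)))
       + C * (b * (x * lp x) + \<eta> * (x * lp x * ell x)))" by simp
    define U where "U = x * lp x * ell x"
    have U: "U > 0" using x L by (simp add: U_def)
    have Sx: "S x > 0" using S_ge_1[OF x] by simp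
    have US: "U \<le> 4 / c * (S x * (ln x)\<^sup>2)"
    proof -
      have "ell x ^ 2 \<le> (2 * ln x) ^ 2" using ell_bounds_ln[OF lnx] L by (intro power_mono) auto
      hence e: "ell x ^ 2 \<le> 4 * (ln x)\<^sup>2" by (simp add: power_mult_distrib)
      have "U = x * (lp x / ell x) * ell x ^ 2" using L by (simp add: U_def power2_eq_square)
      also have "\<dots> \<le> (S x / c) * (4 * (ln x)\<^sup>2)"
        using c(2)[OF x] c(1) e x L Sx by (intro mult_mono) (auto simp: field_simps)
      finally show ?thesis by (simp add: mult_ac)
    qed
    have il: "1 / ell x \<le> 1 / ln x" using lnx L by (intro divide_left_mono) (auto simp: ell_def)
    have r1: "x * lp x \<le> U * (1 / ln x)"
    proof -
      have "x * lp x = U * (1 / ell x)" using L by (simp add: U_def)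
      also have "\<dots> \<le> U * (1 / ln x)" using il U by (intro mult_left_mono) auto
      finally show ?thesis .
    qed
    have r2: "x * ell x * A z = U * (A z / lp x)" using L by (simp add: U_def)
    have r3: "x * \<bar>W h x\<bar> = U * (\<bar>W h x\<bar> / (ell x * lp x))" using L by (simp add: U_def)
    define P1 where "P1 = b * A z / lp x"
    define P2 where "P2 = \<bar>W h x\<bar> / (ell x * lp x)"
    define P3 where "P3 = (b + \<mu>) / ln x"
    have P: "P1 \<ge> 0" "P2 \<ge> 0" "P3 \<ge> 0" using b0 A_nonneg[of z] L mu lnx by (auto simp: P1_def P2_def P3_def)
    have "\<mu> * (C * (x * lp x)) + a * (b * (122 * x * ell x * A z) + (2 * x * \<bar>W h x\<bar> + 120 * b * x * (C3 * lp x)))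
       + C * (b * (x * lp x) + \<eta> * (x * lp x * ell x))
       = C * ((b + \<mu>) * (x * lp x)) + 122 * a * (b * (x * ell x * A z)) + 2 * a * (x * \<bar>W h x\<bar>)
         + 120 * a * C3 * (b * (x * lp x)) + C * (\<eta> * U)"
      by (simp add: U_def algebra_simps)
    also have "\<dots> \<le> C * ((b + \<mu>) * (U * (1 / ln x))) + 122 * a * (b * (U * (A z / lp x))) + 2 * a * (U * (\<bar>W h x\<bar> / (ell x * lp x)))
         + 120 * a * C3 * ((b + \<mu>) * (U * (1 / ln x))) + C * (\<eta> * U)"
    proof -
      have "b * (x * lp x) \<le> (b + \<mu>) * (U * (1 / ln x))"
        by (rule mult_mono[OF _ r1]) (use b0 mu x L in auto)
      moreover have "(b + \<mu>) * (x * lp x) \<le> (b + \<mu>) * (U * (1 / ln x))"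
        using b0 mu r1 by (intro mult_left_mono) auto
      ultimately have "120 * a * C3 * (b * (x * lp x)) \<le> 120 * a * C3 * ((b + \<mu>) * (U * (1 / ln x)))"
        "C * ((b + \<mu>) * (x * lp x)) \<le> C * ((b + \<mu>) * (U * (1 / ln x)))"
        using a C3(1) C(1) by - (rule mult_left_mono, assumption, simp)+
      thus ?thesis unfolding r2 r3 by linarith
    qed
    also have "\<dots> = U * (122 * a * P1 + 2 * a * P2 + (C + 120 * a * C3) * P3 + C * \<eta>)"
      by (simp add: P1_def P2_def P3_def algebra_simps add_divide_distrib)
    also have "\<dots> \<le> U * ((122 * a + 2 * a + 120 * a * C3 + C) * (P1 + P2 + P3 + \<eta>))"
    proof -
      have nn: "a * P1 \<ge> 0" "a * P2 \<ge> 0" "a * P3 \<ge> 0" "a * \<eta> \<ge> 0" "C * P1 \<ge> 0" "C * P2 \<ge> 0"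
        "a * C3 * P1 \<ge> 0" "a * C3 * P2 \<ge> 0" "a * C3 * \<eta> \<ge> 0"
        using P eta a C(1) C3(1) by auto
      have "122 * a * P1 + 2 * a * P2 + (C + 120 * a * C3) * P3 + C * \<eta> \<le> (122 * a + 2 * a + 120 * a * C3 + C) * (P1 + P2 + P3 + \<eta>)"
        using nn by (simp add: algebra_simps)
      thus ?thesis using U by (intro mult_left_mono) auto
    qed
    also have "\<dots> \<le> (4 / c * (S x * (ln x)\<^sup>2)) * ((122 * a + 2 * a + 120 * a * C3 + C) * (P1 + P2 + P3 + \<eta>))"
      using US P eta a C(1) C3(1) by (intro mult_right_mono mult_nonneg_nonneg add_nonneg_nonneg) auto
    also have "\<dots> = (S x * (ln x)\<^sup>2) * (K * (P1 + P2 + P3 + \<eta>))" by (simp add: K_def mult_ac)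
    finally have "\<bar>Sh h x\<bar> * (ln x)\<^sup>2 \<le> (S x * (ln x)\<^sup>2) * (\<kappa> * \<mu> + K * (P1 + P2 + P3 + \<eta>))"
      using main by (simp only: distrib_left mult_ac)
    hence "(ln x)\<^sup>2 * \<bar>Sh h x\<bar> \<le> (ln x)\<^sup>2 * (S x * (\<kappa> * \<mu> + K * (P1 + P2 + P3 + \<eta>)))" by (simp only: mult_ac)
    hence "\<bar>Sh h x\<bar> \<le> S x * (\<kappa> * \<mu> + K * (P1 + P2 + P3 + \<eta>))"
      using lnx by (subst (asm) mult_le_cancel_left_pos) auto
    hence "\<bar>Sh h x\<bar> / S x \<le> \<kappa> * \<mu> + K * (P1 + P2 + P3 + \<eta>)" using Sx by (simp add: divide_le_eq mult.commute)
    thus ?thesis unfolding P1_def P2_def P3_def .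
  qed
  with K show ?thesis by (intro exI[of _ K] conjI allI impI)
qed

text \<open>Once \<theta> * ln x \<ge> 1, the summand 1 in \<open>ell\<close> is absorbed by the
  factor 2. This is the source of the small factor for all that happens below x powr
  \<theta>.\<close>

lemma lp_powr_le:
  assumes "x \<ge> 1" "\<theta> > 0" "\<theta> * ln x \<ge> 1"
  shows "lp (x powr \<theta>) \<le> (2 * \<theta>) powr \<alpha> * lp x"
proof -
  have lnx: "ln x \<ge> 0" using assms by simp
  have "ell (x powr \<theta>) = 1 + \<theta> * ln x" using assms by (simp add: ell_def ln_powr)
  also have "\<dots> \<le> 2 * \<theta> * ell x" using assms by (simp add: ell_def algebra_simps)
  finally have "ell (x powr \<theta>) \<le> 2 * \<theta> * ell x" .
  moreover have "ell (x powr \<theta>) \<ge> 1" using assms by (intro ell_ge_1) (simp add: ge_one_powr_ge_zero)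
  ultimately have "lp (x powr \<theta>) \<le> (2 * \<theta> * ell x) powr \<alpha>"
    unfolding lp_def using alpha_pos by (intro powr_mono2) auto
  also have "\<dots> = (2 * \<theta>) powr \<alpha> * lp x" unfolding lp_def using assms ell_ge_1[of x] by (simp add: powr_mult)
  finally show ?thesis .
qed

text \<open>The ratio compares \<open>H x\<close> at x with S x, whereas the inequality needs the
  fixed function \<open>H x\<close> at all y in the range from x powr \<theta> to x. Slow variation
  of H in its first argument bridges the two.\<close>

proposition contraction:
  fixes H :: "real \<Rightarrow> nat \<Rightarrow> real"
  assumes st: "\<And>\<epsilon>. \<epsilon> > 0 \<Longrightarrow> \<forall>\<^sub>F x in at_top. prime_stable (H x) b \<epsilon>"
    and slow: "\<And>\<theta> \<epsilon>. 0 < \<theta> \<Longrightarrow> \<theta> < 1 \<Longrightarrow> \<epsilon> > 0 \<Longrightarrow>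
      \<forall>\<^sub>F x in at_top. \<forall>y. x powr \<theta> \<le> y \<longrightarrow> y \<le> x \<longrightarrow> (\<forall>n\<ge>1. \<bar>H x n - H y n\<bar> \<le> \<epsilon>)"
    and W: "((\<lambda>x. \<bar>W (H x) x\<bar> / (ell x * lp x)) \<longlongrightarrow> 0) at_top"
  shows "((\<lambda>x. Sh (H x) x / S x) \<longlongrightarrow> 0) at_top"
proof -
  define r where "r x = \<bar>Sh (H x) x\<bar> / S x" for x
  obtain K where K: "K > 0" "\<And>h b \<eta> x z \<mu>. ln x \<ge> 1 \<Longrightarrow> 1 \<le> z \<Longrightarrow> z \<le> x \<Longrightarrow> \<mu> \<ge> 0 \<Longrightarrow> prime_stable h b \<eta> \<Longrightarrow>
     (\<forall>y. z \<le> y \<longrightarrow> y \<le> x \<longrightarrow> \<bar>Sh h y\<bar> \<le> \<mu> * S y) \<Longrightarrow>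
     \<bar>Sh h x\<bar> / S x \<le> \<kappa> * \<mu> + K * (b * A z / lp x + \<bar>W h x\<bar> / (ell x * lp x) + (b + \<mu>) / ln x + \<eta>)"
    using contraction_inequality by blast
  obtain C3 where C3: "C3 > 0" "\<And>x. x \<ge> 1 \<Longrightarrow> A x \<le> C3 * lp x" using A_upper by blast
  have b0: "b \<ge> 0"
  proof -
    obtain x where "prime_stable (H x) b 1" using st[of 1] by (auto simp: eventually_at_top_linorder)
    thus ?thesis by (rule prime_stable_nonneg)
  qed
  have rb: "\<forall>\<^sub>F x in at_top. r x \<le> b"
    using st[OF zero_less_one] eventually_ge_at_top[of 1]
  proof eventually_elim
    case (elim x)
    have "\<bar>Sh (H x) x\<bar> \<le> b * S x" using elim(1) by (intro abs_Sh_le) (auto simp: prime_stable_def)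
    thus ?case using S_ge_1[OF elim(2)] by (simp add: r_def divide_le_eq)
  qed
  \<comment> \<open>One round: an eventual bound \<mu> improves to \<kappa> * \<mu> + \<epsilon>.
    First \<theta> is fixed so that the range below x powr \<theta> is negligible; all other errors
    vanish as x grows.\<close>
  have step: "\<forall>\<^sub>F x in at_top. r x \<le> \<kappa> * \<mu> + \<epsilon>" if mu: "\<mu> \<ge> 0" "\<forall>\<^sub>F x in at_top. r x \<le> \<mu>" and eps: "\<epsilon> > 0" for \<mu> \<epsilon>
  proof -
    have "((\<lambda>\<theta>. (2 * \<theta>) powr \<alpha>) \<longlongrightarrow> 0) (at_right 0)" using alpha_pos by real_asymp
    hence "((\<lambda>\<theta>. K * (b * (C3 * (2 * \<theta>) powr \<alpha>))) \<longlongrightarrow> K * (b * (C3 * 0))) (at_right 0)"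
      by (intro tendsto_intros)
    hence "\<forall>\<^sub>F \<theta> in at_right 0. K * (b * (C3 * (2 * \<theta>) powr \<alpha>)) < \<epsilon> / 4"
      using eps by (intro order_tendstoD(2)) auto
    moreover have "\<forall>\<^sub>F \<theta> in at_right (0::real). \<theta> < 1" "\<forall>\<^sub>F \<theta> in at_right (0::real). 0 < \<theta>"
      unfolding eventually_at_right_field by (rule exI[of _ 1], simp)+
    ultimately have "\<forall>\<^sub>F \<theta> in at_right (0::real). K * (b * (C3 * (2 * \<theta>) powr \<alpha>)) < \<epsilon> / 4 \<and> \<theta> < 1 \<and> 0 < \<theta>"
      by eventually_elim auto
    then obtain \<theta> where th: "K * (b * (C3 * (2 * \<theta>) powr \<alpha>)) < \<epsilon> / 4" "\<theta> < 1" "0 < \<theta>"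
      using eventually_happens'[of "at_right (0::real)"] by (auto simp: trivial_limit_at_right_real)
    obtain X0 where X0: "\<And>y. y \<ge> X0 \<Longrightarrow> r y \<le> \<mu>" using mu(2) by (auto simp: eventually_at_top_linorder)
    define \<epsilon>' where "\<epsilon>' = \<epsilon> / 4"
    have e': "\<epsilon>' > 0" using eps by (simp add: \<epsilon>'_def)
    define \<eta> where "\<eta> = \<epsilon> / (8 * K)"
    have eta: "\<eta> > 0" "K * \<eta> = \<epsilon> / 8" using eps K(1) by (auto simp: \<eta>_def)
    have "filterlim (\<lambda>x. x powr \<theta>) at_top at_top" using th by real_asymp
    hence ev1: "\<forall>\<^sub>F x in at_top. x powr \<theta> \<ge> max X0 1" by (rule filterlim_at_top[THEN iffD1, rule_format])
    have "filterlim (\<lambda>x. \<theta> * ln x) at_top at_top" using th by real_asymp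
    hence ev2: "\<forall>\<^sub>F x in at_top. \<theta> * ln x \<ge> 1" by (rule filterlim_at_top[THEN iffD1, rule_format])
    have "((\<lambda>x. K * (\<bar>W (H x) x\<bar> / (ell x * lp x) + (b + (\<mu> + \<epsilon>')) / ln x + \<eta>)) \<longlongrightarrow> K * (0 + 0 + \<eta>)) at_top"
    proof (intro tendsto_intros W)
      show "((\<lambda>x. (b + (\<mu> + \<epsilon>')) / ln x) \<longlongrightarrow> 0) at_top" by real_asymp
    qed
    hence ev3: "\<forall>\<^sub>F x in at_top. K * (\<bar>W (H x) x\<bar> / (ell x * lp x) + (b + (\<mu> + \<epsilon>')) / ln x + \<eta>) < \<epsilon> / 4"
    proof (rule order_tendstoD(2))
      have "K * (0 + 0 + \<eta>) = \<epsilon> / 8" using eta(2) by (simp only: add_0)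
      thus "K * (0 + 0 + \<eta>) < \<epsilon> / 4" using eps by linarith
    qed
    show ?thesis
      using ev1 ev2 ev3 st[OF eta(1)] slow[OF th(3,2) e'] eventually_ge_at_top[of 1]
    proof eventually_elim
      case (elim x)
      let ?z = "x powr \<theta>"
      have x: "x \<ge> 1" by fact
      have "\<theta> * ln x \<le> 1 * ln x" using th x by (intro mult_right_mono) auto
      hence lnx: "ln x \<ge> 1" using elim(2) by linarith
      have z: "1 \<le> ?z" "?z \<le> x" using elim(1) x th powr_mono[of \<theta> 1 x] by auto
      have pw: "\<bar>Sh (H x) y\<bar> \<le> (\<mu> + \<epsilon>') * S y" if y: "?z \<le> y" "y \<le> x" for y
      proof -
        have y1: "y \<ge> 1" "y \<ge> X0" using y z elim(1) by auto
        have "Sh (H x) y = Sh (H y) y + Sh (\<lambda>n. H x n - H y n) y"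
          by (simp add: Sh_def algebra_simps sum_subtractf)
        moreover have "\<bar>Sh (H y) y\<bar> \<le> \<mu> * S y"
          using X0[OF y1(2)] S_ge_1[OF y1(1)] by (simp add: r_def divide_le_eq)
        moreover have "\<bar>Sh (\<lambda>n. H x n - H y n) y\<bar> \<le> \<epsilon>' * S y" using elim(5) y by (intro abs_Sh_le) blast
        ultimately show ?thesis by (simp only: distrib_right)
      qed
      have "r x \<le> \<kappa> * (\<mu> + \<epsilon>') + K * (b * A ?z / lp x + \<bar>W (H x) x\<bar> / (ell x * lp x) + (b + (\<mu> + \<epsilon>')) / ln x + \<eta>)"
        unfolding r_def using lnx z mu e' elim(4) pw by (intro K(2)) auto
      also have "\<dots> = \<kappa> * \<mu> + \<kappa> * \<epsilon>' + K * (b * A ?z / lp x) + K * (\<bar>W (H x) x\<bar> / (ell x * lp x) + (b + (\<mu> + \<epsilon>')) / ln x + \<eta>)"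
        by (simp add: algebra_simps)
      also have "\<kappa> * \<epsilon>' \<le> 1 * \<epsilon>'" using kappa e' by (intro mult_right_mono) auto
      also have "K * (b * A ?z / lp x) \<le> K * (b * (C3 * (2 * \<theta>) powr \<alpha>))"
      proof -
        have "A ?z \<le> C3 * lp ?z" by (rule C3(2)[OF z(1)])
        also have "\<dots> \<le> C3 * ((2 * \<theta>) powr \<alpha> * lp x)"
          using lp_powr_le[OF x th(3) elim(2)] C3(1) by (intro mult_left_mono) auto
        finally have "A ?z / lp x \<le> C3 * (2 * \<theta>) powr \<alpha>" using lp_ge_1[OF x] by (simp add: divide_le_eq mult_ac)
        hence "b * (A ?z / lp x) \<le> b * (C3 * (2 * \<theta>) powr \<alpha>)" using b0 by (intro mult_left_mono)
        hence "K * (b * (A ?z / lp x)) \<le> K * (b * (C3 * (2 * \<theta>) powr \<alpha>))"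
          by (rule mult_left_mono) (use K(1) in simp)
        thus ?thesis by simp
      qed
      finally show ?case using th(1) elim(3) eps unfolding \<epsilon>'_def by linarith
    qed
  qed
  \<comment> \<open>The trivial bound b starts the iteration. Each \<epsilon> is arbitrary, so
    finitely many rounds accumulate no error.\<close>
  have iter: "\<forall>\<epsilon>>0. \<forall>\<^sub>F x in at_top. r x \<le> \<kappa> ^ n * b + \<epsilon>" for n
  proof (induction n)
    case 0
    show ?case using rb by (auto elim!: eventually_mono)
  next
    case (Suc n)
    show ?case
    proof (intro allI impI)
      fix \<epsilon> :: real assume e: "\<epsilon> > 0"
      have "\<forall>\<^sub>F x in at_top. r x \<le> \<kappa> * (\<kappa> ^ n * b + \<epsilon> / 2) + \<epsilon> / 2"
        using e Suc kappa b0 by (intro step) auto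
      moreover have "\<kappa> * (\<epsilon> / 2) \<le> 1 * (\<epsilon> / 2)" using kappa e by (intro mult_right_mono) auto
      hence "\<kappa> * (\<kappa> ^ n * b + \<epsilon> / 2) + \<epsilon> / 2 \<le> \<kappa> ^ Suc n * b + \<epsilon>" by (simp add: algebra_simps)
      ultimately show "\<forall>\<^sub>F x in at_top. r x \<le> \<kappa> ^ Suc n * b + \<epsilon>"
        by (auto elim!: eventually_mono)
    qed
  qed
  have "((\<lambda>x. Sh (H x) x / S x) \<longlongrightarrow> 0) at_top"
  proof (rule tendstoI)
    fix e :: real assume e: "e > 0"
    have "(\<lambda>n. \<kappa> ^ n * b) \<longlonglongrightarrow> 0 * b" using kappa by (intro tendsto_intros LIMSEQ_power_zero) auto
    hence "\<forall>\<^sub>F n in sequentially. \<kappa> ^ n * b < e / 2" using e by (intro order_tendstoD(2)) auto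
    then obtain n where n: "\<kappa> ^ n * b < e / 2" by (auto simp: eventually_at_top_linorder)
    have "\<forall>\<^sub>F x in at_top. r x \<le> \<kappa> ^ n * b + e / 2" using iter e by simp
    thus "\<forall>\<^sub>F x in at_top. dist (Sh (H x) x / S x) 0 < e"
      by eventually_elim (use n S_nonneg in \<open>auto simp: r_def abs_divide\<close>)
  qed
  thus ?thesis .
qed

end

section \<open>The central limit theorem for the Dirichlet weights\<close>

lemma sums_of_has_sum_positive:
  fixes g :: "nat \<Rightarrow> 'a :: real_normed_vector"
  assumes "(g has_sum s) {0<..}"
  shows "(\<lambda>n. if n > 0 then g n else 0) sums s"
proof -
  have "((\<lambda>n. if n > 0 then g n else 0) has_sum s) UNIV \<longleftrightarrow> (g has_sum s) {0<..}"
    by (rule has_sum_cong_neutral) auto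
  with assms have "((\<lambda>n. if n > 0 then g n else 0) has_sum s) UNIV" by simp
  thus ?thesis by (rule has_sum_imp_sums)
qed

definition omega_normalized :: "real \<Rightarrow> real \<Rightarrow> nat \<Rightarrow> real" where
  "omega_normalized \<alpha> x n = (real (prime_Omega n) - \<alpha> * ln (ln x)) / sqrt (\<alpha> * ln (ln x))"

lemma norm_iexp_minus_1: "norm (iexp s - 1) \<le> \<bar>s\<bar>"
  using iexp_approx1[of s 0] by simp

lemma norm_iexp_second_order: "norm (iexp s - 1 - \<i> * s + s\<^sup>2 / 2) \<le> \<bar>s\<bar> ^ 3 / 6"
  using iexp_approx1[of s 2] by (simp add: numeral_2_eq_2 numeral_3_eq_3 fact_numeral power2_eq_square algebra_simps)

context weight_fun
begin

definition pw :: "real \<Rightarrow> nat \<Rightarrow> real" where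
  "pw \<sigma> n = (if n > 0 then w \<sigma> n / E \<sigma> else 0)"

text \<open>The law of a random positive integer n with probability proportional to f n * n powr
  -\<sigma>; through \<open>pw\<close> the integer 0 has mass 0.\<close>

definition M :: "real \<Rightarrow> nat measure" where
  "M \<sigma> = density (count_space UNIV) (\<lambda>n. ennreal (pw \<sigma> n))"

lemma pw_nonneg: "\<sigma> > 1 \<Longrightarrow> pw \<sigma> n \<ge> 0"
  using E_pos[of \<sigma>] w_nonneg[of n \<sigma>] by (simp add: pw_def Suc_le_eq)

lemma pw_sums: "\<sigma> > 1 \<Longrightarrow> pw \<sigma> sums 1"
proof -
  assume s: "\<sigma> > 1"
  have "(\<lambda>n. (if n > 0 then w \<sigma> n else 0) / E \<sigma>) sums (E \<sigma> / E \<sigma>)"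
    by (intro sums_divide sums_of_has_sum_positive has_sum_w s)
  moreover have "(\<lambda>n. (if n > 0 then w \<sigma> n else 0) / E \<sigma>) = pw \<sigma>" by (auto simp: pw_def)
  ultimately show ?thesis using E_pos[OF s] by simp
qed

lemma space_M [simp]: "space (M \<sigma>) = UNIV" and sets_M [simp, measurable_cong]: "sets (M \<sigma>) = UNIV"
  by (simp_all add: M_def)

lemma borel_measurable_M [simp]: "g \<in> borel_measurable (M \<sigma>)"
  by (simp add: measurable_def)

lemma prob_space_M:
  assumes "\<sigma> > 1"
  shows "prob_space (M \<sigma>)"
proof
  have "emeasure (M \<sigma>) (space (M \<sigma>)) = (\<integral>\<^sup>+n. ennreal (pw \<sigma> n) \<partial>count_space UNIV)"
    by (simp add: M_def emeasure_density)
  also have "\<dots> = (\<Sum>n. ennreal (pw \<sigma> n))" by (rule nn_integral_count_space_nat)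
  also have "\<dots> = ennreal 1" using pw_nonneg[OF assms] pw_sums[OF assms] by (intro suminf_ennreal_eq)
  finally show "emeasure (M \<sigma>) (space (M \<sigma>)) = 1" by simp
qed

lemma integral_M:
  fixes g :: "nat \<Rightarrow> 'b :: {banach, second_countable_topology}"
  assumes s: "\<sigma> > 1" and g: "\<And>n. norm (g n) \<le> K"
  shows "(\<lambda>n. pw \<sigma> n *\<^sub>R g n) sums integral\<^sup>L (M \<sigma>) g"
proof -
  have "summable (\<lambda>n. norm (pw \<sigma> n *\<^sub>R g n))"
  proof (rule summable_comparison_test)
    show "summable (\<lambda>n. K * pw \<sigma> n)" using pw_sums[OF s] by (intro summable_mult) (rule sums_summable)
    show "\<exists>N. \<forall>n\<ge>N. norm (norm (pw \<sigma> n *\<^sub>R g n)) \<le> K * pw \<sigma> n"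
      using g pw_nonneg[OF s] by (auto simp: mult.commute intro!: mult_right_mono)
  qed
  hence "integrable (count_space UNIV) (\<lambda>n. pw \<sigma> n *\<^sub>R g n)" by (simp only: integrable_count_space_nat_iff)
  hence "(\<lambda>n. pw \<sigma> n *\<^sub>R g n) sums integral\<^sup>L (count_space UNIV) (\<lambda>n. pw \<sigma> n *\<^sub>R g n)"
    by (rule sums_integral_count_space_nat)
  thus ?thesis unfolding M_def using pw_nonneg[OF s] by (subst integral_density) auto
qed

definition D :: "real \<Rightarrow> real \<Rightarrow> real measure" where
  "D \<sigma> x = distr (M \<sigma>) borel (omega_normalized \<alpha> x)"

lemma real_distribution_D: "\<sigma> > 1 \<Longrightarrow> real_distribution (D \<sigma> x)"
  unfolding D_def by (intro prob_space.real_distribution_distr prob_space_M) simp_all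

text \<open>Up to the phase from the centring, the characteristic function of the normalised Omega
  is the quotient \<open>EZ \<sigma> z / E \<sigma>\<close> at a point z of the unit circle.\<close>

lemma char_D:
  assumes s: "\<sigma> > 1"
  defines "z \<equiv> \<lambda>x t. iexp (t / sqrt (\<alpha> * ln (ln x)))"
  shows "char (D \<sigma> x) t = iexp (- t * (\<alpha> * ln (ln x)) / sqrt (\<alpha> * ln (ln x))) * (EZ \<sigma> (z x t) / of_real (E \<sigma>))"
proof -
  let ?L = "\<alpha> * ln (ln x)"
  define e where "e = iexp (- t * ?L / sqrt ?L)"
  have nz: "norm (z x t) \<le> 1" by (simp add: z_def)
  have "char (D \<sigma> x) t = (CLINT n|M \<sigma>. iexp (t * omega_normalized \<alpha> x n))"
    unfolding char_def D_def by (subst integral_distr) auto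
  moreover have "(\<lambda>n. pw \<sigma> n *\<^sub>R iexp (t * omega_normalized \<alpha> x n)) sums (CLINT n|M \<sigma>. iexp (t * omega_normalized \<alpha> x n))"
    by (rule integral_M[OF s, where K = 1]) simp
  moreover have "pw \<sigma> n *\<^sub>R iexp (t * omega_normalized \<alpha> x n) = e * ((if n > 0 then zw \<sigma> (z x t) n else 0) / of_real (E \<sigma>))" for n
  proof -
    have "iexp (t * omega_normalized \<alpha> x n) = e * z x t ^ prime_Omega n"
      unfolding e_def z_def exp_of_nat_mult[symmetric] exp_add[symmetric] omega_normalized_def
      by (simp add: diff_divide_distrib algebra_simps)
    thus ?thesis by (simp add: pw_def zw_def scaleR_conv_of_real)
  qed
  moreover have "(\<lambda>n. e * ((if n > 0 then zw \<sigma> (z x t) n else 0) / of_real (E \<sigma>))) sums (e * (EZ \<sigma> (z x t) / of_real (E \<sigma>)))"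
    by (intro sums_mult sums_divide sums_of_has_sum_positive has_sum_zw s nz)
  ultimately show ?thesis unfolding e_def by (simp add: sums_iff)
qed

text \<open>By \<open>EZ_ratio_close\<close> the quotient is that of a Poisson law with parameter
  \<alpha> * \<open>prime_zeta \<sigma>\<close>, up to O(|z - 1|). At \<sigma> = 1 + c / ln x the
  parameter is \<alpha> * ln ln x + O(1) for every c, so the same centring works for all these
  \<sigma>. The \<open>max 1\<close> keeps \<sigma> > 1 for every x.\<close>

lemma char_D_tendsto:
  assumes c: "c > 0"
  shows "((\<lambda>x. char (D (1 + c / max 1 (ln x)) x) t) \<longlongrightarrow> exp (- (of_real (t\<^sup>2) / 2))) at_top"
proof -
  obtain K where K: "\<And>\<sigma> z. \<sigma> > 1 \<Longrightarrow> norm z \<le> 1 \<Longrightarrow>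
    norm (EZ \<sigma> z / of_real (E \<sigma>) - exp (of_real (\<alpha> * prime_zeta \<sigma>) * (z - 1))) \<le> K * norm (z - 1)"
    using EZ_ratio_close by blast
  define L where "L x = \<alpha> * ln (ln x)" for x :: real
  define s where "s x = t / sqrt (L x)" for x
  define P where "P x = prime_zeta (1 + c / max 1 (ln x))" for x
  define ex where "ex x = of_real (\<alpha> * P x) * (iexp (s x) - 1) - \<i> * of_real (t * L x / sqrt (L x))" for x
  have slim: "(s \<longlongrightarrow> 0) at_top" unfolding s_def L_def using alpha_pos by real_asymp
  have "((\<lambda>x. ex x + of_real (t\<^sup>2) / 2) \<longlongrightarrow> 0) at_top"
  proof (rule Lim_null_comparison)
    have "\<forall>\<^sub>F x in at_top. ln x \<ge> max 1 c" by real_asymp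
    moreover have "\<forall>\<^sub>F x in at_top. L x > 0" unfolding L_def using alpha_pos by real_asymp
    ultimately show "\<forall>\<^sub>F x in at_top. norm (ex x + of_real (t\<^sup>2) / 2)
        \<le> \<alpha> * (36 + \<bar>ln c\<bar>) * \<bar>s x\<bar> + L x * (\<bar>s x\<bar> ^ 3 / 6)"
    proof eventually_elim
      case (elim x)
      hence lx: "ln x \<ge> 1" "ln x \<ge> c" "max 1 (ln x) = ln x" by auto
      have d: "0 < c / ln x" "c / ln x \<le> 1" using c lx by auto
      have "\<bar>P x - ln (1 / (c / ln x))\<bar> \<le> 36" unfolding P_def lx(3) by (rule prime_zeta_bounds[OF d])
      moreover have "ln (1 / (c / ln x)) = ln (ln x) - ln c" using c lx by (simp add: ln_div)
      ultimately have P: "\<bar>P x - ln (ln x)\<bar> \<le> 36 + \<bar>ln c\<bar>" by linarith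
      have sq: "sqrt (L x) * sqrt (L x) = L x" "sqrt (L x) > 0" using elim by auto
      have e1: "t * L x / sqrt (L x) = L x * s x" by (simp add: s_def)
      have e2: "L x * (s x)\<^sup>2 = t\<^sup>2" unfolding s_def power2_eq_square using sq elim by (simp add: field_simps)
      have e2': "of_real (t\<^sup>2) / 2 = of_real (L x) * (of_real ((s x)\<^sup>2) / 2 :: complex)"
        by (simp only: e2[symmetric] of_real_mult) simp
      \<comment> \<open>With L = \<alpha> * ln ln x, the linear term of L * (exp (i * s) - 1)
        cancels the centring and the quadratic one is -t^2 / 2. What remains is O(1) times s, and L
        times a cubic remainder, of order 1 / sqrt L.\<close>
      have "ex x + of_real (t\<^sup>2) / 2 = of_real (\<alpha> * (P x - ln (ln x))) * (iexp (s x) - 1)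
         + of_real (L x) * (iexp (s x) - 1 - \<i> * s x + (s x)\<^sup>2 / 2)"
        unfolding ex_def e1 e2' by (simp add: L_def algebra_simps)
      also have "norm \<dots> \<le> norm (of_real (\<alpha> * (P x - ln (ln x))) * (iexp (s x) - 1))
         + norm (of_real (L x) * (iexp (s x) - 1 - \<i> * s x + (s x)\<^sup>2 / 2))" by (rule norm_triangle_ineq)
      also have "\<dots> \<le> (\<alpha> * (36 + \<bar>ln c\<bar>)) * \<bar>s x\<bar> + L x * (\<bar>s x\<bar> ^ 3 / 6)"
        unfolding norm_mult norm_of_real
        using P alpha_pos elim
        by (intro add_mono mult_mono norm_iexp_minus_1 norm_iexp_second_order) (auto simp: abs_mult)
      finally show ?case .
    qed
    show "((\<lambda>x. \<alpha> * (36 + \<bar>ln c\<bar>) * \<bar>s x\<bar> + L x * (\<bar>s x\<bar> ^ 3 / 6)) \<longlongrightarrow> 0) at_top"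
    proof -
      have sabs: "\<bar>s x\<bar> = \<bar>t\<bar> * \<bar>1 / sqrt (L x)\<bar>" for x by (simp add: s_def abs_mult[symmetric])
      have "((\<lambda>x. L x * \<bar>1 / sqrt (L x)\<bar> ^ 3) \<longlongrightarrow> 0) at_top"
        unfolding L_def using alpha_pos by real_asymp
      hence "((\<lambda>x. \<alpha> * (36 + \<bar>ln c\<bar>) * \<bar>s x\<bar> + \<bar>t\<bar> ^ 3 / 6 * (L x * \<bar>1 / sqrt (L x)\<bar> ^ 3))
          \<longlongrightarrow> \<alpha> * (36 + \<bar>ln c\<bar>) * \<bar>0\<bar> + \<bar>t\<bar> ^ 3 / 6 * 0) at_top"
        by (intro tendsto_intros slim)
      thus ?thesis unfolding sabs by (simp add: power_mult_distrib power_divide mult_ac)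
    qed
  qed
  hence exlim: "((\<lambda>x. ex x) \<longlongrightarrow> - (of_real (t\<^sup>2) / 2)) at_top"
    using tendsto_add[OF _ tendsto_const[of "- (complex_of_real (t\<^sup>2) / 2)" at_top]] by fastforce
  have "((\<lambda>x. char (D (1 + c / max 1 (ln x)) x) t - exp (ex x)) \<longlongrightarrow> 0) at_top"
  proof (rule Lim_null_comparison)
    show "\<forall>\<^sub>F x in at_top. norm (char (D (1 + c / max 1 (ln x)) x) t - exp (ex x)) \<le> \<bar>K\<bar> * \<bar>s x\<bar>"
    proof (intro always_eventually allI)
      fix x
      define \<sigma> where "\<sigma> = 1 + c / max 1 (ln x)"
      have sg: "\<sigma> > 1" using c by (simp add: \<sigma>_def)
      let ?z = "iexp (s x)"
      define u where "u = iexp (- t * L x / sqrt (L x))"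
      have u: "norm u = 1" by (simp add: u_def)
      have ch: "char (D \<sigma> x) t = u * (EZ \<sigma> ?z / of_real (E \<sigma>))"
        using char_D[OF sg, of x t] by (simp add: u_def s_def L_def)
      have "exp (ex x) = u * exp (of_real (\<alpha> * prime_zeta \<sigma>) * (?z - 1))"
        unfolding u_def exp_add[symmetric] by (simp add: ex_def P_def \<sigma>_def algebra_simps)
      hence "norm (char (D \<sigma> x) t - exp (ex x)) = norm (u * (EZ \<sigma> ?z / of_real (E \<sigma>) - exp (of_real (\<alpha> * prime_zeta \<sigma>) * (?z - 1))))"
        unfolding ch by (simp add: right_diff_distrib)
      also have "\<dots> \<le> K * norm (?z - 1)" unfolding norm_mult u using K[OF sg, of ?z] by simp
      also have "\<dots> \<le> \<bar>K\<bar> * \<bar>s x\<bar>" by (intro mult_mono norm_iexp_minus_1) auto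
      finally show "norm (char (D (1 + c / max 1 (ln x)) x) t - exp (ex x)) \<le> \<bar>K\<bar> * \<bar>s x\<bar>" unfolding \<sigma>_def .
    qed
    have "((\<lambda>x. \<bar>K\<bar> * \<bar>s x\<bar>) \<longlongrightarrow> \<bar>K\<bar> * \<bar>0\<bar>) at_top" by (intro tendsto_intros slim)
    thus "((\<lambda>x. \<bar>K\<bar> * \<bar>s x\<bar>) \<longlongrightarrow> 0) at_top" by simp
  qed
  from tendsto_add[OF this tendsto_exp[OF exlim]] show ?thesis by simp
qed

text \<open>Levy's continuity theorem speaks of sequences of distributions, so it is applied along
  an arbitrary sequence tending to infinity.\<close>

lemma expectation_tendsto_normal:
  fixes F :: "real \<Rightarrow> real"
  assumes c: "c > 0" and F: "\<And>u. isCont F u" "\<And>u. norm (F u) \<le> K"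
  shows "((\<lambda>x. integral\<^sup>L (M (1 + c / max 1 (ln x))) (\<lambda>n. F (omega_normalized \<alpha> x n)))
    \<longlongrightarrow> integral\<^sup>L std_normal_distribution F) at_top"
proof (rule tendsto_at_topI_sequentially)
  fix X :: "nat \<Rightarrow> real" assume X: "filterlim X at_top sequentially"
  define \<sigma> where "\<sigma> n = 1 + c / max 1 (ln (X n))" for n
  have sg: "\<sigma> n > 1" for n using c by (simp add: \<sigma>_def)
  have "weak_conv_m (\<lambda>n. D (\<sigma> n) (X n)) std_normal_distribution"
  proof (rule levy_continuity)
    show "real_distribution (D (\<sigma> n) (X n))" for n by (rule real_distribution_D[OF sg])
    show "real_distribution std_normal_distribution" by (rule real_dist_normal_dist)
    show "(\<lambda>n. char (D (\<sigma> n) (X n)) t) \<longlonglongrightarrow> char std_normal_distribution t" for t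
      using filterlim_compose[OF char_D_tendsto[OF c, of t] X]
      by (simp add: \<sigma>_def char_std_normal_distribution exp_of_real[symmetric])
  qed
  from weak_conv_imp_integral_bdd_continuous_conv[OF real_distribution_D[OF sg] real_dist_normal_dist this F]
  have "(\<lambda>n. integral\<^sup>L (D (\<sigma> n) (X n)) F) \<longlonglongrightarrow> integral\<^sup>L std_normal_distribution F" .
  moreover have "integral\<^sup>L (D (\<sigma> n) (X n)) F = integral\<^sup>L (M (\<sigma> n)) (\<lambda>k. F (omega_normalized \<alpha> (X n) k))" for n
    unfolding D_def using F(1)
    by (intro integral_distr borel_measurable_continuous_onI continuous_at_imp_continuous_on) auto
  ultimately show "(\<lambda>n. integral\<^sup>L (M (1 + c / max 1 (ln (X n)))) (\<lambda>k. F (omega_normalized \<alpha> (X n) k)))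
      \<longlonglongrightarrow> integral\<^sup>L std_normal_distribution F" by (simp add: \<sigma>_def)
qed

end

section \<open>Karamata's method for the logarithmic averages\<close>

text \<open>In the variable v = n powr (-1 / ln x) the cut-off n \<ge> x reads v \<le> exp (-1), and
  ln (x / n) / ln x is 1 + ln v. The kernel vanishes at the cut-off, hence is continuous and can be
  approximated by Weierstrass. Dividing by v reserves one factor v, which makes the approximation
  error summable against f n / n.\<close>

lemma kernel_polynomial_approx:
  assumes e: "\<epsilon> > 0"
  defines "r \<equiv> \<lambda>v::real. if v \<le> exp (-1) then 0 else (1 + ln v) / v"
  obtains a :: "nat \<Rightarrow> real" and N where "\<And>v. 0 \<le> v \<Longrightarrow> v \<le> 1 \<Longrightarrow> \<bar>r v - (\<Sum>i\<le>N. a i * v ^ i)\<bar> \<le> \<epsilon>"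
proof -
  have "v \<noteq> 0" if "v \<in> {exp (-1)..1}" for v :: real
    using that less_le_trans[OF exp_gt_zero[of "-1"]] by fastforce
  hence c: "continuous_on {exp (-1)..1} (\<lambda>v::real. (1 + ln v) / v)" by (intro continuous_intros) auto
  have e1: "0 = (1 + ln v) / v" if "v \<in> {exp (-1)..1}" "v \<le> exp (-1)" for v :: real
  proof -
    have "v = exp (-1)" using that by simp
    thus ?thesis by simp
  qed
  have "continuous_on ({0..exp (-1)} \<union> {exp (-1)..1}) (\<lambda>v::real. if v \<le> exp (-1) then 0 else (1 + ln v) / v)"
    by (rule continuous_on_If[OF closed_real_atLeastAtMost closed_real_atLeastAtMost continuous_on_const c _ e1]) simp_all
  moreover have "{0..exp (-1)} \<union> {exp (-1)..1} = {0..1::real}" by (intro ivl_disj_un_two_touch) simp_all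
  ultimately have "continuous_on {0..1} r" unfolding r_def by simp
  then obtain g where g: "real_polynomial_function g" "\<And>v. v \<in> {0..1} \<Longrightarrow> \<bar>r v - g v\<bar> < \<epsilon>"
    using Stone_Weierstrass_real_polynomial_function[of "{0..1}" r \<epsilon>] e by auto
  obtain a N where "g = (\<lambda>x. \<Sum>i\<le>N. a i * x ^ i)"
    using g(1) real_polynomial_function_iff_sum by blast
  hence "\<bar>r v - (\<Sum>i\<le>N. a i * v ^ i)\<bar> \<le> \<epsilon>" if "0 \<le> v" "v \<le> 1" for v
    using g(2)[of v] that by simp
  thus ?thesis by (rule that)
qed

context weight_fun
begin

lemma W_as_series:
  assumes x0: "x > 1" and x: "ln x \<ge> 1"
  defines "v \<equiv> \<lambda>n. real n powr (- 1 / ln x)"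
    and "r \<equiv> \<lambda>v::real. if v \<le> exp (-1) then 0 else (1 + ln v) / v"
  shows "(\<lambda>n. if n > 0 then f n / real n * h n * (v n * r (v n)) else 0) sums (W h x / ln x)"
proof -
  have r: "(if n > 0 then f n / real n * h n * (v n * r (v n)) else 0)
      = (if n \<in> nats_le x then f n * h n / real n * (ln (x / real n) / ln x) else 0)" for n
  proof (cases "n > 0")
    case True
    have lv: "ln (v n) = - ln (real n) / ln x" using True by (simp add: v_def ln_powr)
    have vpos: "v n > 0" using True by (simp add: v_def)
    have iff: "v n \<le> exp (-1) \<longleftrightarrow> ln (real n) \<ge> ln x"
    proof -
      have "v n \<le> exp (-1) \<longleftrightarrow> ln (v n) \<le> -1" using vpos by (metis exp_le_cancel_iff exp_ln)
      also have "\<dots> \<longleftrightarrow> ln (real n) \<ge> ln x" unfolding lv using x by (simp add: field_simps)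
      finally show ?thesis .
    qed
    have iff2: "ln (real n) \<ge> ln x \<longleftrightarrow> real n \<ge> x" using True x0 by simp
    show ?thesis
    proof (cases "real n < x")
      case less: True
      have "v n * r (v n) = 1 + ln (v n)" using less vpos iff iff2 by (simp add: r_def)
      also have "\<dots> = ln (x / real n) / ln x" unfolding lv using True x x0 by (simp add: ln_div field_simps)
      finally show ?thesis using True less by (simp add: mem_nats_le)
    next
      case False
      hence "r (v n) = 0" using iff iff2 by (simp add: r_def)
      moreover have "ln (x / real n) = 0" if "real n = x" using that x0 by simp
      ultimately show ?thesis using False True by (auto simp: mem_nats_le)
    qed
  next
    case False
    thus ?thesis by (simp add: mem_nats_le)
  qed
  have "(\<lambda>n. if n \<in> nats_le x then f n * h n / real n * (ln (x / real n) / ln x) else 0)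
      sums (\<Sum>n\<in>nats_le x. f n * h n / real n * (ln (x / real n) / ln x))"
    by (rule sums_If_finite_set) simp
  also have "(\<Sum>n\<in>nats_le x. f n * h n / real n * (ln (x / real n) / ln x)) = W h x / ln x"
    by (simp add: W_def sum_divide_distrib)
  finally show ?thesis unfolding r .
qed

text \<open>The term of degree i contributes v ^ (i + 1) / n, which is n powr -\<sigma> with
  \<sigma> = 1 + (i + 1) / ln x; so the polynomial turns the finite sum into a combination of
  expectations under the Dirichlet weights. The reserved factor v leaves the series
  \<open>E (1 + 1 / ln x)\<close> in the error.\<close>

lemma W_approx:
  assumes x0: "x > 1" and x: "ln x \<ge> 1" and h: "\<And>n. norm (h n) \<le> b" and e: "\<epsilon> \<ge> 0"
    and a: "\<And>v. 0 \<le> v \<Longrightarrow> v \<le> 1 \<Longrightarrow>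
       \<bar>(if v \<le> exp (-1) then 0 else (1 + ln v) / v) - (\<Sum>i\<le>N. a i * v ^ i)\<bar> \<le> \<epsilon>"
  shows "\<bar>W h x / ln x - (\<Sum>i\<le>N. a i * (E (1 + real (Suc i) / ln x) * integral\<^sup>L (M (1 + real (Suc i) / ln x)) h))\<bar>
    \<le> \<epsilon> * b * E (1 + 1 / ln x)"
proof -
  define \<sigma> where "\<sigma> i = 1 + real (Suc i) / ln x" for i
  have sg: "\<sigma> i > 1" for i using x by (simp add: \<sigma>_def)
  define v where "v n = real n powr (- 1 / ln x)" for n :: nat
  define r where "r v = (if v \<le> exp (-1) then 0 else (1 + ln v) / v)" for v :: real
  have b0: "b \<ge> 0" using h[of 0] norm_ge_zero[of "h 0"] by linarith
  have wv: "w (\<sigma> i) n = f n / real n * (v n * v n ^ i)" if "n > 0" for i n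
  proof -
    have "- \<sigma> i = -1 + (- 1 / ln x) * real (Suc i)" by (simp add: \<sigma>_def)
    hence "real n powr (- \<sigma> i) = real n powr (-1) * (real n powr (- 1 / ln x)) powr real (Suc i)"
      by (simp only: powr_add powr_powr)
    also have "\<dots> = 1 / real n * v n ^ Suc i"
      using that by (subst powr_realpow) (auto simp: v_def powr_minus_divide)
    finally show ?thesis by (simp add: w_def)
  qed
  have v01: "0 \<le> v n" "v n \<le> 1" if "n > 0" for n
  proof -
    have "real n powr (- 1 / ln x) \<le> real n powr 0" using that x by (intro powr_mono) auto
    thus "v n \<le> 1" using that by (simp add: v_def)
  qed (simp add: v_def)
  have s1: "(\<lambda>n. if n > 0 then f n / real n * h n * (v n * r (v n)) else 0) sums (W h x / ln x)"
    unfolding v_def r_def by (rule W_as_series[OF x0 x])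
  have s2: "(\<lambda>n. \<Sum>i\<le>N. a i * (E (\<sigma> i) * (pw (\<sigma> i) n *\<^sub>R h n))) sums (\<Sum>i\<le>N. a i * (E (\<sigma> i) * integral\<^sup>L (M (\<sigma> i)) h))"
    by (intro sums_sum sums_mult integral_M[OF sg h])
  have s3: "(\<lambda>n. \<epsilon> * b * (if n > 0 then w (\<sigma> 0) n else 0)) sums (\<epsilon> * b * E (\<sigma> 0))"
    by (intro sums_mult sums_of_has_sum_positive has_sum_w sg)
  have "norm (W h x / ln x - (\<Sum>i\<le>N. a i * (E (\<sigma> i) * integral\<^sup>L (M (\<sigma> i)) h))) \<le> \<epsilon> * b * E (\<sigma> 0)"
  proof (rule norm_sums_le[OF sums_diff[OF s1 s2] s3])
    fix n
    show "norm ((if n > 0 then f n / real n * h n * (v n * r (v n)) else 0) - (\<Sum>i\<le>N. a i * (E (\<sigma> i) * (pw (\<sigma> i) n *\<^sub>R h n))))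
        \<le> \<epsilon> * b * (if n > 0 then w (\<sigma> 0) n else 0)"
    proof (cases "n > 0")
      case True
      have fn: "f n / real n * v n \<ge> 0" using True v01[OF True] f_nonneg[of n] by simp
      have "(\<Sum>i\<le>N. a i * (E (\<sigma> i) * (pw (\<sigma> i) n *\<^sub>R h n))) = (\<Sum>i\<le>N. f n / real n * v n * h n * (a i * v n ^ i))"
      proof (intro sum.cong refl)
        fix i
        have "E (\<sigma> i) * (pw (\<sigma> i) n *\<^sub>R h n) = w (\<sigma> i) n * h n" using E_pos[OF sg[of i]] True by (simp add: pw_def)
        thus "a i * (E (\<sigma> i) * (pw (\<sigma> i) n *\<^sub>R h n)) = f n / real n * v n * h n * (a i * v n ^ i)"
          using wv[OF True, of i] by (simp add: mult_ac)
      qed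
      also have "\<dots> = f n / real n * v n * h n * (\<Sum>i\<le>N. a i * v n ^ i)" by (rule sum_distrib_left[symmetric])
      finally have "(if n > 0 then f n / real n * h n * (v n * r (v n)) else 0) - (\<Sum>i\<le>N. a i * (E (\<sigma> i) * (pw (\<sigma> i) n *\<^sub>R h n)))
          = f n / real n * v n * (h n * (r (v n) - (\<Sum>i\<le>N. a i * v n ^ i)))"
        using True by (simp add: algebra_simps)
      also have "norm \<dots> = f n / real n * v n * (norm (h n) * \<bar>r (v n) - (\<Sum>i\<le>N. a i * v n ^ i)\<bar>)"
        unfolding norm_mult[of "f n / real n * v n"] real_norm_def[of "f n / real n * v n"] abs_of_nonneg[OF fn]
          by (simp add: abs_mult)
      also have "\<dots> \<le> f n / real n * v n * (b * \<epsilon>)"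
        using fn b0 a[OF v01[OF True]] unfolding r_def by (intro mult_left_mono[OF mult_mono[OF h]]) auto
      also have "\<dots> = \<epsilon> * b * w (\<sigma> 0) n" using wv[OF True, of 0] by simp
      finally show ?thesis using True by simp
    qed (simp add: pw_def)
  qed
  thus ?thesis by (simp add: \<sigma>_def)
qed

text \<open>Each of the finitely many expectations tends to 0 by the central limit theorem, because
  F is centred by its Gaussian mean, and each series E involved is O(lp x).\<close>

proposition W_small:
  fixes F :: "real \<Rightarrow> real"
  assumes F: "\<And>u. isCont F u" "\<And>u. norm (F u) \<le> K"
  defines "m \<equiv> integral\<^sup>L std_normal_distribution F"
  defines "H \<equiv> \<lambda>x n. F (omega_normalized \<alpha> x n) - m"
  shows "((\<lambda>x. \<bar>W (H x) x\<bar> / (ell x * lp x)) \<longlongrightarrow> 0) at_top"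
proof (rule tendstoI)
  fix e :: real assume e: "e > 0"
  obtain c C where C: "C > 0" "\<And>\<delta>. 0 < \<delta> \<Longrightarrow> \<delta> \<le> 1 \<Longrightarrow> E (1 + \<delta>) \<le> C * \<delta> powr (-\<alpha>)"
    using E_bounds by metis
  define b where "b = \<bar>K\<bar> + \<bar>m\<bar> + 1"
  have b: "b > 0" by (simp add: b_def)
  have Hb: "norm (H x n) \<le> b" for x n
  proof -
    have "norm (H x n) \<le> \<bar>F (omega_normalized \<alpha> x n)\<bar> + \<bar>m\<bar>" unfolding H_def by simp
    thus ?thesis using F(2)[of "omega_normalized \<alpha> x n"] by (simp add: b_def)
  qed
  \<comment> \<open>Half of e pays for the polynomial approximation, whose error is \<epsilon> * b *
    C * lp x; the other half is left for the expectations.\<close>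
  define \<epsilon> where "\<epsilon> = e / (2 * b * C)"
  have eps: "\<epsilon> > 0" using e b C(1) by (simp add: \<epsilon>_def)
  obtain a :: "nat \<Rightarrow> real" and N where a: "\<And>v. 0 \<le> v \<Longrightarrow> v \<le> 1 \<Longrightarrow>
       \<bar>(if v \<le> exp (-1) then 0 else (1 + ln v) / v) - (\<Sum>i\<le>N. a i * v ^ i)\<bar> \<le> \<epsilon>"
    using kernel_polynomial_approx[OF eps] by blast
  define J where "J i x = integral\<^sup>L (M (1 + real (Suc i) / max 1 (ln x))) (H x)" for i x
  have J: "((\<lambda>x. J i x) \<longlongrightarrow> 0) at_top" for i
  proof -
    define \<sigma> where "\<sigma> x = 1 + real (Suc i) / max 1 (ln x)" for x
    have sg: "\<sigma> x > 1" for x unfolding \<sigma>_def by simp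
    have "J i x = integral\<^sup>L (M (\<sigma> x)) (\<lambda>n. F (omega_normalized \<alpha> x n)) - m" for x
    proof -
      interpret prob_space "M (\<sigma> x)" by (rule prob_space_M[OF sg])
      have "integrable (M (\<sigma> x)) (\<lambda>n. F (omega_normalized \<alpha> x n))"
        by (rule integrable_const_bound[where B = K]) (use F(2) in auto)
      thus ?thesis unfolding J_def H_def \<sigma>_def[symmetric]
        using prob_space[unfolded space_M] by simp
    qed
    moreover have "((\<lambda>x. integral\<^sup>L (M (\<sigma> x)) (\<lambda>n. F (omega_normalized \<alpha> x n)) - m) \<longlongrightarrow> m - m) at_top"
      unfolding \<sigma>_def m_def by (intro tendsto_diff tendsto_const expectation_tendsto_normal[OF _ F]) simp
    ultimately show ?thesis by simp
  qed
  have "((\<lambda>x. C * (\<Sum>i\<le>N. \<bar>a i\<bar> * \<bar>J i x\<bar>)) \<longlongrightarrow> C * (\<Sum>i\<le>N. \<bar>a i\<bar> * \<bar>0\<bar>)) at_top"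
    by (intro tendsto_intros J)
  hence "\<forall>\<^sub>F x in at_top. C * (\<Sum>i\<le>N. \<bar>a i\<bar> * \<bar>J i x\<bar>) < e / 2"
    using e by (intro order_tendstoD(2)) auto
  moreover have "\<forall>\<^sub>F x in at_top. ln x \<ge> real (Suc N)" by real_asymp
  moreover have "\<forall>\<^sub>F x in at_top. x > (1::real)" by (rule eventually_gt_at_top)
  ultimately show "\<forall>\<^sub>F x in at_top. dist (\<bar>W (H x) x\<bar> / (ell x * lp x)) 0 < e"
  proof eventually_elim
    case (elim x)
    have lx: "ln x \<ge> 1" "max 1 (ln x) = ln x" using elim by auto
    have x0: "x > 1" and x1: "x \<ge> 1" using elim(3) by auto
    have L: "lp x \<ge> 1" "ell x \<ge> 1" "ln x \<le> ell x" using lp_ge_1[OF x1] ell_ge_1[OF x1] by (auto simp: ell_def)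
    have Eb: "E (1 + real (Suc i) / ln x) \<le> C * lp x" if "i \<le> N" for i
    proof -
      have d: "0 < real (Suc i) / ln x" "real (Suc i) / ln x \<le> 1" using lx elim(2) that by auto
      have "E (1 + real (Suc i) / ln x) \<le> C * (real (Suc i) / ln x) powr (-\<alpha>)" by (rule C(2)[OF d])
      also have "(real (Suc i) / ln x) powr (-\<alpha>) = (ln x / real (Suc i)) powr \<alpha>"
        using lx by (simp add: powr_minus_divide powr_divide)
      also have "\<dots> \<le> lp x" unfolding lp_def
      proof (rule powr_mono2)
        have "ln x / real (Suc i) \<le> ln x / 1" using lx by (intro divide_left_mono) auto
        thus "ln x / real (Suc i) \<le> ell x" using L by simp
      qed (use alpha_pos lx in auto)
      finally show ?thesis using C(1) by simp
    qed
    have E0: "E (1 + real (Suc i) / ln x) \<ge> 0" for i using E_pos[of "1 + real (Suc i) / ln x"] lx by simp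
    have "\<bar>W (H x) x / ln x\<bar> \<le> \<bar>W (H x) x / ln x - (\<Sum>i\<le>N. a i * (E (1 + real (Suc i) / ln x) * J i x))\<bar>
        + \<bar>\<Sum>i\<le>N. a i * (E (1 + real (Suc i) / ln x) * J i x)\<bar>" by linarith
    also have "\<bar>W (H x) x / ln x - (\<Sum>i\<le>N. a i * (E (1 + real (Suc i) / ln x) * J i x))\<bar> \<le> \<epsilon> * b * E (1 + 1 / ln x)"
      unfolding J_def lx(2) by (rule W_approx[OF x0 lx(1) Hb _ a]) (use eps in auto)
    also have "\<dots> \<le> \<epsilon> * b * (C * lp x)" using Eb[of 0] eps b by (intro mult_left_mono) auto
    also have "\<bar>\<Sum>i\<le>N. a i * (E (1 + real (Suc i) / ln x) * J i x)\<bar> \<le> (\<Sum>i\<le>N. \<bar>a i\<bar> * (C * lp x * \<bar>J i x\<bar>))"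
    proof (intro order_trans[OF sum_abs] sum_mono)
      fix i assume "i \<in> {..N}"
      hence "E (1 + real (Suc i) / ln x) * \<bar>J i x\<bar> \<le> C * lp x * \<bar>J i x\<bar>" using Eb[of i] by (intro mult_right_mono) auto
      thus "\<bar>a i * (E (1 + real (Suc i) / ln x) * J i x)\<bar> \<le> \<bar>a i\<bar> * (C * lp x * \<bar>J i x\<bar>)"
        using E0[of i] by (simp add: abs_mult mult_left_mono)
    qed
    also have "\<dots> = lp x * (C * (\<Sum>i\<le>N. \<bar>a i\<bar> * \<bar>J i x\<bar>))" by (simp add: sum_distrib_left mult_ac)
    also have "\<epsilon> * b * (C * lp x) = lp x * (e / 2)" using b C(1) by (simp add: \<epsilon>_def)
    finally have "\<bar>W (H x) x / ln x\<bar> \<le> lp x * (e / 2) + lp x * (C * (\<Sum>i\<le>N. \<bar>a i\<bar> * \<bar>J i x\<bar>))" by simp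
    also have "\<dots> < lp x * (e / 2) + lp x * (e / 2)" using elim(1) L by (intro add_strict_left_mono mult_strict_left_mono) auto
    finally have "\<bar>W (H x) x\<bar> / ln x < lp x * e" using lx by (simp add: abs_divide mult.commute)
    hence "\<bar>W (H x) x\<bar> < lp x * e * ln x" using lx by (simp add: divide_less_eq)
    also have "\<dots> \<le> lp x * e * ell x" using L e by (intro mult_left_mono) auto
    finally have "\<bar>W (H x) x\<bar> / (ell x * lp x) < e" using L by (simp add: divide_less_eq mult_ac)
    thus ?case using L by simp
  qed
qed

end

section \<open>The largest prime factor\<close>

lemma prime_factors_le_largest: "n \<ge> 1 \<Longrightarrow> p \<in> prime_factors n \<Longrightarrow> p \<le> largest_prime_factor n"
  by (cases "n = 1") (auto simp: largest_prime_factor_def)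

lemma largest_prime_factor_in: "n > 1 \<Longrightarrow> largest_prime_factor n \<in> prime_factors n"
proof -
  assume n: "n > 1"
  then obtain p where "prime p" "p dvd n" using prime_factor_nat[of n] by auto
  hence "prime_factors n \<noteq> {}" using n by (auto simp: prime_factors_dvd)
  thus ?thesis using n Max_in[of "prime_factors n"] by (simp add: largest_prime_factor_def)
qed

lemma largest_prime_factor_le_iff:
  assumes "n \<ge> 1" "k \<ge> 1"
  shows "largest_prime_factor n \<le> k \<longleftrightarrow> (\<forall>p\<in>prime_factors n. p \<le> k)"
proof (cases "n = 1")
  case True
  thus ?thesis using assms by (simp add: largest_prime_factor_def)
next
  case False
  hence n: "n > 1" using assms by simp
  show ?thesis using largest_prime_factor_in[OF n] prime_factors_le_largest[OF assms(1)] by (meson order_trans)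
qed

lemma largest_prime_factor_ge_1: "largest_prime_factor n \<ge> 1"
proof (cases "n > 1")
  case True
  hence "prime (largest_prime_factor n)" using largest_prime_factor_in[of n] by (auto simp: prime_factors_dvd)
  thus ?thesis by (rule prime_ge_1_nat)
qed (simp add: largest_prime_factor_def)

lemma prime_largest_prime_factor: "n > 1 \<Longrightarrow> prime (largest_prime_factor n)"
  using largest_prime_factor_in by (auto simp: prime_factors_dvd)

lemma largest_prime_factor_dvd: "n > 1 \<Longrightarrow> largest_prime_factor n dvd n"
  using largest_prime_factor_in[of n] by (auto simp: prime_factors_dvd)

lemma largest_prime_factor_prime_times:
  assumes p: "prime p" and m: "m \<ge> 1" and less: "largest_prime_factor m < p"
  shows "largest_prime_factor (p * m) = p" "\<not> p dvd m"
proof -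
  have "prime_factors (p * m) = insert p (prime_factors m)"
    using p m by (subst prime_factors_product) (auto simp: prime_prime_factors)
  moreover have "\<forall>q\<in>prime_factors m. q \<le> p"
    using prime_factors_le_largest[OF m] less by fastforce
  moreover have "p * m > 1" using prime_gt_1_nat[OF p] m by (metis less_1_mult mult.right_neutral nat_less_le)
  ultimately show "largest_prime_factor (p * m) = p"
    by (auto simp: largest_prime_factor_def intro!: Max_eqI)
  show "\<not> p dvd m"
  proof
    assume "p dvd m"
    hence "p \<in> prime_factors m" using p m by (auto simp: prime_factors_dvd)
    thus False using prime_factors_le_largest[OF m] less by fastforce
  qed
qed

lemma largest_prime_factor_cofactor:
  assumes n: "n > 1" and sq: "\<not> largest_prime_factor n ^ 2 dvd n"
  obtains m where "n = largest_prime_factor n * m" "m \<ge> 1" "largest_prime_factor m < largest_prime_factor n"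
proof -
  let ?p = "largest_prime_factor n"
  obtain m where m: "n = ?p * m" using largest_prime_factor_dvd[OF n] by (elim dvdE)
  have m1: "m \<ge> 1" using m n by (cases m) auto
  have p: "prime ?p" by (rule prime_largest_prime_factor[OF n])
  have ndvd: "\<not> ?p dvd m"
  proof
    assume "?p dvd m"
    hence "?p * ?p dvd ?p * m" by (rule mult_dvd_mono[OF dvd_refl])
    thus False using sq m by (simp add: power2_eq_square)
  qed
  have "largest_prime_factor m < ?p"
  proof (cases "m = 1")
    case True
    thus ?thesis using prime_gt_1_nat[OF p] by (simp add: largest_prime_factor_def)
  next
    case False
    hence m2: "m > 1" using m1 by simp
    have "largest_prime_factor m dvd m" by (rule largest_prime_factor_dvd[OF m2])
    hence "largest_prime_factor m dvd n" using m by (metis dvd_mult)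
    hence "largest_prime_factor m \<in> prime_factors n"
      using prime_largest_prime_factor[OF m2] n by (auto simp: prime_factors_dvd)
    hence "largest_prime_factor m \<le> ?p" using n by (intro prime_factors_le_largest) auto
    moreover have "largest_prime_factor m \<noteq> ?p" using ndvd largest_prime_factor_dvd[OF m2] by auto
    ultimately show ?thesis by simp
  qed
  with m m1 show ?thesis using that by blast
qed

section \<open>Counting primes\<close>

definition primes_le :: "real \<Rightarrow> nat set" where
  "primes_le x = {p. prime p \<and> real p \<le> x}"

lemma primes_le_subset: "primes_le x \<subseteq> nats_le x"
proof
  fix p assume "p \<in> primes_le x"
  thus "p \<in> nats_le x" using prime_ge_1_nat[of p] by (simp add: primes_le_def mem_nats_le)
qed

lemma finite_primes_le [simp, intro]: "finite (primes_le x)"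
  by (rule finite_subset[OF primes_le_subset]) simp

lemma primes_le_mono: "x \<le> y \<Longrightarrow> primes_le x \<subseteq> primes_le y"
  by (auto simp: primes_le_def)

definition prime_pi :: "real \<Rightarrow> real" where
  "prime_pi x = real (card (primes_le x))"

lemma prime_pi_mono: "x \<le> y \<Longrightarrow> prime_pi x \<le> prime_pi y"
  unfolding prime_pi_def using primes_le_mono by (auto intro!: card_mono)

text \<open>Primes above sqrt x carry weight at least ln x / 2 in \<open>psi x\<close>, which gives
  16 * x / ln x; those below number at most sqrt x, hence at most 2 * x / ln x.\<close>

lemma prime_pi_upper:
  assumes x: "x > 1"
  shows "prime_pi x \<le> 18 * (x / ln x)"
proof -
  have lx: "ln x > 0" using x by simp
  have s1: "1 \<le> sqrt x" "sqrt x \<le> x" using x real_le_lsqrt[of x x] by (auto simp: power2_eq_square)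
  have sub: "primes_le (sqrt x) \<subseteq> primes_le x" using s1 by (intro primes_le_mono)
  have "real (card (primes_le (sqrt x))) \<le> real (card (nats_le (sqrt x)))"
    using card_mono[OF finite_nats_le primes_le_subset] by simp
  also have "\<dots> \<le> sqrt x" using s1 by (subst card_nats_le) auto
  finally have 1: "real (card (primes_le (sqrt x))) \<le> sqrt x" .
  have "ln x / 2 * real (card (primes_le x - primes_le (sqrt x))) = (\<Sum>p\<in>primes_le x - primes_le (sqrt x). ln x / 2)"
    by simp
  also have "\<dots> \<le> (\<Sum>p\<in>primes_le x - primes_le (sqrt x). mangoldt p)"
  proof (rule sum_mono)
    fix p assume "p \<in> primes_le x - primes_le (sqrt x)"
    hence p: "prime p" "real p > sqrt x" by (auto simp: primes_le_def)
    have "ln x / 2 = ln (sqrt x)" using x by (simp add: ln_sqrt)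
    also have "\<dots> \<le> ln (real p)" using p s1 by (subst ln_le_cancel_iff) linarith+
    finally show "ln x / 2 \<le> mangoldt p" using p by simp
  qed
  also have "\<dots> \<le> psi x" unfolding psi_def
    using primes_le_subset mangoldt_nonneg by (intro sum_mono2) auto
  also have "\<dots> \<le> 8 * x" using x by (intro psi_le) auto
  finally have 2: "real (card (primes_le x - primes_le (sqrt x))) \<le> 16 * (x / ln x)" using lx by (simp add: field_simps)
  have "ln x \<le> 2 * sqrt x" using ln_powr_bound[of x "1/2"] x by (simp add: powr_half_sqrt)
  hence "ln x * sqrt x \<le> 2 * sqrt x * sqrt x" using s1 by (intro mult_right_mono) auto
  moreover have "2 * sqrt x * sqrt x = 2 * x" using x by (simp add: mult.assoc)
  ultimately have "sqrt x * ln x \<le> 2 * x" by (simp only: mult.commute[of "sqrt x" "ln x"])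
  hence "sqrt x \<le> 2 * x / ln x" using lx by (subst pos_le_divide_eq)
  hence 3: "sqrt x \<le> 2 * (x / ln x)" by simp
  have "prime_pi x = real (card (primes_le (sqrt x))) + real (card (primes_le x - primes_le (sqrt x)))"
    unfolding prime_pi_def using sub by (simp add: card_Diff_subset card_mono of_nat_diff)
  thus ?thesis using 1 2 3 by linarith
qed

text \<open>The counting function of S minus its expected size, written as a sum over primes so that
  a window of primes is a difference of two such values.\<close>

definition density_error :: "nat set \<Rightarrow> real \<Rightarrow> real \<Rightarrow> real" where
  "density_error S \<delta> x = (\<Sum>p\<in>primes_le x. (if p \<in> S then 1 else 0) - \<delta>)"

lemma density_error_small:
  assumes S: "S \<subseteq> {p. prime p}" and d: "has_natural_density S \<delta>" and e: "\<epsilon> > 0"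
  shows "\<forall>\<^sub>F x in at_top. \<bar>density_error S \<delta> x\<bar> \<le> \<epsilon> * prime_pi x"
proof -
  have "\<forall>\<^sub>F x::real in at_top. dist (real (card {p \<in> S. real p \<le> x}) / real (card {p::nat. prime p \<and> real p \<le> x})) \<delta> < \<epsilon>"
    using d e unfolding has_natural_density_def by (rule tendstoD)
  thus ?thesis using eventually_ge_at_top[of "2::real"]
  proof eventually_elim
    case (elim x)
    have "2 \<in> primes_le x" using elim(2) by (simp add: primes_le_def two_is_prime_nat)
    hence pos: "prime_pi x > 0" unfolding prime_pi_def by (auto simp: card_gt_0_iff)
    have "(\<Sum>p\<in>primes_le x. if p \<in> S then 1 else 0 :: real) = real (card (primes_le x \<inter> S))"
      by (simp add: sum.If_cases)
    also have "primes_le x \<inter> S = {p \<in> S. real p \<le> x}" using S by (auto simp: primes_le_def)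
    finally have eq: "density_error S \<delta> x = real (card {p \<in> S. real p \<le> x}) - \<delta> * prime_pi x"
      by (simp add: density_error_def sum_subtractf prime_pi_def)
    have "\<bar>real (card {p \<in> S. real p \<le> x}) / prime_pi x - \<delta>\<bar> < \<epsilon>"
      using elim(1) by (simp add: dist_real_def prime_pi_def primes_le_def)
    hence "\<bar>real (card {p \<in> S. real p \<le> x}) / prime_pi x - \<delta>\<bar> * prime_pi x \<le> \<epsilon> * prime_pi x"
      using pos by (intro mult_right_mono) auto
    moreover have "(real (card {p \<in> S. real p \<le> x}) / prime_pi x - \<delta>) * prime_pi x = density_error S \<delta> x"
      unfolding eq using pos by (simp add: left_diff_distrib)
    hence "\<bar>real (card {p \<in> S. real p \<le> x}) / prime_pi x - \<delta>\<bar> * prime_pi x = \<bar>density_error S \<delta> x\<bar>"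
      using pos abs_mult[of "real (card {p \<in> S. real p \<le> x}) / prime_pi x - \<delta>" "prime_pi x"] by (simp only: abs_of_pos)
    ultimately show ?case by simp
  qed
qed

section \<open>Smooth numbers, repeated largest primes, and the rough remainder\<close>

context weight_fun
begin

lemma prime_zeta_upto_le_limit: "\<sigma> > 1 \<Longrightarrow> prime_zeta_upto \<sigma> N \<le> prime_zeta \<sigma>"
proof -
  assume s: "\<sigma> > 1"
  have "incseq (prime_zeta_upto \<sigma>)"
    unfolding prime_zeta_upto_def by (intro monoI sum_mono2) (auto simp: primes_upto_def)
  thus ?thesis by (rule incseq_le[OF _ prime_zeta_LIMSEQ[OF s]])
qed

text \<open>The sum of 1 / p is compared with the prime zeta sum at 1 + \<delta>, \<delta> = 1 /
  \<open>ell y\<close>. The difference is at most \<delta> times the sum of ln p / p, hence at most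
  9 by Mertens; the prime zeta function itself is ln (ell y) + O(1).\<close>

lemma sum_inverse_primes_le:
  assumes y: "y \<ge> 1" and N: "N = nat \<lfloor>y\<rfloor>"
  shows "prime_zeta_upto 1 N \<le> ln (ell y) + 46"
proof -
  define \<delta> where "\<delta> = 1 / ell y"
  have d: "0 < \<delta>" "\<delta> \<le> 1" using ell_ge_1[OF y] by (auto simp: \<delta>_def)
  have set: "primes_upto N \<subseteq> nats_le y" using primes_upto_subset by (simp add: N nats_le_eq)
  have "prime_zeta_upto 1 N - prime_zeta_upto (1 + \<delta>) N = (\<Sum>p\<in>primes_upto N. real p powr (-1) - real p powr (- (1 + \<delta>)))"
    by (simp add: prime_zeta_upto_def sum_subtractf)
  also have "\<dots> \<le> (\<Sum>p\<in>primes_upto N. \<delta> * (mangoldt p / real p))"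
  proof (rule sum_mono)
    fix p assume p: "p \<in> primes_upto N"
    have pr: "prime p" by (rule prime_of_primes_upto[OF p])
    have p1: "real p \<ge> 1" using prime_ge_1_nat[OF pr] by simp
    have "real p powr (- (1 + \<delta>)) = real p powr (-1) * real p powr (-\<delta>)" 
      by (simp only: powr_add[symmetric] minus_add_distrib)
    hence "real p powr (-1) - real p powr (- (1 + \<delta>)) = (1 - real p powr (-\<delta>)) / real p"
      using p1 by (simp add: powr_minus_divide field_simps)
    also have "1 - real p powr (-\<delta>) \<le> \<delta> * ln (real p)"
      using exp_ge_add_one_self[of "-\<delta> * ln (real p)"] p1 by (simp add: powr_def)
    finally show "real p powr (-1) - real p powr (- (1 + \<delta>)) \<le> \<delta> * (mangoldt p / real p)"
      using p1 pr by (simp add: divide_right_mono)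
  qed
  also have "\<dots> = \<delta> * (\<Sum>p\<in>primes_upto N. mangoldt p / real p)" by (simp add: sum_distrib_left)
  also have "(\<Sum>p\<in>primes_upto N. mangoldt p / real p) \<le> (\<Sum>d\<in>nats_le y. mangoldt d / real d)"
    using set mangoldt_nonneg by (intro sum_mono2) auto
  also have "\<dots> \<le> ln y + 9" using Mertens_mangoldt[OF y] by linarith
  also have "\<dots> \<le> 9 * ell y" using ln_ge_zero[OF y] by (simp add: ell_def)
  finally have 1: "prime_zeta_upto 1 N - prime_zeta_upto (1 + \<delta>) N \<le> \<delta> * (9 * ell y)" using d by simp
  have "\<delta> * (9 * ell y) = 9" using ell_ge_1[OF y] by (simp add: \<delta>_def)
  moreover have "prime_zeta_upto (1 + \<delta>) N \<le> prime_zeta (1 + \<delta>)" using d by (intro prime_zeta_upto_le_limit) auto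
  moreover have "prime_zeta (1 + \<delta>) \<le> ln (1 / \<delta>) + 36" using prime_zeta_bounds[OF d] by linarith
  ultimately show ?thesis using 1 by (simp add: \<delta>_def)
qed

text \<open>The Euler product at \<sigma> = 1 over the primes up to y majorises the sum, uniformly
  in x.\<close>

lemma smooth_A_le: "\<exists>C>0. \<forall>x y. y \<ge> 1 \<longrightarrow>
    (\<Sum>m\<in>{m\<in>nats_le x. real (largest_prime_factor m) \<le> y}. f m / real m) \<le> C * lp y"
proof -
  define C where "C = exp (46 * \<alpha> + 18 * B)"
  have "(\<Sum>m\<in>{m\<in>nats_le x. real (largest_prime_factor m) \<le> y}. f m / real m) \<le> C * lp y" if y: "y \<ge> 1" for x y
  proof -
    define N where "N = nat \<lfloor>y\<rfloor>"
    have N1: "N \<ge> 1" using y by (simp add: N_def le_nat_floor)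
    let ?F = "{m\<in>nats_le x. real (largest_prime_factor m) \<le> y}"
    have "(\<Sum>m\<in>?F. f m / real m) = (\<Sum>m\<in>?F. w 1 m)"
      by (intro sum.cong refl) (auto simp: w_def mem_nats_le powr_minus_divide)
    also have "\<dots> \<le> (\<Prod>p\<in>primes_upto N. Rfac 1 p)"
    proof (rule sum_w_le_prod)
      show "?F \<subseteq> smooth_numbers (primes_upto N)"
      proof
        fix m assume m: "m \<in> ?F"
        hence m1: "m \<ge> 1" and "largest_prime_factor m \<le> N" by (auto simp: mem_nats_le N_def le_nat_floor)
        hence "\<forall>p\<in>prime_factors m. p \<le> N" using largest_prime_factor_le_iff[OF m1 N1] by simp
        thus "m \<in> smooth_numbers (primes_upto N)"
          using m1 by (auto simp: smooth_numbers_def primes_upto_def prime_factors_dvd)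
      qed
    qed auto
    also have "\<dots> \<le> exp (\<alpha> * prime_zeta_upto 1 N + 18 * B)" by (rule prod_Rfac_bounds(2)) simp
    also have "\<dots> \<le> exp (\<alpha> * (ln (ell y) + 46) + 18 * B)"
      using sum_inverse_primes_le[OF y N_def] alpha_pos by simp
    also have "\<dots> = C * lp y"
      using ell_ge_1[OF y] by (simp add: C_def lp_def powr_def exp_add[symmetric] algebra_simps)
    finally show ?thesis .
  qed
  thus ?thesis by (intro exI[of _ C]) (auto simp: C_def)
qed

text \<open>The argument for the upper bound of S, run with the indicator of y-smooth numbers;
  divisors of smooth numbers are smooth, so the logarithmic sum that appears is again over smooth
  numbers and has size \<open>lp y\<close>.\<close>

lemma smooth_S_le: "\<exists>C>0. \<forall>x y. x \<ge> 1 \<longrightarrow> y \<ge> 1 \<longrightarrow>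
    (\<Sum>n\<in>{n\<in>nats_le x. real (largest_prime_factor n) \<le> y}. f n) * ln x \<le> C * (x * (lp x / ell x) + x * lp y)"
proof -
  obtain C1 where C1: "C1 > 0" "\<And>x. x \<ge> 1 \<Longrightarrow> Err x \<le> C1 * (x * (lp x / ell x))" using Err_bound by blast
  obtain C2 where C2: "C2 > 0" "\<And>x. x \<ge> 1 \<Longrightarrow> (\<Sum>n\<in>nats_le x. f n * ln (x / real n)) \<le> C2 * (x * (lp x / ell x))"
    using sum_f_ln_div_bound by blast
  obtain C3 where C3: "C3 > 0" "\<And>x y. y \<ge> 1 \<Longrightarrow>
    (\<Sum>m\<in>{m\<in>nats_le x. real (largest_prime_factor m) \<le> y}. f m / real m) \<le> C3 * lp y" using smooth_A_le by blast
  define C where "C = C1 + C2 + 8 * \<alpha> * C3"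
  have "(\<Sum>n\<in>{n\<in>nats_le x. real (largest_prime_factor n) \<le> y}. f n) * ln x \<le> C * (x * (lp x / ell x) + x * lp y)"
    if x: "x \<ge> 1" and y: "y \<ge> 1" for x y
  proof -
    define h where "h = (\<lambda>n. if real (largest_prime_factor n) \<le> y then 1 else 0 :: real)"
    have "(\<Sum>n\<in>{n\<in>nats_le x. real (largest_prime_factor n) \<le> y}. f n) = Sh h x"
      unfolding Sh_def h_def by (intro sum.mono_neutral_cong_left) auto
    hence "(\<Sum>n\<in>{n\<in>nats_le x. real (largest_prime_factor n) \<le> y}. f n) * ln x = (\<Sum>n\<in>nats_le x. f n * h n * ln (x / real n))
     + (\<Sum>d\<in>nats_le x. \<Sum>m\<in>nats_le (x / real d). mangoldt d * (f (d * m) * h (d * m)))"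
      using Sh_ln_eq[OF x, of h] by simp
    also have "(\<Sum>n\<in>nats_le x. f n * h n * ln (x / real n)) \<le> (\<Sum>n\<in>nats_le x. f n * ln (x / real n))"
    proof (rule sum_mono)
      fix n assume n: "n \<in> nats_le x"
      have "f n * ln (x / real n) \<ge> 0" using f_nonneg'[OF n] nats_le_divI[OF n] by simp
      thus "f n * h n * ln (x / real n) \<le> f n * ln (x / real n)" by (simp add: h_def)
    qed
    also have "\<dots> \<le> C2 * (x * (lp x / ell x))" by (rule C2(2)[OF x])
    also have "(\<Sum>d\<in>nats_le x. \<Sum>m\<in>nats_le (x / real d). mangoldt d * (f (d * m) * h (d * m)))
        \<le> Err x + \<alpha> * (\<Sum>m\<in>nats_le x. f m * h m * psi (x / real m))"
    proof (rule good_sum_le)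
      fix p m :: nat assume p: "prime p" and m: "m \<ge> 1"
      have pm: "p * m \<ge> 1" using p m by (simp add: prime_gt_0_nat Suc_le_eq)
      have "largest_prime_factor m \<le> largest_prime_factor (p * m)"
        unfolding largest_prime_factor_le_iff[OF m largest_prime_factor_ge_1]
        using pm by (auto simp: prime_factors_dvd intro!: prime_factors_le_largest)
      thus "h (p * m) \<le> h m" by (auto simp: h_def)
    qed (auto simp: h_def)
    also have "(\<Sum>m\<in>nats_le x. f m * h m * psi (x / real m)) \<le> 8 * x * (C3 * lp y)"
    proof -
      have "(\<Sum>m\<in>nats_le x. f m * h m * psi (x / real m)) \<le> (\<Sum>m\<in>nats_le x. f m * h m * (8 * (x / real m)))"
        using x by (intro sum_mono mult_left_mono psi_le mult_nonneg_nonneg f_nonneg'[of _ x]) (auto simp: h_def)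
      also have "\<dots> = 8 * x * (\<Sum>m\<in>nats_le x. f m * h m / real m)" by (simp add: sum_distrib_left mult_ac)
      also have "(\<Sum>m\<in>nats_le x. f m * h m / real m) = (\<Sum>m\<in>{m\<in>nats_le x. real (largest_prime_factor m) \<le> y}. f m / real m)"
        unfolding h_def by (intro sum.mono_neutral_cong_right) auto
      also have "\<dots> \<le> C3 * lp y" by (rule C3(2)[OF y])
      finally show ?thesis using x by (simp add: mult_left_mono)
    qed
    also have "Err x \<le> C1 * (x * (lp x / ell x))" by (rule C1(2)[OF x])
    finally have "(\<Sum>n\<in>{n\<in>nats_le x. real (largest_prime_factor n) \<le> y}. f n) * ln x
        \<le> C2 * (x * (lp x / ell x)) + (C1 * (x * (lp x / ell x)) + \<alpha> * (8 * x * (C3 * lp y)))"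
      using alpha_pos by (simp add: mult_left_mono)
    also have "\<dots> = (C1 + C2) * (x * (lp x / ell x)) + 8 * \<alpha> * C3 * (x * lp y)"
      by (simp add: algebra_simps add_divide_distrib)
    also have "\<dots> \<le> C * (x * (lp x / ell x)) + C * (x * lp y)"
      using x lp_ge_1[OF x] lp_ge_1[OF y] ell_ge_1[OF x] C1(1) C2(1) C3(1) alpha_pos
      by (intro add_mono mult_right_mono) (auto simp: C_def)
    finally show ?thesis by (simp only: distrib_left)
  qed
  moreover have "C > 0" using C1(1) C2(1) C3(1) alpha_pos by (simp add: C_def add_pos_pos)
  ultimately show ?thesis by blast
qed

text \<open>If p = P^+(n) has p^2 dividing n, then (p, n / p) is a bad pair of weight ln p > ln y,
  so these n are already paid for by \<open>Err x\<close>.\<close>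

lemma square_factor_sum_le:
  assumes y: "y > 1"
  shows "ln y * (\<Sum>n\<in>{n\<in>nats_le x. real (largest_prime_factor n) > y \<and> largest_prime_factor n ^ 2 dvd n}. f n) \<le> Err x"
proof -
  let ?s = "{n\<in>nats_le x. real (largest_prime_factor n) > y \<and> largest_prime_factor n ^ 2 dvd n}"
  let ?t = "SIGMA d:nats_le x. nats_le (x / real d)"
  let ?g = "\<lambda>(d, m). if bad d m then mangoldt d * (f (d * m) + \<alpha> * f m) else 0"
  have "ln y * (\<Sum>n\<in>?s. f n) = (\<Sum>n\<in>?s. ln y * f n)" by (rule sum_distrib_left)
  also have "\<dots> \<le> (\<Sum>z\<in>?t. ?g z)"
  proof (rule sum_le_included[where i = "\<lambda>(d, m). d * m"])
    show "finite ?s" by simp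
    show "finite ?t" by (intro finite_SigmaI) auto
    show "\<forall>z\<in>?t. 0 \<le> ?g z"
    proof
      fix z assume "z \<in> ?t"
      then obtain d m where z: "z = (d, m)" "d \<ge> 1" "m \<ge> 1" by (auto simp: mem_nats_le)
      have "f (d * m) \<ge> 0" "f m \<ge> 0" using z by (auto intro!: f_nonneg)
      thus "0 \<le> ?g z" using alpha_pos mangoldt_nonneg[of d] by (simp add: z(1))
    qed
    show "\<forall>n\<in>?s. \<exists>z\<in>?t. (\<lambda>(d, m). d * m) z = n \<and> ln y * f n \<le> ?g z"
    proof
      fix n assume n: "n \<in> ?s"
      define p where "p = largest_prime_factor n"
      have n1: "n \<ge> 1" "real n \<le> x" "real p > y" "p ^ 2 dvd n" using n by (auto simp: mem_nats_le p_def)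
      have n2: "n > 1"
      proof (rule ccontr)
        assume "\<not> n > 1"
        hence "p = 1" using n1 by (simp add: p_def largest_prime_factor_def)
        thus False using n1 y by simp
      qed
      have p: "prime p" unfolding p_def by (rule prime_largest_prime_factor[OF n2])
      obtain k where k: "n = p ^ 2 * k" using n1(4) by (elim dvdE)
      define m where "m = p * k"
      have nm: "n = p * m" by (simp add: k m_def power2_eq_square)
      have m1: "m \<ge> 1" using nm n2 by (cases m) auto
      have t: "(p, m) \<in> ?t" unfolding Sigma_nats_le_eq using n1 nm m1 prime_ge_1_nat[OF p] by auto
      have bad: "bad p m" by (simp add: bad_def m_def)
      have "f n \<ge> 0" "f m \<ge> 0" using n1 m1 by (auto intro!: f_nonneg)
      moreover have "ln y \<le> ln (real p)" using n1(3) y by simp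
      ultimately have "ln y * f n \<le> ln (real p) * (f n + \<alpha> * f m)"
        using alpha_pos y n1(3) by (intro mult_mono) auto
      hence "ln y * f n \<le> ?g (p, m)" using bad p nm by simp
      thus "\<exists>z\<in>?t. (\<lambda>(d, m). d * m) z = n \<and> ln y * f n \<le> ?g z" using t nm by (intro bexI[of _ "(p, m)"]) auto
    qed
  qed
  also have "\<dots> = Err x" unfolding Err_def by (subst sum.Sigma) auto
  finally show ?thesis .
qed

text \<open>The bijection between n and (m, p) separates the variables: c sees only the prime p,
  while f and G depend on m alone apart from the factor \<alpha> and the shift of Omega by
  1.\<close>

lemma rough_sum_eq:
  fixes c :: "nat \<Rightarrow> real" and G :: "nat \<Rightarrow> real" and x y :: real
  assumes y: "y \<ge> 1"
  defines "R \<equiv> {n\<in>nats_le x. real (largest_prime_factor n) > y \<and> \<not> largest_prime_factor n ^ 2 dvd n}"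
    and "Q \<equiv> \<lambda>m. primes_le (x / real m) - primes_le (max (real (largest_prime_factor m)) y)"
  shows "(\<Sum>n\<in>R. f n * c (largest_prime_factor n) * G (prime_Omega n))
       = (\<Sum>m\<in>nats_le x. \<alpha> * f m * G (Suc (prime_Omega m)) * (\<Sum>p\<in>Q m. c p))"
proof -
  have Q: "p \<in> Q m \<longleftrightarrow> prime p \<and> real p * real m \<le> x \<and> largest_prime_factor m < p \<and> y < real p" if "m \<ge> 1" for p m
    using that by (auto simp: Q_def primes_le_def field_simps not_le)
  have "(\<Sum>m\<in>nats_le x. \<alpha> * f m * G (Suc (prime_Omega m)) * (\<Sum>p\<in>Q m. c p))
      = (\<Sum>(m, p)\<in>(SIGMA m:nats_le x. Q m). \<alpha> * f m * G (Suc (prime_Omega m)) * c p)"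
    unfolding sum_distrib_left by (rule sum.Sigma) (auto simp: Q_def)
  also have "\<dots> = (\<Sum>n\<in>R. f n * c (largest_prime_factor n) * G (prime_Omega n))"
  proof (rule sum.reindex_bij_witness[of _ "\<lambda>n. (n div largest_prime_factor n, largest_prime_factor n)" "\<lambda>(m, p). p * m"])
    fix z assume "z \<in> (SIGMA m:nats_le x. Q m)"
    then obtain m p where z: "z = (m, p)" "m \<in> nats_le x" "p \<in> Q m" by auto
    have m1: "m \<ge> 1" using z by (auto simp: mem_nats_le)
    have p: "prime p" "real p * real m \<le> x" "largest_prime_factor m < p" "y < real p" using z(3) Q[OF m1] by auto
    note L = largest_prime_factor_prime_times[OF p(1) m1 p(3)]
    have p0: "p > 0" using p(1) by (rule prime_gt_0_nat)
    show "((case z of (m, p) \<Rightarrow> p * m) div largest_prime_factor (case z of (m, p) \<Rightarrow> p * m), largest_prime_factor (case z of (m, p) \<Rightarrow> p * m)) = z"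
      using p0 by (simp add: z(1) L(1))
    have "\<not> p ^ 2 dvd p * m" using L(2) p0 by (simp add: power2_eq_square)
    moreover have "p * m \<ge> 1" using p0 m1 by (simp add: Suc_le_eq)
    ultimately show "(case z of (m, p) \<Rightarrow> p * m) \<in> R" using p by (simp add: z(1) R_def L(1) mem_nats_le)
    have cop: "coprime p m" using p(1) L(2) by (rule prime_imp_coprime)
    have "f (p * m) = \<alpha> * f m" using f_mult[OF p0 _ cop] m1 p(1) by (simp add: f_prime)
    moreover have "prime_Omega (p * m) = Suc (prime_Omega m)"
      using prime_Omega_mult[of p m] p0 m1 prime_Omega_prime_power[OF p(1), of 1] by simp
    ultimately show "f (case z of (m, p) \<Rightarrow> p * m) * c (largest_prime_factor (case z of (m, p) \<Rightarrow> p * m)) * G (prime_Omega (case z of (m, p) \<Rightarrow> p * m))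
        = (case z of (m, p) \<Rightarrow> \<alpha> * f m * G (Suc (prime_Omega m)) * c p)"
      by (simp add: z(1) L(1))
  next
    fix n assume n: "n \<in> R"
    define p where "p = largest_prime_factor n"
    have n1: "n \<ge> 1" "real n \<le> x" "real p > y" "\<not> p ^ 2 dvd n" using n by (auto simp: R_def mem_nats_le p_def)
    have n2: "n > 1"
    proof (rule ccontr)
      assume "\<not> n > 1"
      hence "p = 1" by (simp add: p_def largest_prime_factor_def)
      thus False using n1(3) y by simp
    qed
    obtain m where m: "n = p * m" "m \<ge> 1" "largest_prime_factor m < p"
      using largest_prime_factor_cofactor[OF n2] n1(4) unfolding p_def by blast
    have p: "prime p" unfolding p_def by (rule prime_largest_prime_factor[OF n2])
    have p0: "p > 0" using p by (rule prime_gt_0_nat)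
    have d: "n div p = m" using m(1) p0 by simp
    show "(case (n div largest_prime_factor n, largest_prime_factor n) of (m, p) \<Rightarrow> p * m) = n"
      unfolding p_def[symmetric] d using m(1) by simp
    have le: "real p * real m \<le> x" using n1(2) m(1) by simp
    have "1 * real m \<le> real p * real m" using p0 by (intro mult_right_mono) auto
    hence "real m \<le> x" using le by linarith
    hence "m \<in> nats_le x" using m(2) by (simp add: mem_nats_le)
    moreover have "p \<in> Q m" using Q[OF m(2)] p le m(3) n1(3) by simp
    ultimately show "(n div largest_prime_factor n, largest_prime_factor n) \<in> (SIGMA m:nats_le x. Q m)"
      unfolding p_def[symmetric] d by simp
  qed
  finally show ?thesis ..
qed

text \<open>The window sum is a difference of two density errors, whence 36 = 2 * 18. Dividing by ln
  y instead of ln u keeps the bound linear in u = x / m, so that summing over m yields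
  \<open>A x\<close>.\<close>

lemma prime_window_le:
  assumes y: "y > 1" and e: "\<epsilon> \<ge> 0" and small: "\<And>z. z \<ge> y \<Longrightarrow> \<bar>density_error P \<delta> z\<bar> \<le> \<epsilon> * prime_pi z"
    and u: "u \<ge> 0"
  shows "\<bar>\<Sum>p\<in>primes_le u - primes_le (max v y). (if p \<in> P then 1 else 0) - \<delta>\<bar> \<le> 36 * \<epsilon> * (u / ln y)"
proof (cases "max v y < u")
  case False
  hence "primes_le u - primes_le (max v y) = {}" using primes_le_mono[of u "max v y"] by (simp only: Diff_eq_empty_iff not_less)
  moreover have "36 * \<epsilon> * (u / ln y) \<ge> 0" using y u e by (intro mult_nonneg_nonneg divide_nonneg_nonneg) auto
  ultimately show ?thesis by (simp only: sum.empty abs_zero)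
next
  case True
  have uy: "u > y" using True by simp
  have "(\<Sum>p\<in>primes_le u - primes_le (max v y). (if p \<in> P then 1 else 0) - \<delta>) = density_error P \<delta> u - density_error P \<delta> (max v y)"
    unfolding density_error_def using True by (intro sum_diff primes_le_mono) auto
  also have "\<bar>\<dots>\<bar> \<le> \<epsilon> * prime_pi u + \<epsilon> * prime_pi (max v y)"
    using small[OF less_imp_le[OF uy]] small[OF max.cobounded2[of y v]] by linarith
  also have "\<dots> \<le> \<epsilon> * prime_pi u + \<epsilon> * prime_pi u"
    using e True by (intro add_left_mono mult_left_mono prime_pi_mono) auto
  also have "\<dots> = 2 * \<epsilon> * prime_pi u" by simp
  also have "\<dots> \<le> 2 * \<epsilon> * (18 * (u / ln u))" using e uy y by (intro mult_left_mono prime_pi_upper) auto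
  also have "\<dots> \<le> 2 * \<epsilon> * (18 * (u / ln y))"
    using e uy y by (intro mult_left_mono divide_left_mono mult_pos_pos) auto
  finally show ?thesis by simp
qed

text \<open>The integers are divided into y-smooth ones, those whose largest prime occurs twice, and
  the rest, where the density of P acts on the windows of p. Each class accounts for one kind of
  error term.\<close>

lemma largest_prime_factor_inequality:
  "\<exists>K>0. \<forall>\<epsilon> b G x y. 1 < y \<longrightarrow> y \<le> x \<longrightarrow> \<epsilon> \<ge> 0 \<longrightarrow> (\<forall>j. \<bar>G j\<bar> \<le> b) \<longrightarrow>
     (\<forall>z\<ge>y. \<bar>density_error P \<delta> z\<bar> \<le> \<epsilon> * prime_pi z) \<longrightarrow>
     \<bar>\<Sum>n\<in>nats_le x. f n * ((if largest_prime_factor n \<in> P then 1 else 0) - \<delta>) * G (prime_Omega n)\<bar>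
       \<le> K * b * (2 * (x * (lp x / ell x)) / ln y + x * lp y / ln x + \<epsilon> * (x * lp x) / ln y)"
proof -
  obtain C1 where C1: "C1 > 0" "\<And>x. x \<ge> 1 \<Longrightarrow> Err x \<le> C1 * (x * (lp x / ell x))" using Err_bound by blast
  obtain C2 where C2: "C2 > 0" "\<And>x y. x \<ge> 1 \<Longrightarrow> y \<ge> 1 \<Longrightarrow>
    (\<Sum>n\<in>{n\<in>nats_le x. real (largest_prime_factor n) \<le> y}. f n) * ln x \<le> C2 * (x * (lp x / ell x) + x * lp y)"
    using smooth_S_le by blast
  obtain C3 where C3: "C3 > 0" "\<And>x. x \<ge> 1 \<Longrightarrow> A x \<le> C3 * lp x" using A_upper by blast
  define D where "D = 1 + \<bar>\<delta>\<bar>"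
  have D: "D \<ge> 1" by (simp add: D_def)
  define K where "K = D * (C1 + C2) + 36 * \<alpha> * C3"
  have K: "K > 0" using D C1(1) C2(1) C3(1) alpha_pos by (simp add: K_def add_pos_pos)
  have "\<bar>\<Sum>n\<in>nats_le x. f n * ((if largest_prime_factor n \<in> P then 1 else 0) - \<delta>) * G (prime_Omega n)\<bar>
       \<le> K * b * (2 * (x * (lp x / ell x)) / ln y + x * lp y / ln x + \<epsilon> * (x * lp x) / ln y)"
    if y: "1 < y" and yx: "y \<le> x" and e: "\<epsilon> \<ge> 0" and G: "\<forall>j. \<bar>G j\<bar> \<le> b"
      and small: "\<forall>z\<ge>y. \<bar>density_error P \<delta> z\<bar> \<le> \<epsilon> * prime_pi z" for \<epsilon> b G x y
  proof -
    have x: "x \<ge> 1" "x > 1" using y yx by auto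
    have b0: "b \<ge> 0" using G abs_ge_zero order_trans by blast
    have ly: "ln y > 0" "ln x > 0" "ln y \<le> ln x" using y yx by auto
    have L: "lp x \<ge> 1" "lp y \<ge> 1" "ell x \<ge> 1" using lp_ge_1 ell_ge_1 x y by auto
    define c where "c = (\<lambda>p. (if p \<in> P then 1 else 0) - \<delta>)"
    have cD: "\<bar>c p\<bar> \<le> D" for p unfolding c_def D_def by (simp split: if_split) (linarith)
    define t where "t = (\<lambda>n. f n * c (largest_prime_factor n) * G (prime_Omega n))"
    define Sm where "Sm = {n\<in>nats_le x. real (largest_prime_factor n) \<le> y}"
    define Bd where "Bd = {n\<in>nats_le x. real (largest_prime_factor n) > y \<and> largest_prime_factor n ^ 2 dvd n}"
    define R where "R = {n\<in>nats_le x. real (largest_prime_factor n) > y \<and> \<not> largest_prime_factor n ^ 2 dvd n}"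
    have fin: "finite Sm" "finite Bd" "finite R" by (auto simp: Sm_def Bd_def R_def)
    have U: "nats_le x = (Sm \<union> Bd) \<union> R" by (auto simp: Sm_def Bd_def R_def)
    have "(\<Sum>n\<in>nats_le x. t n) = (\<Sum>n\<in>Sm \<union> Bd. t n) + (\<Sum>n\<in>R. t n)"
      unfolding U using fin by (intro sum.union_disjoint) (auto simp: Sm_def Bd_def R_def)
    also have "(\<Sum>n\<in>Sm \<union> Bd. t n) = (\<Sum>n\<in>Sm. t n) + (\<Sum>n\<in>Bd. t n)"
      using fin by (intro sum.union_disjoint) (auto simp: Sm_def Bd_def)
    finally have split: "(\<Sum>n\<in>nats_le x. t n) = (\<Sum>n\<in>Sm. t n) + (\<Sum>n\<in>Bd. t n) + (\<Sum>n\<in>R. t n)" .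
    have triv: "\<bar>\<Sum>n\<in>Z. t n\<bar> \<le> D * b * (\<Sum>n\<in>Z. f n)" if "Z \<subseteq> nats_le x" for Z
      unfolding sum_distrib_left
    proof (intro order_trans[OF sum_abs] sum_mono)
      fix n assume "n \<in> Z"
      hence fn: "f n \<ge> 0" using that f_nonneg' by blast
      have "\<bar>c (largest_prime_factor n)\<bar> * \<bar>G (prime_Omega n)\<bar> \<le> D * b"
        using cD G D b0 by (intro mult_mono) auto
      hence "f n * (\<bar>c (largest_prime_factor n)\<bar> * \<bar>G (prime_Omega n)\<bar>) \<le> f n * (D * b)" using fn by (rule mult_left_mono)
      thus "\<bar>t n\<bar> \<le> D * b * f n" using fn by (simp add: t_def abs_mult mult_ac)
    qed
    let ?X = "x * (lp x / ell x)"
    have X0: "?X \<ge> 0" using x L by simp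
    have Db: "D * b \<ge> 0" using D b0 by simp
    have "\<bar>\<Sum>n\<in>Sm. t n\<bar> \<le> D * b * (\<Sum>n\<in>Sm. f n)" by (rule triv) (auto simp: Sm_def)
    also have "(\<Sum>n\<in>Sm. f n) \<le> C2 * (?X + x * lp y) / ln x"
      using C2(2)[of x y] x y ly unfolding Sm_def by (simp add: pos_le_divide_eq)
    finally have s1: "\<bar>\<Sum>n\<in>Sm. t n\<bar> \<le> D * b * (C2 * (?X + x * lp y) / ln x)" using Db by (simp add: mult_left_mono)
    have "\<bar>\<Sum>n\<in>Bd. t n\<bar> \<le> D * b * (\<Sum>n\<in>Bd. f n)" by (rule triv) (auto simp: Bd_def)
    also have "(\<Sum>n\<in>Bd. f n) \<le> C1 * ?X / ln y"
      using order_trans[OF square_factor_sum_le[OF y, of x] C1(2)[OF x(1)]] unfolding Bd_def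
      by (subst pos_le_divide_eq[OF ly(1)]) (simp only: mult.commute)
    finally have s2: "\<bar>\<Sum>n\<in>Bd. t n\<bar> \<le> D * b * (C1 * ?X / ln y)" using Db by (simp add: mult_left_mono)
    have "(\<Sum>n\<in>R. t n) = (\<Sum>m\<in>nats_le x. \<alpha> * f m * G (Suc (prime_Omega m)) *
        (\<Sum>p\<in>primes_le (x / real m) - primes_le (max (real (largest_prime_factor m)) y). c p))"
      unfolding t_def R_def using y by (intro rough_sum_eq) simp
    also have "\<bar>\<dots>\<bar> \<le> (\<Sum>m\<in>nats_le x. 36 * \<alpha> * b * \<epsilon> * x / ln y * (f m / real m))"
    proof (intro order_trans[OF sum_abs] sum_mono)
      fix m assume m: "m \<in> nats_le x"
      have "\<bar>\<Sum>p\<in>primes_le (x / real m) - primes_le (max (real (largest_prime_factor m)) y). c p\<bar> \<le> 36 * \<epsilon> * ((x / real m) / ln y)"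
        unfolding c_def using small x by (intro prime_window_le y e) auto
      hence "\<bar>G (Suc (prime_Omega m))\<bar> * \<bar>\<Sum>p\<in>primes_le (x / real m) - primes_le (max (real (largest_prime_factor m)) y). c p\<bar>
          \<le> b * (36 * \<epsilon> * ((x / real m) / ln y))" using G b0 by (intro mult_mono) auto
      hence "\<alpha> * f m * (\<bar>G (Suc (prime_Omega m))\<bar> * \<bar>\<Sum>p\<in>primes_le (x / real m) - primes_le (max (real (largest_prime_factor m)) y). c p\<bar>)
          \<le> \<alpha> * f m * (b * (36 * \<epsilon> * ((x / real m) / ln y)))" using alpha_pos f_nonneg'[OF m] by (intro mult_left_mono) auto
      thus "\<bar>\<alpha> * f m * G (Suc (prime_Omega m)) * (\<Sum>p\<in>primes_le (x / real m) - primes_le (max (real (largest_prime_factor m)) y). c p)\<bar>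
          \<le> 36 * \<alpha> * b * \<epsilon> * x / ln y * (f m / real m)"
        using alpha_pos f_nonneg'[OF m] by (simp add: abs_mult mult_ac)
    qed
    also have "\<dots> = 36 * \<alpha> * b * \<epsilon> * x / ln y * A x" by (simp add: A_def sum_distrib_left)
    also have "\<dots> \<le> 36 * \<alpha> * b * \<epsilon> * x / ln y * (C3 * lp x)"
      using C3(2)[OF x(1)] alpha_pos b0 e x ly by (intro mult_left_mono) auto
    finally have s3: "\<bar>\<Sum>n\<in>R. t n\<bar> \<le> 36 * \<alpha> * b * \<epsilon> * x / ln y * (C3 * lp x)" .
    define X1 where "X1 = ?X / ln y"
    define X2 where "X2 = x * lp y / ln x"
    define X3 where "X3 = \<epsilon> * (x * lp x) / ln y"
    have Xn: "X1 \<ge> 0" "X2 \<ge> 0" "X3 \<ge> 0" using X0 ly x L e by (auto simp: X1_def X2_def X3_def)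
    have "?X / ln x \<le> X1" unfolding X1_def using X0 ly by (intro divide_left_mono) auto
    hence "C2 * (?X + x * lp y) / ln x \<le> C2 * (X1 + X2)"
      using C2(1) by (simp add: X2_def distrib_left add_divide_distrib flip: times_divide_eq_right)
    hence "D * b * (C2 * (?X + x * lp y) / ln x) \<le> D * b * (C2 * (X1 + X2))" using Db by (rule mult_left_mono)
    hence "\<bar>\<Sum>n\<in>nats_le x. t n\<bar> \<le> D * b * (C2 * (X1 + X2)) + D * b * (C1 * X1) + 36 * \<alpha> * b * C3 * X3"
      using s1 s2 s3 unfolding split by (simp add: X1_def X3_def mult_ac)
    also have "\<dots> = b * (D * C2 * (X1 + X2) + D * C1 * X1 + 36 * \<alpha> * C3 * X3)" by (simp add: algebra_simps)
    also have "\<dots> \<le> b * (K * (2 * X1 + X2 + X3))"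
    proof (rule mult_left_mono[OF _ b0])
      have nn: "D * C1 * X1 \<ge> 0" "D * C1 * X2 \<ge> 0" "D * C1 * X3 \<ge> 0" "D * C2 * X1 \<ge> 0" "D * C2 * X3 \<ge> 0"
        "\<alpha> * C3 * X1 \<ge> 0" "\<alpha> * C3 * X2 \<ge> 0"
        using Xn D C1(1) C2(1) C3(1) alpha_pos by auto
      thus "D * C2 * (X1 + X2) + D * C1 * X1 + 36 * \<alpha> * C3 * X3 \<le> K * (2 * X1 + X2 + X3)"
        by (simp add: K_def algebra_simps)
    qed
    finally show ?thesis unfolding t_def c_def X1_def X2_def X3_def by (simp add: mult_ac)
  qed
  with K show ?thesis by (intro exI[of _ K] conjI allI impI)
qed

text \<open>With y = x powr \<theta> the three classes contribute, relative to S x, at most a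
  constant times \<theta> powr \<alpha>, 1 / (\<theta> * ln x) and \<epsilon> / \<theta>.\<close>

proposition largest_prime_factor_equidistribution:
  fixes G :: "real \<Rightarrow> nat \<Rightarrow> real"
  assumes P: "P \<subseteq> {p. prime p}" "has_natural_density P \<delta>" and G: "\<And>x j. \<bar>G x j\<bar> \<le> b"
  shows "((\<lambda>x. (\<Sum>n\<in>nats_le x. f n * ((if largest_prime_factor n \<in> P then 1 else 0) - \<delta>) * G x (prime_Omega n)) / S x) \<longlongrightarrow> 0) at_top"
proof (rule tendstoI)
  fix e :: real assume e: "e > 0"
  obtain K where K: "K > 0" "\<And>\<epsilon> b G x y. 1 < y \<Longrightarrow> y \<le> x \<Longrightarrow> \<epsilon> \<ge> 0 \<Longrightarrow> (\<forall>j. \<bar>G j\<bar> \<le> b) \<Longrightarrow>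
     (\<forall>z\<ge>y. \<bar>density_error P \<delta> z\<bar> \<le> \<epsilon> * prime_pi z) \<Longrightarrow>
     \<bar>\<Sum>n\<in>nats_le x. f n * ((if largest_prime_factor n \<in> P then 1 else 0) - \<delta>) * G (prime_Omega n)\<bar>
       \<le> K * b * (2 * (x * (lp x / ell x)) / ln y + x * lp y / ln x + \<epsilon> * (x * lp x) / ln y)"
    using largest_prime_factor_inequality by blast
  obtain c where c: "c > 0" "\<And>x. x \<ge> 1 \<Longrightarrow> S x \<ge> c * (x * (lp x / ell x))" using S_lower by blast
  have b0: "b \<ge> 0" using G[of 0 0] by linarith
  define M where "M = K * b / c"
  have M: "M \<ge> 0" using K(1) b0 c(1) by (simp add: M_def)
  have "((\<lambda>\<theta>. (2 * \<theta>) powr \<alpha>) \<longlongrightarrow> 0) (at_right 0)" using alpha_pos by real_asymp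
  hence "((\<lambda>\<theta>. M * (2 * (2 * \<theta>) powr \<alpha>)) \<longlongrightarrow> M * (2 * 0)) (at_right 0)" by (intro tendsto_intros)
  hence "\<forall>\<^sub>F \<theta> in at_right 0. M * (2 * (2 * \<theta>) powr \<alpha>) < e / 3" using e by (intro order_tendstoD(2)) auto
  moreover have "\<forall>\<^sub>F \<theta> in at_right (0::real). \<theta> < 1" "\<forall>\<^sub>F \<theta> in at_right (0::real). 0 < \<theta>"
    unfolding eventually_at_right_field by (rule exI[of _ 1], simp)+
  ultimately have "\<forall>\<^sub>F \<theta> in at_right (0::real). M * (2 * (2 * \<theta>) powr \<alpha>) < e / 3 \<and> \<theta> < 1 \<and> 0 < \<theta>"
    by eventually_elim auto
  then obtain \<theta> where th: "M * (2 * (2 * \<theta>) powr \<alpha>) < e / 3" "\<theta> < 1" "0 < \<theta>"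
    using eventually_happens'[of "at_right (0::real)"] by (auto simp: trivial_limit_at_right_real)
  \<comment> \<open>Chosen after \<theta> and proportional to it, because the windows cost 2 *
    \<epsilon> / \<theta>.\<close>
  define \<epsilon> where "\<epsilon> = e * \<theta> / (6 * (M + 1))"
  have eps: "\<epsilon> > 0" using e th M by (simp add: \<epsilon>_def)
  have Me: "M * (2 * \<epsilon> / \<theta>) \<le> e / 3"
  proof -
    have "M * (2 * \<epsilon> / \<theta>) = M / (M + 1) * (e / 3)"
      using th M by (simp add: \<epsilon>_def) (simp add: divide_simps)
    also have "\<dots> \<le> 1 * (e / 3)" using M e by (intro mult_right_mono) (auto simp: divide_le_eq_1)
    finally show ?thesis by simp
  qed
  obtain Z where Z: "\<And>z. z \<ge> Z \<Longrightarrow> \<bar>density_error P \<delta> z\<bar> \<le> \<epsilon> * prime_pi z"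
    using density_error_small[OF P eps] by (auto simp: eventually_at_top_linorder)
  have "filterlim (\<lambda>x. x powr \<theta>) at_top at_top" using th by real_asymp
  hence ev1: "\<forall>\<^sub>F x in at_top. x powr \<theta> \<ge> max Z 2" by (rule filterlim_at_top[THEN iffD1, rule_format])
  have "filterlim (\<lambda>x. \<theta> * ln x) at_top at_top" using th by real_asymp
  hence ev2: "\<forall>\<^sub>F x in at_top. \<theta> * ln x \<ge> 1" by (rule filterlim_at_top[THEN iffD1, rule_format])
  have "((\<lambda>x. M * (2 / (\<theta> * ln x))) \<longlongrightarrow> M * 0) at_top"
  proof (intro tendsto_mult tendsto_const)
    show "((\<lambda>x. 2 / (\<theta> * ln x)) \<longlongrightarrow> 0) at_top" using th by real_asymp
  qed
  hence ev3: "\<forall>\<^sub>F x in at_top. M * (2 / (\<theta> * ln x)) < e / 3" using e by (intro order_tendstoD(2)) auto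
  show "\<forall>\<^sub>F x in at_top. dist ((\<Sum>n\<in>nats_le x. f n * ((if largest_prime_factor n \<in> P then 1 else 0) - \<delta>) * G x (prime_Omega n)) / S x) 0 < e"
    using ev1 ev2 ev3 eventually_ge_at_top[of 1]
  proof eventually_elim
    case (elim x)
    let ?T = "\<Sum>n\<in>nats_le x. f n * ((if largest_prime_factor n \<in> P then 1 else 0) - \<delta>) * G x (prime_Omega n)"
    define y where "y = x powr \<theta>"
    have x: "x \<ge> 1" by fact
    have y: "1 < y" "y \<ge> Z" "y \<le> x" using elim(1) x th powr_mono[of \<theta> 1 x] by (auto simp: y_def)
    have lny: "ln y = \<theta> * ln x" using x by (simp add: y_def ln_powr)
    have "\<theta> * ln x \<le> 1 * ln x" using th x by (intro mult_right_mono) auto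
    hence lnx: "ln x \<ge> 1" using elim(2) by linarith
    have L: "lp x \<ge> 1" "ell x \<ge> 1" "ell x \<le> 2 * ln x" using lp_ge_1[OF x] ell_ge_1[OF x] ell_bounds_ln[OF lnx] by auto
    define U where "U = x * (lp x / ell x)"
    have U: "U > 0" using x L by (simp add: U_def)
    have US: "U \<le> S x / c" using c(2)[OF x] c(1) by (simp add: U_def pos_le_divide_eq mult.commute)
    have "\<bar>?T\<bar> \<le> K * b * (2 * U / ln y + x * lp y / ln x + \<epsilon> * (x * lp x) / ln y)"
      unfolding U_def by (rule K(2)) (use y eps G Z in auto)
    also have "\<dots> \<le> K * b * (U * (2 / (\<theta> * ln x) + 2 * (2 * \<theta>) powr \<alpha> + 2 * \<epsilon> / \<theta>))"
    proof (rule mult_left_mono)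
      have xl: "x * lp x = U * ell x" using L by (simp add: U_def)
      have r: "ell x / ln x \<le> 2" using L lnx by (simp add: divide_le_eq)
      have "x * lp y / ln x \<le> x * ((2 * \<theta>) powr \<alpha> * lp x) / ln x"
        unfolding y_def using lp_powr_le[OF x th(3) elim(2)] x lnx by (intro divide_right_mono mult_left_mono) auto
      also have "\<dots> = U * (2 * \<theta>) powr \<alpha> * (ell x / ln x)" using xl by (simp add: mult_ac)
      also have "\<dots> \<le> U * (2 * \<theta>) powr \<alpha> * 2" using r U by (intro mult_left_mono) auto
      finally have 1: "x * lp y / ln x \<le> U * (2 * (2 * \<theta>) powr \<alpha>)" by (simp add: mult_ac)
      have "\<epsilon> * (x * lp x) / ln y = U * (\<epsilon> / \<theta>) * (ell x / ln x)" unfolding xl lny by (simp add: mult_ac)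
      also have "\<dots> \<le> U * (\<epsilon> / \<theta>) * 2" using r U eps th by (intro mult_left_mono) auto
      finally have 2: "\<epsilon> * (x * lp x) / ln y \<le> U * (2 * \<epsilon> / \<theta>)" by (simp add: mult_ac)
      have 3: "2 * U / ln y = U * (2 / (\<theta> * ln x))" by (simp add: lny)
      show "2 * U / ln y + x * lp y / ln x + \<epsilon> * (x * lp x) / ln y \<le> U * (2 / (\<theta> * ln x) + 2 * (2 * \<theta>) powr \<alpha> + 2 * \<epsilon> / \<theta>)"
        using 1 2 unfolding 3 by (simp only: distrib_left)
      show "0 \<le> K * b" using K(1) b0 by simp
    qed
    also have "\<dots> \<le> K * b * (S x / c * (2 / (\<theta> * ln x) + 2 * (2 * \<theta>) powr \<alpha> + 2 * \<epsilon> / \<theta>))"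
      using K(1) b0 US th eps lnx by (intro mult_left_mono mult_right_mono add_nonneg_nonneg) auto
    also have "\<dots> = S x * (M * (2 / (\<theta> * ln x)) + M * (2 * (2 * \<theta>) powr \<alpha>) + M * (2 * \<epsilon> / \<theta>))"
      by (simp add: M_def algebra_simps)
    also have "\<dots> < S x * e" using elim(3) th(1) Me S_ge_1[OF x] by (intro mult_strict_left_mono) linarith+
    finally have "\<bar>?T\<bar> / S x < e" using S_ge_1[OF x] by (simp add: divide_less_eq mult.commute)
    thus ?case using S_nonneg[of x] by (simp add: abs_divide)
  qed
qed

end

section \<open>Insensitivity of the normalised test function\<close>

text \<open>A margin of 1 around the support: two points at distance below 1, one of them outside
  the margin, both lie outside the support.\<close>

lemma bounded_support_uniform:
  fixes F :: "real \<Rightarrow> real"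
  assumes cont: "continuous_on UNIV F" and supp: "\<And>u. \<bar>u\<bar> > R \<Longrightarrow> F u = 0" and e: "\<epsilon> > 0"
  shows "\<exists>d>0. \<forall>u v. \<bar>u - v\<bar> < d \<longrightarrow> \<bar>F u - F v\<bar> < \<epsilon>"
proof -
  have "continuous_on {-R-1..R+1} F" using cont by (rule continuous_on_subset) simp
  hence "uniformly_continuous_on {-R-1..R+1} F" by (intro compact_uniformly_continuous) auto
  then obtain d where d: "d > 0" "\<And>u v. u \<in> {-R-1..R+1} \<Longrightarrow> v \<in> {-R-1..R+1} \<Longrightarrow> dist v u < d \<Longrightarrow> dist (F v) (F u) < \<epsilon>"
    using e unfolding uniformly_continuous_on_def by metis
  have "\<bar>F u - F v\<bar> < \<epsilon>" if uv: "\<bar>u - v\<bar> < min d 1" for u v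
  proof (cases "u \<in> {-R-1..R+1} \<and> v \<in> {-R-1..R+1}")
    case True
    thus ?thesis using d(2)[of v u] uv by (simp add: dist_real_def)
  next
    case False
    hence "\<bar>u\<bar> > R" "\<bar>v\<bar> > R" using uv by (auto simp: abs_if split: if_splits)
    thus ?thesis using e by (simp add: supp)
  qed
  thus ?thesis using d(1) by (intro exI[of _ "min d 1"]) auto
qed

text \<open>Changing L to L' moves the argument s to \<rho> * s + \<tau> with \<rho> - 1 and \<tau>
  small. The displacement is small only for bounded s; for |s| > R + 1 compact support takes over,
  since the new argument still lies outside the support.\<close>

lemma rescaling_close:
  fixes F :: "real \<Rightarrow> real"
  assumes cont: "continuous_on UNIV F" and supp: "\<And>u. \<bar>u\<bar> > R \<Longrightarrow> F u = 0" and e: "\<epsilon> > 0"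
    and R: "R \<ge> 0" and c: "c > 0"
  shows "\<forall>\<^sub>F L in at_top. \<forall>L' j. L - c \<le> L' \<longrightarrow> L' \<le> L \<longrightarrow> \<bar>F ((j - L) / sqrt L) - F ((j - L') / sqrt L')\<bar> \<le> \<epsilon>"
proof -
  obtain d where d: "d > 0" "\<And>u v. \<bar>u - v\<bar> < d \<Longrightarrow> \<bar>F u - F v\<bar> < \<epsilon>"
    using bounded_support_uniform[of F R, OF cont supp e] by blast
  have "((\<lambda>L. c / (L - c)) \<longlongrightarrow> 0) at_top" "((\<lambda>L. c / sqrt (L - c)) \<longlongrightarrow> 0) at_top" using c by real_asymp+
  hence "((\<lambda>L. (R + 1) * (c / (L - c)) + c / sqrt (L - c)) \<longlongrightarrow> (R + 1) * 0 + 0) at_top"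
    by (intro tendsto_intros)
  hence "\<forall>\<^sub>F L in at_top. (R + 1) * (c / (L - c)) + c / sqrt (L - c) < min d 1" using d by (intro order_tendstoD(2)) auto
  thus ?thesis using eventually_gt_at_top[of c]
  proof eventually_elim
    case (elim L)
    show ?case
    proof (intro allI impI)
      fix L' j assume L': "L - c \<le> L'" "L' \<le> L"
      have pos: "L' > 0" "L > 0" "L - c > 0" using L' elim(2) c by auto
      define s where "s = (j - L) / sqrt L"
      define s' where "s' = (j - L') / sqrt L'"
      define \<rho> where "\<rho> = sqrt L / sqrt L'"
      define \<tau> where "\<tau> = (L - L') / sqrt L'"
      have "j = L + s * sqrt L" using pos by (simp add: s_def)
      hence ss: "s' = \<rho> * s + \<tau>" using pos by (simp add: s'_def \<rho>_def \<tau>_def field_simps)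
      have r1: "\<rho> \<ge> 1" using pos L' by (simp add: \<rho>_def)
      have "\<rho> * 1 \<le> \<rho> * \<rho>" using r1 by (intro mult_left_mono) auto
      also have "\<rho> * \<rho> = L / L'" using pos by (simp add: \<rho>_def)
      finally have "\<rho> - 1 \<le> (L - L') / L'" using pos by (simp add: diff_divide_distrib)
      also have "\<dots> \<le> c / (L - c)" using pos L' c by (intro frac_le) auto
      finally have r2: "\<rho> - 1 \<le> c / (L - c)" .
      have t0: "\<tau> \<ge> 0" using pos L' by (simp add: \<tau>_def)
      have t1: "\<tau> \<le> c / sqrt (L - c)" unfolding \<tau>_def using pos L' c by (intro frac_le) auto
      have n: "(R + 1) * (c / (L - c)) \<ge> 0" using R c pos by simp
      show "\<bar>F ((j - L) / sqrt L) - F ((j - L') / sqrt L')\<bar> \<le> \<epsilon>"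
        unfolding s_def[symmetric] s'_def[symmetric]
      proof (cases "\<bar>s\<bar> \<le> R + 1")
        case True
        have "\<bar>s - s'\<bar> = \<bar>(\<rho> - 1) * s + \<tau>\<bar>" unfolding ss by (simp add: algebra_simps abs_minus_commute)
        also have "\<dots> \<le> \<bar>(\<rho> - 1) * s\<bar> + \<bar>\<tau>\<bar>" by (rule abs_triangle_ineq)
        also have "\<dots> = (\<rho> - 1) * \<bar>s\<bar> + \<tau>" using r1 t0 by (simp add: abs_mult)
        also have "(\<rho> - 1) * \<bar>s\<bar> \<le> c / (L - c) * (R + 1)" using r1 r2 True by (intro mult_mono) auto
        finally have "\<bar>s - s'\<bar> < d" using t1 elim(1) by (simp add: mult.commute)
        thus "\<bar>F s - F s'\<bar> \<le> \<epsilon>" using d(2) less_imp_le by blast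
      next
        case False
        have "1 * \<bar>s\<bar> \<le> \<rho> * \<bar>s\<bar>" using r1 by (intro mult_right_mono) auto
        also have "\<rho> * \<bar>s\<bar> = \<bar>s' - \<tau>\<bar>" unfolding ss using r1 by (simp add: abs_mult)
        also have "\<dots> \<le> \<bar>s'\<bar> + \<tau>" using t0 by linarith
        finally have "\<bar>s'\<bar> > R" using False t1 elim(1) n by linarith
        thus "\<bar>F s - F s'\<bar> \<le> \<epsilon>" using False supp e by simp
      qed
    qed
  qed
qed

section \<open>The Gaussian mean and the divisor bound\<close>

lemma integral_std_normal_distribution:
  fixes F :: "real \<Rightarrow> real"
  assumes "F \<in> borel_measurable borel"
  shows "integral\<^sup>L std_normal_distribution F = 1 / sqrt (2 * pi) * (LINT t|lborel. F t * exp (- (t\<^sup>2) / 2))"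
proof -
  have "integral\<^sup>L std_normal_distribution F = (LINT t|lborel. std_normal_density t * F t)"
    using assms by (subst integral_density) auto
  also have "\<dots> = (LINT t|lborel. 1 / sqrt (2 * pi) * (F t * exp (- (t\<^sup>2) / 2)))"
    by (intro Bochner_Integration.integral_cong) (auto simp: std_normal_density_def)
  finally show ?thesis by (simp only: integral_mult_right_zero)
qed

text \<open>Every entry of a factorisation of p ^ j is one of the j + 1 powers of p up to p ^ j; a
  crude polynomial bound in j is all the growth condition asks for.\<close>

lemma divisor_fun_prime_power_le:
  assumes p: "prime p"
  shows "divisor_fun k (p ^ j) \<le> Suc j ^ k"
proof -
  let ?A = "(\<lambda>i. p ^ i) ` {..j}"
  have "{as. length as = k \<and> (\<forall>a\<in>set as. 0 < a) \<and> prod_list as = p ^ j} \<subseteq> {as. set as \<subseteq> ?A \<and> length as = k}"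
  proof safe
    fix as a assume as: "prod_list as = p ^ j" "a \<in> set as"
    have "a dvd p ^ j" using prod_list_dvd[OF as(2)] as(1) by simp
    thus "a \<in> ?A" using divides_primepow_nat[OF p] by auto
  qed
  hence "divisor_fun k (p ^ j) \<le> card {as. set as \<subseteq> ?A \<and> length as = k}"
    unfolding divisor_fun_def by (intro card_mono finite_lists_length_eq) auto
  also have "\<dots> = card ?A ^ k" by (intro card_lists_length_eq) auto
  also have "\<dots> \<le> Suc j ^ k" using card_image_le[of "{..j}" "\<lambda>i. p ^ i"] by (intro power_mono) auto
  finally show ?thesis .
qed

text \<open>Bernoulli's inequality for the (k + 1)-st root q of 3 / 2; the constant 1 / (q - 1) + 1
  is large enough to turn 1 + j * (q - 1) into a bound for j + 1.\<close>

lemma power_le_exponential: "\<exists>B. \<forall>j. real (Suc j) ^ Suc k \<le> B * (3 / 2) ^ j"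
proof -
  define q where "q = root (Suc k) (3 / 2)"
  have q: "q ^ Suc k = 3 / 2" "q > 1" unfolding q_def by (simp_all del: power_Suc)
  define C where "C = 1 / (q - 1) + 1"
  have "real (Suc j) ^ Suc k \<le> C ^ Suc k * (3 / 2) ^ j" for j
  proof -
    have b: "1 + real j * (q - 1) \<le> q ^ j" using Bernoulli_inequality[of "q - 1" j] q by simp
    have "C * (1 + real j * (q - 1)) = 1 / (q - 1) + real j * (q - 1) + real (Suc j)"
      using q by (simp add: C_def field_simps)
    moreover have "1 / (q - 1) \<ge> 0" "real j * (q - 1) \<ge> 0" using q by simp_all
    ultimately have "real (Suc j) \<le> C * (1 + real j * (q - 1))" by linarith
    also have "\<dots> \<le> C * q ^ j" using b q by (intro mult_left_mono) (auto simp: C_def)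
    finally have "real (Suc j) ^ Suc k \<le> (C * q ^ j) ^ Suc k" by (intro power_mono) auto
    also have "\<dots> = C ^ Suc k * (q ^ Suc k) ^ j" by (simp only: power_mult_distrib power_mult[symmetric] mult.commute)
    finally show ?thesis by (simp only: q(1))
  qed
  thus ?thesis by blast
qed

lemma weight_fun_of_divisor_bound:
  assumes "\<alpha> > 0" "multiplicative f" "\<And>n. n \<ge> 1 \<Longrightarrow> f n \<ge> 0"
    and bound: "\<And>n. n \<ge> 1 \<Longrightarrow> f n \<le> real (divisor_fun k n)"
    and "\<And>p. prime p \<Longrightarrow> f p = \<alpha>"
  shows "\<exists>B. weight_fun f \<alpha> B"
proof -
  obtain B where B: "\<And>j. real (Suc j) ^ Suc k \<le> B * (3 / 2) ^ j" using power_le_exponential by blast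
  have "real (Suc j) * f (p ^ j) \<le> B * (3 / 2) ^ j" if p: "prime p" for p j
  proof -
    have "f (p ^ j) \<le> real (divisor_fun k (p ^ j))" using prime_gt_0_nat[OF p] by (intro bound) (simp add: Suc_le_eq)
    also have "\<dots> \<le> real (Suc j ^ k)" using divisor_fun_prime_power_le[OF p] by (rule of_nat_mono)
    also have "\<dots> = real (Suc j) ^ k" by (rule of_nat_power)
    finally have "real (Suc j) * f (p ^ j) \<le> real (Suc j) * real (Suc j) ^ k" by (rule mult_left_mono) simp
    also have "\<dots> = real (Suc j) ^ Suc k" by (rule power_Suc[symmetric])
    also note B
    finally show ?thesis .
  qed
  hence "weight_fun f \<alpha> B" by (intro weight_fun.intro) (use assms in auto)
  thus ?thesis ..
qed

section \<open>The central limit theorem for f and its refinement by the largest prime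
  factor\<close>

context weight_fun
begin

text \<open>A prime factor shifts the normalised Omega by 1 / sqrt (\<alpha> * ln ln x), which tends
  to 0; uniform continuity of F does the rest.\<close>

lemma omega_normalized_stable:
  fixes F :: "real \<Rightarrow> real"
  assumes cont: "continuous_on UNIV F" and supp: "\<And>u. \<bar>u\<bar> > R \<Longrightarrow> F u = 0" and K: "\<And>u. \<bar>F u\<bar> \<le> K" and e: "\<epsilon> > 0"
  shows "\<forall>\<^sub>F x in at_top. prime_stable (\<lambda>n. F (omega_normalized \<alpha> x n) - m) (K + \<bar>m\<bar>) \<epsilon>"
proof -
  obtain d where d: "d > 0" "\<And>u v. \<bar>u - v\<bar> < d \<Longrightarrow> \<bar>F u - F v\<bar> < \<epsilon>"
    using bounded_support_uniform[of F R, OF cont supp e] by blast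
  have "((\<lambda>x. 1 / sqrt (\<alpha> * ln (ln x))) \<longlongrightarrow> 0) at_top" using alpha_pos by real_asymp
  hence "\<forall>\<^sub>F x in at_top. \<bar>1 / sqrt (\<alpha> * ln (ln x))\<bar> < d"
    using d(1) tendstoD[of "\<lambda>x. 1 / sqrt (\<alpha> * ln (ln x))" 0 at_top d] by (simp only: dist_real_def diff_zero)
  thus ?thesis
  proof eventually_elim
    case (elim x)
    have b: "\<bar>F (omega_normalized \<alpha> x n) - m\<bar> \<le> K + \<bar>m\<bar>" for n
      using K[of "omega_normalized \<alpha> x n"] by linarith
    have s: "\<bar>(F (omega_normalized \<alpha> x (p * n)) - m) - (F (omega_normalized \<alpha> x n) - m)\<bar> \<le> \<epsilon>"
      if p: "prime p" and n: "n \<ge> 1" for p n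
    proof -
      have "prime_Omega (p * n) = Suc (prime_Omega n)"
        using prime_Omega_mult[of p n] prime_gt_0_nat[OF p] n prime_Omega_prime_power[OF p, of 1] by simp
      hence "omega_normalized \<alpha> x (p * n) - omega_normalized \<alpha> x n = 1 / sqrt (\<alpha> * ln (ln x))"
        unfolding omega_normalized_def by (simp flip: diff_divide_distrib)
      hence "\<bar>omega_normalized \<alpha> x (p * n) - omega_normalized \<alpha> x n\<bar> < d" using elim by simp
      from d(2)[OF this] show ?thesis by linarith
    qed
    show ?case unfolding prime_stable_def using e b s by simp
  qed
qed

text \<open>For y \<ge> x powr \<theta> one has ln ln y \<ge> ln ln x + ln \<theta>, so the centring
  \<alpha> * ln ln moves by at most the fixed amount c = -\<alpha> * ln \<theta>.\<close>

lemma omega_normalized_slow: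
  fixes F :: "real \<Rightarrow> real"
  assumes cont: "continuous_on UNIV F" and supp: "\<And>u. \<bar>u\<bar> > R \<Longrightarrow> F u = 0" and R: "R \<ge> 0"
    and e: "\<epsilon> > 0" and th: "0 < \<theta>" "\<theta> < 1"
  shows "\<forall>\<^sub>F x in at_top. \<forall>y. x powr \<theta> \<le> y \<longrightarrow> y \<le> x \<longrightarrow>
    (\<forall>n. \<bar>F (omega_normalized \<alpha> x n) - F (omega_normalized \<alpha> y n)\<bar> \<le> \<epsilon>)"
proof -
  define c where "c = - \<alpha> * ln \<theta>"
  have c: "c > 0" using th alpha_pos by (simp add: c_def mult_pos_neg)
  have "filterlim (\<lambda>x. \<alpha> * ln (ln x)) at_top at_top" using alpha_pos by real_asymp
  moreover have "\<forall>\<^sub>F L in at_top. \<forall>L' j. L - c \<le> L' \<longrightarrow> L' \<le> L \<longrightarrow> \<bar>F ((j - L) / sqrt L) - F ((j - L') / sqrt L')\<bar> \<le> \<epsilon>"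
    using cont supp e R c by (rule rescaling_close)
  ultimately have "\<forall>\<^sub>F x in at_top. \<forall>L' j. \<alpha> * ln (ln x) - c \<le> L' \<longrightarrow> L' \<le> \<alpha> * ln (ln x) \<longrightarrow>
      \<bar>F ((j - \<alpha> * ln (ln x)) / sqrt (\<alpha> * ln (ln x))) - F ((j - L') / sqrt L')\<bar> \<le> \<epsilon>"
    by (rule eventually_compose_filterlim[rotated])
  thus ?thesis using eventually_gt_at_top[of 1]
  proof eventually_elim
    case (elim x)
    show ?case
    proof (intro allI impI)
      fix y n assume y: "x powr \<theta> \<le> y" "y \<le> x"
      have lx: "ln x > 0" "x > 0" using elim(2) by auto
      have "x powr \<theta> > 0" using elim(2) by simp
      hence y0: "y > 0" using y by linarith
      have "ln (x powr \<theta>) \<le> ln y" using y \<open>x powr \<theta> > 0\<close> y0 by (subst ln_le_cancel_iff) auto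
      hence l1: "\<theta> * ln x \<le> ln y" using elim(2) by (simp add: ln_powr)
      have l2: "ln y \<le> ln x" using y y0 lx by (subst ln_le_cancel_iff) auto
      have t: "\<theta> * ln x > 0" using lx th by simp
      have "ln \<theta> + ln (ln x) = ln (\<theta> * ln x)" using lx th by (simp add: ln_mult)
      also have "\<dots> \<le> ln (ln y)" using l1 t by (subst ln_le_cancel_iff) linarith+
      finally have "\<alpha> * (ln \<theta> + ln (ln x)) \<le> \<alpha> * ln (ln y)" using alpha_pos by (intro mult_left_mono) auto
      hence a1: "\<alpha> * ln (ln x) - c \<le> \<alpha> * ln (ln y)" by (simp add: c_def algebra_simps)
      have "ln (ln y) \<le> ln (ln x)" using l1 l2 t by (subst ln_le_cancel_iff) linarith+
      hence a2: "\<alpha> * ln (ln y) \<le> \<alpha> * ln (ln x)" using alpha_pos by (intro mult_left_mono) auto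
      show "\<bar>F (omega_normalized \<alpha> x n) - F (omega_normalized \<alpha> y n)\<bar> \<le> \<epsilon>"
        unfolding omega_normalized_def using elim(1) a1 a2 by blast
    qed
  qed
qed

theorem Erdos_Kac:
  fixes F :: "real \<Rightarrow> real"
  assumes cont: "continuous_on UNIV F" and supp: "\<And>u. \<bar>u\<bar> > R \<Longrightarrow> F u = 0" and R: "R \<ge> 0" and K: "\<And>u. \<bar>F u\<bar> \<le> K"
  shows "((\<lambda>x. (\<Sum>n\<in>nats_le x. f n * F (omega_normalized \<alpha> x n)) / S x) \<longlongrightarrow> integral\<^sup>L std_normal_distribution F) at_top"
proof -
  define m where "m = integral\<^sup>L std_normal_distribution F"
  define H where "H = (\<lambda>x n. F (omega_normalized \<alpha> x n) - m)"
  have "((\<lambda>x. Sh (H x) x / S x) \<longlongrightarrow> 0) at_top"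
  proof (rule contraction)
    fix \<epsilon> :: real assume "\<epsilon> > 0"
    with cont supp K show "\<forall>\<^sub>F x in at_top. prime_stable (H x) (K + \<bar>m\<bar>) \<epsilon>"
      unfolding H_def by (rule omega_normalized_stable)
  next
    fix \<theta> \<epsilon> :: real assume "0 < \<theta>" "\<theta> < 1" "\<epsilon> > 0"
    hence "\<forall>\<^sub>F x in at_top. \<forall>y. x powr \<theta> \<le> y \<longrightarrow> y \<le> x \<longrightarrow>
      (\<forall>n. \<bar>F (omega_normalized \<alpha> x n) - F (omega_normalized \<alpha> y n)\<bar> \<le> \<epsilon>)"
      by (intro omega_normalized_slow[of F R, OF cont supp R])
    thus "\<forall>\<^sub>F x in at_top. \<forall>y. x powr \<theta> \<le> y \<longrightarrow> y \<le> x \<longrightarrow> (\<forall>n\<ge>1. \<bar>H x n - H y n\<bar> \<le> \<epsilon>)"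
      by eventually_elim (simp add: H_def)
  next
    show "((\<lambda>x. \<bar>W (H x) x\<bar> / (ell x * lp x)) \<longlongrightarrow> 0) at_top"
      unfolding H_def m_def using cont K by (intro W_small[of F K]) (auto simp: continuous_on_eq_continuous_at)
  qed
  hence "((\<lambda>x. Sh (H x) x / S x + m) \<longlongrightarrow> 0 + m) at_top" by (intro tendsto_intros)
  moreover have "\<forall>\<^sub>F x in at_top. Sh (H x) x / S x + m = (\<Sum>n\<in>nats_le x. f n * F (omega_normalized \<alpha> x n)) / S x"
    using eventually_ge_at_top[of 1]
  proof eventually_elim
    case (elim x)
    have "Sh (H x) x = (\<Sum>n\<in>nats_le x. f n * F (omega_normalized \<alpha> x n)) - m * S x"
      by (simp add: Sh_def H_def S_def right_diff_distrib sum_subtractf sum_distrib_left mult.commute)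
    thus ?case using S_ge_1[OF elim] by (simp add: diff_divide_distrib)
  qed
  ultimately have "((\<lambda>x. (\<Sum>n\<in>nats_le x. f n * F (omega_normalized \<alpha> x n)) / S x) \<longlongrightarrow> 0 + m) at_top"
    by (rule Lim_transform_eventually)
  thus ?thesis by (simp add: m_def)
qed

text \<open>The indicator of the largest prime factor lying in P is written as its deviation from
  \<delta> plus \<delta>: the deviation averages to 0 by equidistribution, the constant reduces to
  the theorem for all n.\<close>

theorem Erdos_Kac_largest_prime_factor:
  fixes F :: "real \<Rightarrow> real"
  assumes cont: "continuous_on UNIV F" and supp: "\<And>u. \<bar>u\<bar> > R \<Longrightarrow> F u = 0"
    and P: "P \<subseteq> {p. prime p}" "has_natural_density P \<delta>"
  shows "((\<lambda>x. (\<Sum>n\<in>{n\<in>nats_le x. largest_prime_factor n \<in> P}. f n * F (omega_normalized \<alpha> x n)) / S x)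
    \<longlongrightarrow> \<delta> * integral\<^sup>L std_normal_distribution F) at_top"
proof -
  \<comment> \<open>The bound R of the support may be negative, so its absolute value is
    used.\<close>
  define R' where "R' = \<bar>R\<bar>"
  have R': "R' \<ge> 0" "\<And>u. \<bar>u\<bar> > R' \<Longrightarrow> F u = 0" using supp by (auto simp: R'_def)
  have "compact (F ` {-R'..R'})" using cont by (intro compact_continuous_image) (auto intro: continuous_on_subset)
  then obtain K where K: "\<And>u. u \<in> {-R'..R'} \<Longrightarrow> norm (F u) \<le> K"
    using compact_imp_bounded bounded_iff by (metis imageI)
  have K': "\<bar>F u\<bar> \<le> \<bar>K\<bar>" for u
  proof (cases "\<bar>u\<bar> > R'")
    case False
    hence "u \<in> {-R'..R'}" by auto
    from K[OF this] show ?thesis by simp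
  qed (simp add: R')
  define T where "T = (\<lambda>x. (\<Sum>n\<in>nats_le x. f n * F (omega_normalized \<alpha> x n)))"
  define U where "U = (\<lambda>x. \<Sum>n\<in>nats_le x. f n * ((if largest_prime_factor n \<in> P then 1 else 0) - \<delta>) * F (omega_normalized \<alpha> x n))"
  have "((\<lambda>x. U x / S x) \<longlongrightarrow> 0) at_top"
    unfolding U_def omega_normalized_def by (rule largest_prime_factor_equidistribution[OF P]) (rule K')
  moreover have "((\<lambda>x. T x / S x) \<longlongrightarrow> integral\<^sup>L std_normal_distribution F) at_top"
    unfolding T_def by (rule Erdos_Kac[of F R', OF cont R'(2,1) K'])
  ultimately have "((\<lambda>x. U x / S x + \<delta> * (T x / S x)) \<longlongrightarrow> 0 + \<delta> * integral\<^sup>L std_normal_distribution F) at_top"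
    by (intro tendsto_intros)
  moreover have "(\<Sum>n\<in>{n\<in>nats_le x. largest_prime_factor n \<in> P}. f n * F (omega_normalized \<alpha> x n)) = U x + \<delta> * T x" for x
  proof -
    have "(\<Sum>n\<in>{n\<in>nats_le x. largest_prime_factor n \<in> P}. f n * F (omega_normalized \<alpha> x n))
        = (\<Sum>n\<in>nats_le x. if largest_prime_factor n \<in> P then f n * F (omega_normalized \<alpha> x n) else 0)"
      by (rule sum.inter_filter) simp
    also have "\<dots> = U x + \<delta> * T x"
      unfolding U_def T_def sum_distrib_left sum.distrib[symmetric] by (intro sum.cong) (auto simp: algebra_simps)
    finally show ?thesis .
  qed
  ultimately show ?thesis by (simp add: add_divide_distrib)
qed

end

theorem theorem1:
  fixes \<alpha> :: real and f :: "nat \<Rightarrow> real" and k :: nat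
    and F :: "real \<Rightarrow> complex" and S :: "nat set" and \<delta> :: real
  assumes "\<alpha> > 0"
    and "multiplicative f"
    and "\<And>n. n \<ge> 1 \<Longrightarrow> f n \<ge> 0"
    and "k \<ge> 1"
    and "\<And>n. n \<ge> 1 \<Longrightarrow> f n \<le> real (divisor_fun k n)"
    and "\<And>p. prime p \<Longrightarrow> f p = \<alpha>"
    and "continuous_on UNIV F"
    and "compact (closure {t. F t \<noteq> 0})"
    and "S \<subseteq> {p. prime p}"
    and "has_natural_density S \<delta>"
  shows "((\<lambda>x::real.
            inverse (complex_of_real (\<Sum>n | 1 \<le> n \<and> real n \<le> x. f n)) *
            (\<Sum>n | 1 \<le> n \<and> real n \<le> x \<and> largest_prime_factor n \<in> S.
               complex_of_real (f n) *
               F ((real (prime_Omega n) - \<alpha> * ln (ln x)) / sqrt (\<alpha> * ln (ln x)))))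
          \<longlongrightarrow>
          complex_of_real \<delta> *
          (complex_of_real (1 / sqrt (2 * pi)) *
           (LINT t|lborel. F t * complex_of_real (exp (- (t\<^sup>2) / 2))))) at_top"
proof -
  obtain B where "weight_fun f \<alpha> B"
    using weight_fun_of_divisor_bound[OF assms(1-3,5,6)] by blast
  then interpret weight_fun f \<alpha> B .
  let ?I = "LINT t|lborel. F t * complex_of_real (exp (- (t\<^sup>2) / 2))"
  have "bounded {t. F t \<noteq> 0}" using compact_imp_bounded[OF assms(8)] closure_subset by (rule bounded_subset)
  then obtain R where R: "\<forall>t\<in>{t. F t \<noteq> 0}. norm t \<le> R" unfolding bounded_iff ..
  have supp: "F t = 0" if "\<bar>t\<bar> > R" for t
  proof (rule ccontr)
    assume "F t \<noteq> 0"
    hence "norm t \<le> R" using R by simp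
    thus False using that by simp
  qed
  have "integrable lborel (\<lambda>t. indicator {-R..R} t *\<^sub>R (F t * complex_of_real (exp (- (t\<^sup>2) / 2))))"
    using continuous_on_subset[OF assms(7)] by (intro borel_integrable_compact continuous_intros) auto
  moreover have "(\<lambda>t. indicator {-R..R} t *\<^sub>R (F t * complex_of_real (exp (- (t\<^sup>2) / 2)))) = (\<lambda>t. F t * complex_of_real (exp (- (t\<^sup>2) / 2)))"
  proof
    fix t show "indicator {-R..R} t *\<^sub>R (F t * complex_of_real (exp (- (t\<^sup>2) / 2))) = F t * complex_of_real (exp (- (t\<^sup>2) / 2))"
      using supp[of t] by (cases "\<bar>t\<bar> > R") (auto simp: indicator_def)
  qed
  ultimately have int: "integrable lborel (\<lambda>t. F t * complex_of_real (exp (- (t\<^sup>2) / 2)))" by simp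
  \<comment> \<open>Real and imaginary parts are treated at once through G; the condition G 0 = 0
    preserves the support.\<close>
  have limit: "((\<lambda>x. (\<Sum>n | 1 \<le> n \<and> real n \<le> x \<and> largest_prime_factor n \<in> S.
      f n * G (F ((real (prime_Omega n) - \<alpha> * ln (ln x)) / sqrt (\<alpha> * ln (ln x))))) / (\<Sum>n | 1 \<le> n \<and> real n \<le> x. f n))
    \<longlongrightarrow> \<delta> * (1 / sqrt (2 * pi) * (LINT t|lborel. G (F t) * exp (- (t\<^sup>2) / 2)))) at_top"
    if G: "continuous_on UNIV (\<lambda>t. G (F t))" "G 0 = 0" for G :: "complex \<Rightarrow> real"
  proof -
    have m: "(\<lambda>t. G (F t)) \<in> borel_measurable borel" using G(1) by (rule borel_measurable_continuous_onI)
    show ?thesis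
      using Erdos_Kac_largest_prime_factor[of "\<lambda>t. G (F t)" R S \<delta>, OF G(1) _ assms(9,10)] supp G(2)
      unfolding integral_std_normal_distribution[OF m]
      by (simp add: nats_le_def omega_normalized_def weight_fun.S_def[OF weight_fun_axioms] conj_assoc)
  qed
  have c: "continuous_on UNIV (\<lambda>t. Re (F t))" "continuous_on UNIV (\<lambda>t. Im (F t))" using assms(7) by (intro continuous_intros; simp)+
  have I: "(LINT t|lborel. Re (F t) * exp (- (t\<^sup>2) / 2)) = Re ?I" "(LINT t|lborel. Im (F t) * exp (- (t\<^sup>2) / 2)) = Im ?I"
    using integral_Re[OF int] integral_Im[OF int] by simp_all
  have quot: "Re (inverse (complex_of_real s) * z) = Re z / s" "Im (inverse (complex_of_real s) * z) = Im z / s" for s z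
    by (simp_all only: of_real_inverse[symmetric] Re_complex_of_real Im_complex_of_real times_complex.sel divide_inverse
        mult_zero_left diff_zero add_0_right mult.commute[of "inverse s"])
  have mult: "Re (complex_of_real a * z) = a * Re z" "Im (complex_of_real a * z) = a * Im z" for a z
    by simp_all
  show ?thesis
    unfolding tendsto_complex_iff quot Re_sum Im_sum mult I[symmetric]
    using limit[of Re, OF c(1)] limit[of Im, OF c(2)] by simp
qed

end
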